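(* Let $T>0$, $d\ge 1$, and let $\mu=\{\mu_t\}_{0\le t\le T}$ be a continuous family of Borel probability measures on $\mathbb{R}^d$ with densities $p(t,x)=d\mu_t/dx$. Let $K:\mathbb{R}^{d+1}\to\mathbb{R}$ define the translation-invariant kernel $K(\xi,\eta)=K(\xi-\eta)$ with RKHS $\mathcal{H}$. Suppose: (A1) $K\in C(\mathbb{R}^{d+1})\cap L^1(\mathbb{R}^{d+1})$ is positive definite and $\mathcal{H}$ is universal on every compact subset of $[0,T]\times\mathbb{R}^d$, understood in the sense that $\mathrm{supp}\,\widehat K=\mathbb{R}^{d+1}$; (A2) $\int_{\mathbb{R}^{d+1}}(1+|z|^2)\widehat K(z)\,dz<\infty$; (A3) $p\in C([0,T];L^1(\mathbb{R}^d))\cap L^\infty([0,T]\times\mathbb{R}^d)$, each $p(t,\cdot)$ is a probability density on $\mathbb{R}^d$, and $\partial_tp\in L^1((0,T)\times\mathbb{R}^d)$ in the weak sense. For $u\in L^1([0,T]\times\mathbb{R}^d;\mathbb{R}^d,p(t,x)\,dt\,dx)$ and $s\in[0,T]$ define $$H_s^u(t,x):=\int_0^s\int_{\mathbb{R}^d}p(r,y)\,\mathcal{A}^u_{r,y}K(t,x,r,y)\,dy\,dr-\int_{\mathbb{R}^d}p(s,y)K(t,x,s,y)\,dy+\int_{\mathbb{R}^d}p(0,y)K(t,x,0,y)\,dy .$$ Then $H_s^u\in\mathcal{H}$ for every $s\in[0,T]$ and every $u\in L^1([0,T]\times\mathbb{R}^d;\mathbb{R}^d,p(t,x)\,dt\,dx)$.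 Moreover, for such $u$, one has $u\in\mathcal{U}_0$ if and only if $H_s^u=0$ for every $s\in[0,T]$.
   Context: Fourier transform: $\widehat K(z)=(2\pi)^{-(d+1)/2}\int_{\mathbb{R}^{d+1}}e^{-iz^{\mathsf T}\xi}K(\xi)\,d\xi$; under (A1), $\widehat K\ge0$. $\mathcal{H}$ is the real RKHS of functions on $\mathbb{R}^{d+1}$ (points written $(t,x)$, $t\in\mathbb{R}$, $x\in\mathbb{R}^d$) with reproducing kernel $K(t,x,s,y)=K((t,x)-(s,y))$. $L^q(A;\mathbb{R}^m,\nu)$ is the space of Borel functions $f:A\to\mathbb{R}^m$ with $\int_A|f|^q\,d\nu<\infty$. Operator: $\mathcal{A}^u\varphi=\partial_t\varphi+u^{\mathsf T}\nabla_x\varphi$; $\mathcal{A}^u_{r,y}$ means that $\mathcal{A}^u$ acts on the variable $(r,y)$ (with coefficient $u(r,y)$). Class $\mathcal{U}$: all $u\in L^1([0,T]\times\mathbb{R}^d;\mathbb{R}^d,p(t,x)\,dt\,dx)$ such that $\mathrm{div}_x(pu)\in L^1((0,T)\times\mathbb{R}^d)$ in the weak (distributional) sense. Class $\mathcal{U}_0$: all $u\in\mathcal{U}$ such that for every $\varphi\in C_b^1([0,T]\times\mathbb{R}^d)$ (bounded, $C^1$ with bounded first derivatives) and every $t\in[0,T]$, $$\int_{\mathbb{R}^d}\varphi(t,x)p(t,x)\,dx-\int_{\mathbb{R}^d}\varphi(0,x)p(0,x)\,dx=\int_0^t\int_{\mathbb{R}^d}\bigl(\partial_s\varphi+u(s,x)^{\mathsf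 T}\nabla_x\varphi\bigr)p(s,x)\,dx\,ds .$$ *)

theory Defs
  imports "HOL-Probability.Probability_Measure"
begin

definition fourier :: "('a::euclidean_space \<Rightarrow> real) \<Rightarrow> 'a \<Rightarrow> complex" where
  "fourier K z = complex_of_real ((2 * pi) powr (- real DIM('a) / 2)) *
     (LINT \<xi>|lborel. exp (- (\<i> * complex_of_real (z \<bullet> \<xi>))) * complex_of_real (K \<xi>))"

text \<open>Symmetry is demanded explicitly: with real coefficients it does not follow from the
  nonnegativity of the quadratic forms.\<close>

definition positive_definite :: "('a::real_vector \<Rightarrow> real) \<Rightarrow> bool" where
  "positive_definite K \<longleftrightarrow> (\<forall>\<xi>. K (- \<xi>) = K \<xi>) \<and>
     (\<forall>X c. finite X \<longrightarrow> 0 \<le> (\<Sum>\<xi>\<in>X. \<Sum>\<eta>\<in>X. c \<xi> * c \<eta> * K (\<xi> - \<eta>)))"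

text \<open>The real vector space \<open>H\<close> of functions with inner product \<open>ip\<close> is a Hilbert space with
  reproducing kernel \<open>k\<close>. Values of \<open>ip\<close> outside \<open>H\<close> are irrelevant. For every positive
  definite kernel exactly one such \<open>H\<close> exists (Moore--Aronszajn).\<close>

locale rkhs =
  fixes H :: "('x \<Rightarrow> real) set"
    and ip :: "('x \<Rightarrow> real) \<Rightarrow> ('x \<Rightarrow> real) \<Rightarrow> real"
    and k :: "'x \<Rightarrow> 'x \<Rightarrow> real"
  assumes zero_mem: "(\<lambda>_. 0) \<in> H"
    and add_mem: "\<And>f g. f \<in> H \<Longrightarrow> g \<in> H \<Longrightarrow> (\<lambda>x. f x + g x) \<in> H"
    and scale_mem: "\<And>c f. f \<in> H \<Longrightarrow> (\<lambda>x. c * f x) \<in> H"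
    and ip_commute: "\<And>f g. f \<in> H \<Longrightarrow> g \<in> H \<Longrightarrow> ip f g = ip g f"
    and ip_add: "\<And>f g h. f \<in> H \<Longrightarrow> g \<in> H \<Longrightarrow> h \<in> H \<Longrightarrow>
                   ip (\<lambda>x. f x + g x) h = ip f h + ip g h"
    and ip_scale: "\<And>c f g. f \<in> H \<Longrightarrow> g \<in> H \<Longrightarrow> ip (\<lambda>x. c * f x) g = c * ip f g"
    and ip_nonneg: "\<And>f. f \<in> H \<Longrightarrow> 0 \<le> ip f f"
    and ip_definite: "\<And>f. f \<in> H \<Longrightarrow> ip f f = 0 \<Longrightarrow> f = (\<lambda>_. 0)"
    and complete: "\<And>F :: nat \<Rightarrow> 'x \<Rightarrow> real.
        (\<And>n. F n \<in> H) \<Longrightarrow>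
        (\<And>e. e > 0 \<Longrightarrow> \<exists>N. \<forall>m\<ge>N. \<forall>n\<ge>N.
           sqrt (ip (\<lambda>x. F m x - F n x) (\<lambda>x. F m x - F n x)) < e) \<Longrightarrow>
        \<exists>f\<in>H. (\<lambda>n. sqrt (ip (\<lambda>x. F n x - f x) (\<lambda>x. F n x - f x))) \<longlonglongrightarrow> 0"
    and kernel_mem: "\<And>x. k x \<in> H"
    and reproducing: "\<And>f x. f \<in> H \<Longrightarrow> f x = ip f (k x)"

text \<open>The time derivative is relative to a set \<open>I\<close> of times, so that for functions on
  \<open>[0,T] \<times> R^d\<close> it is one-sided at \<open>0\<close> and \<open>T\<close>.\<close>

definition partial_t :: "real set \<Rightarrow> (real \<times> (real^'d) \<Rightarrow> real) \<Rightarrow> real \<times> (real^'d) \<Rightarrow> real" where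
  "partial_t I \<phi> = (\<lambda>(t, x). vector_derivative (\<lambda>s. \<phi> (s, x)) (at t within I))"

definition grad_x :: "(real \<times> (real^'d) \<Rightarrow> real) \<Rightarrow> real \<times> (real^'d) \<Rightarrow> real^'d" where
  "grad_x \<phi> = (\<lambda>(t, x). \<chi> i. frechet_derivative (\<lambda>y. \<phi> (t, y)) (at x) (axis i 1))"

definition transport_op :: "real set \<Rightarrow> (real \<times> (real^'d) \<Rightarrow> real^'d) \<Rightarrow>
    (real \<times> (real^'d) \<Rightarrow> real) \<Rightarrow> real \<times> (real^'d) \<Rightarrow> real" where
  "transport_op I u \<phi> z = partial_t I \<phi> z + u z \<bullet> grad_x \<phi> z"

primrec C_k :: "nat \<Rightarrow> ('a::euclidean_space \<Rightarrow> real) \<Rightarrow> bool" where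
  "C_k 0 f \<longleftrightarrow> continuous_on UNIV f"
| "C_k (Suc n) f \<longleftrightarrow>
     f differentiable_on UNIV \<and> (\<forall>v. C_k n (\<lambda>x. frechet_derivative f (at x) v))"

definition test_function :: "'a::euclidean_space set \<Rightarrow> ('a \<Rightarrow> real) \<Rightarrow> bool" where
  "test_function \<Omega> \<phi> \<longleftrightarrow> (\<forall>n. C_k n \<phi>) \<and>
     compact (closure {z. \<phi> z \<noteq> 0}) \<and> closure {z. \<phi> z \<noteq> 0} \<subseteq> \<Omega>"

definition weak_partial_t_in_L1 :: "(real \<times> (real^'d)) set \<Rightarrow> (real \<times> (real^'d) \<Rightarrow> real) \<Rightarrow> bool" where
  "weak_partial_t_in_L1 \<Omega> p \<longleftrightarrow> (\<exists>g. set_integrable lborel \<Omega> g \<and>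
     (\<forall>\<phi>. test_function \<Omega> \<phi> \<longrightarrow>
        (LINT z:\<Omega>|lborel. p z * partial_t UNIV \<phi> z) = - (LINT z:\<Omega>|lborel. g z * \<phi> z)))"

definition weak_div_x_in_L1 :: "(real \<times> (real^'d)) set \<Rightarrow> (real \<times> (real^'d) \<Rightarrow> real^'d) \<Rightarrow> bool" where
  "weak_div_x_in_L1 \<Omega> w \<longleftrightarrow> (\<exists>g. set_integrable lborel \<Omega> g \<and>
     (\<forall>\<phi>. test_function \<Omega> \<phi> \<longrightarrow>
        (LINT z:\<Omega>|lborel. w z \<bullet> grad_x \<phi> z) = - (LINT z:\<Omega>|lborel. g z * \<phi> z)))"

abbreviation slab :: "real \<Rightarrow> (real \<times> (real^'d)) set" where
  "slab T \<equiv> {0..T} \<times> UNIV"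

abbreviation open_slab :: "real \<Rightarrow> (real \<times> (real^'d)) set" where
  "open_slab T \<equiv> {0<..<T} \<times> UNIV"

definition C1_bounded :: "real \<Rightarrow> (real \<times> (real^'d) \<Rightarrow> real) \<Rightarrow> bool" where
  "C1_bounded T \<phi> \<longleftrightarrow> bounded (\<phi> ` slab T) \<and>
     (\<exists>D :: real \<times> (real^'d) \<Rightarrow> (real \<times> (real^'d)) \<Rightarrow>\<^sub>L real.
        (\<forall>z\<in>slab T. (\<phi> has_derivative blinfun_apply (D z)) (at z within slab T)) \<and>
        continuous_on (slab T) D \<and> bounded (D ` slab T))"

definition continuous_L1 :: "real \<Rightarrow> (real \<times> (real^'d) \<Rightarrow> real) \<Rightarrow> bool" where
  "continuous_L1 T p \<longleftrightarrow> (\<forall>t\<in>{0..T}. integrable lborel (\<lambda>x. p (t, x)) \<and>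
     ((\<lambda>s. LINT x|lborel. \<bar>p (s, x) - p (t, x)\<bar>) \<longlongrightarrow> 0) (at t within {0..T}))"

definition L_infinity :: "real \<Rightarrow> (real \<times> (real^'d) \<Rightarrow> real) \<Rightarrow> bool" where
  "L_infinity T p \<longleftrightarrow> p \<in> borel_measurable (restrict_space borel (slab T)) \<and>
     (\<exists>C. AE z in lborel. z \<in> slab T \<longrightarrow> \<bar>p z\<bar> \<le> C)"

text \<open>Integrability against this measure includes Borel measurability on \<open>[0,T] \<times> R^d\<close>.\<close>

definition L1_vec :: "real \<Rightarrow> (real \<times> (real^'d) \<Rightarrow> real) \<Rightarrow> (real \<times> (real^'d) \<Rightarrow> real^'d) set" where
  "L1_vec T p = {u. integrable (density (restrict_space lborel (slab T)) (\<lambda>z. ennreal (p z))) u}"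

definition class_U :: "real \<Rightarrow> (real \<times> (real^'d) \<Rightarrow> real) \<Rightarrow> (real \<times> (real^'d) \<Rightarrow> real^'d) set" where
  "class_U T p = {u \<in> L1_vec T p. weak_div_x_in_L1 (open_slab T) (\<lambda>z. p z *\<^sub>R u z)}"

definition class_U0 :: "real \<Rightarrow> (real \<times> (real^'d) \<Rightarrow> real) \<Rightarrow> (real \<times> (real^'d) \<Rightarrow> real^'d) set" where
  "class_U0 T p = {u \<in> class_U T p. \<forall>\<phi>. C1_bounded T \<phi> \<longrightarrow> (\<forall>t\<in>{0..T}.
     (LINT x|lborel. \<phi> (t, x) * p (t, x)) - (LINT x|lborel. \<phi> (0, x) * p (0, x)) =
     (LINT s:{0..t}|lborel. LINT x|lborel. transport_op {0..T} u \<phi> (s, x) * p (s, x)))}"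

definition narrowly_continuous :: "real \<Rightarrow> (real \<Rightarrow> (real^'d) measure) \<Rightarrow> bool" where
  "narrowly_continuous T \<mu> \<longleftrightarrow> (\<forall>f :: real^'d \<Rightarrow> real.
     continuous_on UNIV f \<and> bounded (range f) \<longrightarrow>
     continuous_on {0..T} (\<lambda>t. LINT x|\<mu> t. f x))"

definition residual :: "(real \<times> (real^'d) \<Rightarrow> real) \<Rightarrow> (real \<times> (real^'d) \<Rightarrow> real) \<Rightarrow>
    (real \<times> (real^'d) \<Rightarrow> real^'d) \<Rightarrow> real \<Rightarrow> real \<times> (real^'d) \<Rightarrow> real" where
  "residual K p u s \<xi> =
     (LINT r:{0..s}|lborel. LINT y|lborel.
        p (r, y) * transport_op UNIV u (\<lambda>\<eta>. K (\<xi> - \<eta>)) (r, y))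
     - (LINT y|lborel. p (s, y) * K (\<xi> - (s, y)))
     + (LINT y|lborel. p (0, y) * K (\<xi> - (0, y)))"

end

theory Submission
  imports Defs "HOL-Probability.Characteristic_Functions"
begin

text \<open>For fixed \<open>u\<close> and \<open>s\<close> the weak continuity equation on \<open>[0,s]\<close> says that a linear functional
  \<open>\<Lambda>\<close> of a test function and of its gradient vanishes, where \<open>\<Lambda>\<close> integrates against finite measures.
  The residual at \<open>\<xi>\<close> is the value of \<open>\<Lambda>\<close> at the translate \<open>K(\<xi> - \<cdot>)\<close>.

  Membership: Fourier inversion and (A2) make \<open>K\<close> continuously differentiable with
  \<open>K(0) - K(h) = O(|h|\<^sup>2)\<close>, so the reproducing property bounds values and gradients of the
  differentiable elements of the RKHS by their norm. Hence \<open>\<Lambda>\<close> is bounded on them, and its Riesz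
  representative is the residual.

  Vanishing: if \<open>\<Lambda>\<close> kills all translates of \<open>K\<close>, then averaging them against damped cosines shows
  that it kills every plane wave whose frequency lies in the support of the transform of \<open>K\<close>, hence
  by continuity all plane waves, hence all Gaussians, hence by mollification all integrable \<open>C\<^sup>1\<close>
  functions. A test function on the slab is approximated by globally defined ones.

  The transform of the even function \<open>K\<close> is real, so everything is done with cosines.\<close>

subsection \<open>Bounded functions with bounded continuous gradient\<close>

text \<open>A function and its gradient are carried as a pair. \<open>\<Lambda>\<close> sees the
  gradient only through an integrable field, so it is continuous under bounded pointwise convergence
  of pairs, even if the limiting gradient is a mere zero extension. The two halves of a pair need
  different modes of convergence: the terms at times 0 and \<open>s\<close> live on null sets of
  space-time, so values must converge at every point of these slices, whereas gradients may fail to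
  converge on a null set.

  Moving the derivative across a convolution uses that both factors are integrable. Plane waves are
  not, hence the damping.

  For membership it is enough to control the functional on the differentiable elements: they contain
  all translates of \<open>K\<close>, and the representative is evaluated against translates only.
  No curve in the Hilbert space has to be integrated.

  \<open>class_U0\<close> also asks for an integrable weak divergence of \<open>p u\<close>. It
  comes from (A3): tested with functions supported in the open slab, the continuity equation says
  that this divergence is minus the weak time derivative of \<open>p\<close>.\<close>

definition C1b :: "('a::euclidean_space \<Rightarrow> real) \<Rightarrow> ('a \<Rightarrow> 'a) \<Rightarrow> bool" where
  "C1b f G \<longleftrightarrow> (\<forall>x. (f has_derivative (\<lambda>h. G x \<bullet> h)) (at x)) \<and> continuous_on UNIV G \<and>
     (\<exists>B. \<forall>x. \<bar>f x\<bar> \<le> B) \<and> (\<exists>B. \<forall>x. norm (G x) \<le> B)"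

lemma C1b_deriv: "C1b f G \<Longrightarrow> (f has_derivative (\<lambda>h. G x \<bullet> h)) (at x)"
  and C1b_grad_continuous: "C1b f G \<Longrightarrow> continuous_on UNIV G"
  by (auto simp: C1b_def)

lemma C1b_continuous: "C1b f G \<Longrightarrow> continuous_on UNIV f"
  by (meson C1b_deriv continuous_at_imp_continuous_on has_derivative_continuous)

lemma C1b_bound:
  assumes "C1b f G"
  obtains B where "B \<ge> 0" "\<And>x. \<bar>f x\<bar> \<le> B" "\<And>x. norm (G x) \<le> B"
proof -
  obtain B1 B2 where "\<And>x. \<bar>f x\<bar> \<le> B1" "\<And>x. norm (G x) \<le> B2"
    using assms by (auto simp: C1b_def)
  then have "max B1 B2 \<ge> 0" "\<bar>f x\<bar> \<le> max B1 B2" "norm (G x) \<le> max B1 B2" for x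
    by (auto simp: le_max_iff_disj intro: order_trans[OF abs_ge_zero])
  then show ?thesis by (rule that)
qed

lemma C1b_measurable:
  assumes "C1b f G"
  shows "f \<in> borel_measurable borel" "G \<in> borel_measurable borel"
  using C1b_continuous[OF assms] C1b_grad_continuous[OF assms]
  by (simp_all add: borel_measurable_continuous_onI)

lemma C1bI:
  assumes "\<And>x. (f has_derivative (\<lambda>h. G x \<bullet> h)) (at x)" "continuous_on UNIV G"
    "\<And>x. \<bar>f x\<bar> \<le> B" "\<And>x. norm (G x) \<le> B'"
  shows "C1b f G"
  using assms by (auto simp: C1b_def)

text \<open>This is the device for exchanging gradient formulas: when one function is written as an
  integral in two ways, the two gradients found under the integral sign must agree.\<close>

lemma C1b_unique:
  assumes "C1b f G" "C1b f G'"
  shows "G = G'"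
proof
  fix x
  have "(\<lambda>h. G x \<bullet> h) = (\<lambda>h. G' x \<bullet> h)"
    using assms[THEN C1b_deriv, of x] by (rule has_derivative_unique)
  then show "G x = G' x"
    using vector_eq_rdot[of "G x" "G' x"] by metis
qed

lemma C1b_mult:
  assumes "C1b f F" "C1b g G"
  shows "C1b (\<lambda>x. f x * g x) (\<lambda>x. f x *\<^sub>R G x + g x *\<^sub>R F x)"
proof -
  obtain A where A: "A \<ge> 0" "\<And>x. \<bar>f x\<bar> \<le> A" "\<And>x. norm (F x) \<le> A"
    using C1b_bound[OF assms(1)] by metis
  obtain B where B: "B \<ge> 0" "\<And>x. \<bar>g x\<bar> \<le> B" "\<And>x. norm (G x) \<le> B"
    using C1b_bound[OF assms(2)] by metis
  show ?thesis
  proof (rule C1bI)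
    fix x
    show "((\<lambda>x. f x * g x) has_derivative (\<lambda>h. (f x *\<^sub>R G x + g x *\<^sub>R F x) \<bullet> h)) (at x)"
      by (rule has_derivative_eq_rhs[OF has_derivative_mult[OF assms[THEN C1b_deriv, of x]]])
        (auto simp: inner_add_left algebra_simps)
    show "\<bar>f x * g x\<bar> \<le> A * B"
      using A B by (simp add: abs_mult mult_mono)
    have "norm (f x *\<^sub>R G x + g x *\<^sub>R F x) \<le> \<bar>f x\<bar> * norm (G x) + \<bar>g x\<bar> * norm (F x)"
      by (rule order_trans[OF norm_triangle_ineq]) simp
    also have "\<dots> \<le> A * B + B * A"
      using A B by (intro add_mono mult_mono) auto
    finally show "norm (f x *\<^sub>R G x + g x *\<^sub>R F x) \<le> A * B + B * A" .
  next
    show "continuous_on UNIV (\<lambda>x. f x *\<^sub>R G x + g x *\<^sub>R F x)"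
      using assms[THEN C1b_continuous] assms[THEN C1b_grad_continuous]
      by (intro continuous_intros)
  qed
qed

lemma C1b_lincomb:
  assumes "C1b f F" "C1b g G"
  shows "C1b (\<lambda>x. a * f x + b * g x) (\<lambda>x. a *\<^sub>R F x + b *\<^sub>R G x)"
proof -
  obtain A where A: "A \<ge> 0" "\<And>x. \<bar>f x\<bar> \<le> A" "\<And>x. norm (F x) \<le> A"
    using C1b_bound[OF assms(1)] by metis
  obtain B where B: "B \<ge> 0" "\<And>x. \<bar>g x\<bar> \<le> B" "\<And>x. norm (G x) \<le> B"
    using C1b_bound[OF assms(2)] by metis
  show ?thesis
  proof (rule C1bI)
    fix x
    show "((\<lambda>x. a * f x + b * g x) has_derivative (\<lambda>h. (a *\<^sub>R F x + b *\<^sub>R G x) \<bullet> h)) (at x)"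
      by (rule has_derivative_eq_rhs[OF has_derivative_add[OF
            assms(1)[THEN C1b_deriv, of x, THEN has_derivative_mult_right]
            assms(2)[THEN C1b_deriv, of x, THEN has_derivative_mult_right]]])
        (auto simp: inner_add_left algebra_simps)
    show "\<bar>a * f x + b * g x\<bar> \<le> \<bar>a\<bar> * A + \<bar>b\<bar> * B"
      using A B by (intro order_trans[OF abs_triangle_ineq] add_mono) (auto simp: abs_mult mult_mono)
    show "norm (a *\<^sub>R F x + b *\<^sub>R G x) \<le> \<bar>a\<bar> * A + \<bar>b\<bar> * B"
      using A B by (intro order_trans[OF norm_triangle_ineq] add_mono) (auto simp: mult_mono)
  next
    show "continuous_on UNIV (\<lambda>x. a *\<^sub>R F x + b *\<^sub>R G x)"
      using assms[THEN C1b_grad_continuous] by (intro continuous_intros)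
  qed
qed

lemma C1b_translate:
  assumes "C1b f G"
  shows "C1b (\<lambda>x. f (x - w)) (\<lambda>x. G (x - w))"
proof -
  obtain B where B: "\<And>x. \<bar>f x\<bar> \<le> B" "\<And>x. norm (G x) \<le> B"
    using C1b_bound[OF assms] by metis
  show ?thesis
  proof (rule C1bI)
    fix x
    have "((\<lambda>x. x - w) has_derivative (\<lambda>h. h)) (at x)"
      by (auto intro!: derivative_eq_intros)
    from has_derivative_compose[OF this C1b_deriv[OF assms]]
    show "((\<lambda>x. f (x - w)) has_derivative (\<lambda>h. G (x - w) \<bullet> h)) (at x)" .
    show "continuous_on UNIV (\<lambda>x. G (x - w))"
      by (rule continuous_on_compose2[OF C1b_grad_continuous[OF assms]]) (auto intro!: continuous_intros)
  qed (use B in auto)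
qed

lemma C1b_cos: "C1b (\<lambda>x. cos (z \<bullet> x)) (\<lambda>x. - (sin (z \<bullet> x) *\<^sub>R z))"
proof (rule C1bI)
  show "\<bar>cos (z \<bullet> x)\<bar> \<le> 1" for x
    by simp
  show "norm (- (sin (z \<bullet> x) *\<^sub>R z)) \<le> norm z" for x
    using mult_right_mono[OF abs_sin_le_one, of "norm z"] by simp
  show "((\<lambda>x. cos (z \<bullet> x)) has_derivative (\<lambda>h. - (sin (z \<bullet> x) *\<^sub>R z) \<bullet> h)) (at x)" for x
    by (auto intro!: derivative_eq_intros)
qed (auto intro!: continuous_intros)

subsection \<open>Gaussians\<close>

abbreviation gauss :: "real \<Rightarrow> 'a::euclidean_space \<Rightarrow> real" where
  "gauss a x \<equiv> exp (- (a * (x \<bullet> x)))"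

text \<open>It follows from \<open>norm x \<le> 1 + x \<bullet> x\<close> and
  \<open>1 + t \<le> exp t\<close>. The point is uniformity: the bound stays finite as
  \<open>a\<close> tends to 0, so Gaussian cutoffs can be removed under dominated convergence of
  gradients.\<close>

lemma norm_mult_gauss_le:
  assumes "0 \<le> a"
  shows "a * norm x * gauss a x \<le> 1 + a"
proof -
  have "norm x \<le> 1 + x \<bullet> x"
  proof (cases "norm x \<le> 1")
    case False
    then have "norm x \<le> x \<bullet> x"
      using mult_left_mono[of 1 "norm x" "norm x"] by (simp add: dot_square_norm power2_eq_square)
    then show ?thesis by simp
  qed (simp add: add_increasing2)
  then have "a * norm x \<le> a * (1 + x \<bullet> x)"
    using assms by (rule mult_left_mono)
  also have "\<dots> \<le> (1 + a) * (1 + a * (x \<bullet> x))"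
    using assms by (simp add: algebra_simps)
  also have "\<dots> \<le> (1 + a) * exp (a * (x \<bullet> x))"
    using assms by (intro mult_left_mono exp_ge_add_one_self) auto
  finally show ?thesis
    by (simp add: exp_minus field_simps)
qed

lemma gauss_grad_bound:
  assumes "0 \<le> a"
  shows "norm (- ((2 * a * gauss a x) *\<^sub>R x)) \<le> 2 * (1 + a)"
  using norm_mult_gauss_le[OF assms, of x] assms by (simp add: abs_mult algebra_simps)

lemma C1b_gauss:
  assumes "0 \<le> a"
  shows "C1b (gauss a) (\<lambda>x. - ((2 * a * gauss a x) *\<^sub>R x))"
proof (rule C1bI)
  fix x :: 'a
  show "(gauss a has_derivative (\<lambda>h. - ((2 * a * gauss a x) *\<^sub>R x) \<bullet> h)) (at x)"
    by (auto intro!: derivative_eq_intros ext simp: inner_commute algebra_simps)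
  show "\<bar>gauss a x\<bar> \<le> 1"
    using assms by simp
  show "norm (- ((2 * a * gauss a x) *\<^sub>R x)) \<le> 2 * (1 + a)"
    using assms by (rule gauss_grad_bound)
qed (intro continuous_intros)

section \<open>Affine changes of variables and the Fourier transform of Gaussians\<close>

lemma integrable_lborel_affine:
  fixes f :: "'a::euclidean_space \<Rightarrow> 'b::euclidean_space"
  assumes "c \<noteq> 0" "integrable lborel f"
  shows "integrable lborel (\<lambda>x. f (t + c *\<^sub>R x))"
proof -
  have [measurable]: "f \<in> borel_measurable borel"
    using assms(2) by auto
  have "integrable (density (distr lborel borel (\<lambda>x. t + c *\<^sub>R x)) (\<lambda>_. \<bar>c\<bar>^DIM('a))) f"
    using assms(2) lborel_affine[OF assms(1), of t] by simp
  then have "integrable lborel (\<lambda>x. \<bar>c\<bar> ^ DIM('a) *\<^sub>R f (t + c *\<^sub>R x))"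
    by (subst (asm) integrable_density) (auto simp: integrable_distr_eq)
  then have "integrable lborel (\<lambda>x. (1 / \<bar>c\<bar> ^ DIM('a)) *\<^sub>R (\<bar>c\<bar> ^ DIM('a) *\<^sub>R f (t + c *\<^sub>R x)))"
    by (rule integrable_scaleR_right)
  then show ?thesis
    using assms(1) by simp
qed

lemma integral_lborel_affine:
  fixes f :: "'a::euclidean_space \<Rightarrow> 'b::euclidean_space"
  assumes "c \<noteq> 0" "f \<in> borel_measurable borel"
  shows "(LINT x|lborel. f x) = \<bar>c\<bar>^DIM('a) *\<^sub>R (LINT x|lborel. f (t + c *\<^sub>R x))"
  using assms by (subst lborel_affine[OF assms(1), of t])
    (auto simp: integral_density integral_distr)

lemma integral_lborel_reflect:
  fixes f :: "'a::euclidean_space \<Rightarrow> 'b::euclidean_space"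
  assumes "f \<in> borel_measurable borel"
  shows "(LINT x|lborel. f (t - x)) = (LINT x|lborel. f x)"
  using integral_lborel_affine[OF _ assms, of "-1" t] by simp

text \<open>Lebesgue measure is the image of a product of one-dimensional ones and the integrand
  factors over the coordinates; each factor is the characteristic function of the standard normal
  distribution. The cosine is the real part of the complex exponential.\<close>

lemma gaussian_fourier_std:
  fixes \<xi> :: "'a::euclidean_space"
  shows "integrable lborel (gauss (1/2) :: 'a \<Rightarrow> real)"
    "(LINT z|lborel. cos (z \<bullet> \<xi>) * gauss (1/2) z) = (sqrt (2 * pi)) ^ DIM('a) * gauss (1/2) \<xi>"
proof -
  interpret product_sigma_finite "\<lambda>_::'a. lborel :: real measure" ..
  let ?n = "std_normal_density :: real \<Rightarrow> real"
  define f where "f b x = complex_of_real (?n x) * iexp ((\<xi> \<bullet> b) * x)" for b :: 'a and x :: real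
  have intf: "integrable lborel (f b)" for b
  proof -
    have "integrable lborel ?n"
      using integrable_std_normal_moment[of 0] by simp
    then show ?thesis
      unfolding f_def by (rule Bochner_Integration.integrable_bound) (auto simp: norm_mult)
  qed
  have If: "(LINT x|lborel. f b x) = complex_of_real (exp (- ((\<xi> \<bullet> b)\<^sup>2) / 2))" for b
  proof -
    have "char std_normal_distribution (\<xi> \<bullet> b) = (LINT x|lborel. f b x)"
      unfolding char_def f_def
      by (subst integral_density) (auto simp: normal_density_nonneg scaleR_conv_of_real)
    then show ?thesis by (simp add: char_std_normal_distribution)
  qed
  have prod: "(\<Prod>b\<in>Basis. f b (z \<bullet> b)) =
      complex_of_real ((1 / sqrt (2 * pi)) ^ DIM('a) * gauss (1/2) z) * iexp (z \<bullet> \<xi>)" for z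
  proof -
    have "(\<Prod>b\<in>Basis. f b (z \<bullet> b)) =
        complex_of_real (\<Prod>b\<in>Basis. ?n (z \<bullet> b)) * (\<Prod>b\<in>(Basis::'a set). iexp ((\<xi> \<bullet> b) * (z \<bullet> b)))"
      by (simp add: f_def prod.distrib)
    also have "(\<Prod>b\<in>(Basis::'a set). iexp ((\<xi> \<bullet> b) * (z \<bullet> b))) = iexp (z \<bullet> \<xi>)"
      by (subst exp_sum[symmetric], simp)
        (simp add: euclidean_inner[of z \<xi>] mult.commute sum_distrib_left)
    also have "(\<Prod>b\<in>(Basis::'a set). ?n (z \<bullet> b)) = (1 / sqrt (2 * pi)) ^ DIM('a) * gauss (1/2) z"
      unfolding std_normal_density_def
      by (simp add: prod.distrib prod_dividef power_divide flip: exp_sum sum_divide_distrib sum_negf)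
        (simp add: euclidean_inner[of z z] power2_eq_square sum_divide_distrib sum_negf)
    finally show ?thesis .
  qed
  have eq: "lborel = distr (\<Pi>\<^sub>M b\<in>Basis. lborel) borel (\<lambda>f. \<Sum>b\<in>Basis. f b *\<^sub>R (b::'a))"
    by (rule lborel_eq)
  have inner: "(\<Sum>b\<in>Basis. y b *\<^sub>R b) \<bullet> c = y c" if "c \<in> Basis" for y :: "'a \<Rightarrow> real" and c
    using that by simp
  have meas: "(\<lambda>z::'a. \<Prod>b\<in>Basis. f b (z \<bullet> b)) \<in> borel_measurable borel"
    unfolding prod by measurable
  have m2: "(\<lambda>y. \<Sum>b\<in>Basis. y b *\<^sub>R (b::'a)) \<in> (\<Pi>\<^sub>M b\<in>Basis. lborel) \<rightarrow>\<^sub>M borel"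
    by measurable
  have int: "integrable lborel (\<lambda>z::'a. \<Prod>b\<in>Basis. f b (z \<bullet> b))"
    unfolding eq using product_integrable_prod[of Basis f, OF _ intf]
    by (subst integrable_distr_eq[OF m2 meas]) (simp cong: prod.cong)
  have I: "(LINT z|lborel. (\<Prod>b\<in>Basis. f b (z \<bullet> b))) = (\<Prod>b\<in>Basis. complex_of_real (exp (- ((\<xi> \<bullet> b)\<^sup>2) / 2)))"
    unfolding eq using product_integral_prod[of Basis f, OF _ intf]
    by (subst integral_distr[OF m2 meas]) (simp add: If cong: prod.cong)
  \<comment> \<open>The phases have modulus 1, so the norm of the integrable product is the Gaussian
    itself up to a constant.\<close>
  have "norm (\<Prod>b\<in>Basis. f b (z \<bullet> b)) = (1 / sqrt (2 * pi)) ^ DIM('a) * gauss (1/2) z" for z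
    unfolding prod norm_mult norm_of_real by simp
  then have "integrable lborel (\<lambda>z::'a. (1 / sqrt (2 * pi)) ^ DIM('a) * gauss (1/2) z)"
    using integrable_norm[OF int] by simp
  then show "integrable lborel (gauss (1/2) :: 'a \<Rightarrow> real)"
    using integrable_mult_right[of "sqrt (2 * pi) ^ DIM('a)" lborel "\<lambda>z::'a. (1 / sqrt (2 * pi)) ^ DIM('a) * gauss (1/2) z"]
    by (simp add: power_divide)
  have "Re (LINT z|lborel. (\<Prod>b\<in>Basis. f b (z \<bullet> b))) = (LINT z|lborel. Re (\<Prod>b\<in>Basis. f b (z \<bullet> b)))"
    using int by simp
  also have "\<dots> = (1 / sqrt (2 * pi)) ^ DIM('a) * (LINT z|lborel. cos (z \<bullet> \<xi>) * gauss (1/2) z)"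
    unfolding prod by (subst integral_mult_right_zero[symmetric])
       (rule Bochner_Integration.integral_cong, auto simp: exp_eq_polar Re_exp)
  finally have "(1 / sqrt (2 * pi)) ^ DIM('a) * (LINT z|lborel. cos (z \<bullet> \<xi>) * gauss (1/2) z)
       = Re (\<Prod>b\<in>(Basis::'a set). complex_of_real (exp (- ((\<xi> \<bullet> b)\<^sup>2) / 2)))"
    by (simp add: I)
  also have "\<dots> = gauss (1/2) \<xi>"
    by (simp flip: of_real_prod exp_sum)
       (simp add: euclidean_inner[of \<xi> \<xi>] power2_eq_square sum_divide_distrib sum_negf)
  finally show "(LINT z|lborel. cos (z \<bullet> \<xi>) * gauss (1/2) z) = (sqrt (2 * pi)) ^ DIM('a) * gauss (1/2) \<xi>"
    by (simp add: field_simps power_divide)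
qed

lemma gaussian_fourier:
  fixes \<xi> :: "'a::euclidean_space"
  assumes "r > 0"
  shows "integrable lborel (gauss (r\<^sup>2 / 2) :: 'a \<Rightarrow> real)"
    "(LINT z|lborel. cos (z \<bullet> \<xi>) * gauss (r\<^sup>2 / 2) z) =
       (sqrt (2 * pi) / r) ^ DIM('a) * gauss (1/2) (\<xi> /\<^sub>R r)"
proof -
  have g: "gauss (r\<^sup>2 / 2) z = gauss (1/2) (0 + r *\<^sub>R z)" for z :: 'a
    by (simp add: power2_eq_square)
  show "integrable lborel (gauss (r\<^sup>2 / 2) :: 'a \<Rightarrow> real)"
    unfolding g using assms gaussian_fourier_std(1) by (intro integrable_lborel_affine) auto
  have "(LINT z|lborel. cos (z \<bullet> (\<xi> /\<^sub>R r)) * gauss (1/2) z) =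
      \<bar>r\<bar> ^ DIM('a) *\<^sub>R (LINT z|lborel. cos ((0 + r *\<^sub>R z) \<bullet> (\<xi> /\<^sub>R r)) * gauss (1/2) (0 + r *\<^sub>R z))"
    using assms by (intro integral_lborel_affine) auto
  also have "(\<lambda>z. cos ((0 + r *\<^sub>R z) \<bullet> (\<xi> /\<^sub>R r))) = (\<lambda>z. cos (z \<bullet> \<xi>))"
    using assms by (simp flip: mult.assoc)
  finally have "(LINT z|lborel. cos (z \<bullet> (\<xi> /\<^sub>R r)) * gauss (1/2) z) =
      r ^ DIM('a) * (LINT z|lborel. cos (z \<bullet> \<xi>) * gauss (r\<^sup>2 / 2) z)"
    unfolding g using assms by simp
  then show "(LINT z|lborel. cos (z \<bullet> \<xi>) * gauss (r\<^sup>2 / 2) z) =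
       (sqrt (2 * pi) / r) ^ DIM('a) * gauss (1/2) (\<xi> /\<^sub>R r)"
    using assms unfolding gaussian_fourier_std(2) by (simp add: field_simps power_divide)
qed

lemma integrable_gauss:
  assumes "a > 0"
  shows "integrable lborel (gauss a :: 'a::euclidean_space \<Rightarrow> real)"
  using gaussian_fourier(1)[of "sqrt (2 * a)"] assms by simp


subsection \<open>Integrals depending on a parameter\<close>

lemma norm_integral_le_integral:
  fixes f :: "'m \<Rightarrow> 'a::euclidean_space"
  assumes "integrable M f" "integrable M B" "\<And>m. norm (f m) \<le> B m"
  shows "norm (\<integral>m. f m \<partial>M) \<le> (\<integral>m. B m \<partial>M)"
  by (rule order_trans[OF integral_norm_bound]) (intro integral_mono integrable_norm assms)

text \<open>Differentiation under the integral sign. One majorant serves values and gradients: by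
  the mean value inequality it also dominates the remainder quotients, whose limit is then taken
  along sequences.\<close>

lemma C1b_integral:
  fixes f :: "'m \<Rightarrow> 'a::euclidean_space \<Rightarrow> real"
  assumes D: "\<And>m. C1b (f m) (G m)"
    and bf: "\<And>m x. \<bar>f m x\<bar> \<le> B m" and bG: "\<And>m x. norm (G m x) \<le> B m"
    and B: "integrable M B"
    and [measurable]: "\<And>x. (\<lambda>m. f m x) \<in> borel_measurable M" "\<And>x. (\<lambda>m. G m x) \<in> borel_measurable M"
  shows "C1b (\<lambda>x. \<integral>m. f m x \<partial>M) (\<lambda>x. \<integral>m. G m x \<partial>M)"
proof (rule C1bI)
  have [measurable]: "B \<in> borel_measurable M" using B by auto
  have If: "integrable M (\<lambda>m. f m x)" and IG: "integrable M (\<lambda>m. G m x)" for x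
    by (rule Bochner_Integration.integrable_bound[OF B]; simp; intro AE_I2 order_trans[OF _ abs_ge_self] bf bG)+
  show "\<bar>\<integral>m. f m x \<partial>M\<bar> \<le> integral\<^sup>L M B" for x
    using norm_integral_le_integral[OF If[of x] B] bf by simp
  show "norm (\<integral>m. G m x \<partial>M) \<le> integral\<^sup>L M B" for x
    using norm_integral_le_integral[OF IG[of x] B] bG by simp
  show "continuous_on UNIV (\<lambda>x. \<integral>m. G m x \<partial>M)"
    unfolding continuous_on_sequentially
  proof (safe, simp add: comp_def)
    fix X :: "nat \<Rightarrow> 'a" and x assume X: "X \<longlonglongrightarrow> x"
    show "(\<lambda>n. \<integral>m. G m (X n) \<partial>M) \<longlonglongrightarrow> (\<integral>m. G m x \<partial>M)"
    proof (rule integral_dominated_convergence[OF _ _ B])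
      show "AE m in M. (\<lambda>n. G m (X n)) \<longlonglongrightarrow> G m x"
      proof (rule AE_I2)
        fix m
        have "isCont (G m) x"
          using C1b_grad_continuous[OF D] by (simp add: continuous_on_eq_continuous_at)
        then show "(\<lambda>n. G m (X n)) \<longlonglongrightarrow> G m x"
          using X by (rule isCont_tendsto_compose)
      qed
    qed (use bG in auto)
  qed
  fix x :: 'a
  let ?D = "\<lambda>m y. f m y - f m x - G m x \<bullet> (y - x)"
  have lip: "\<bar>f m y - f m x\<bar> \<le> B m * norm (y - x)" for m y
  proof -
    have "norm (f m y - f m x) \<le> B m * norm (y - x)"
    proof (rule differentiable_bound[of UNIV])
      show "(f m has_derivative (\<lambda>h. G m z \<bullet> h)) (at z within UNIV)" for z
        using C1b_deriv[OF D] by simp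
      show "onorm (\<lambda>h. G m z \<bullet> h) \<le> B m" for z
      proof (rule onorm_le)
        fix h show "norm (G m z \<bullet> h) \<le> B m * norm h"
          using mult_right_mono[OF bG[of m z], of "norm h"] Cauchy_Schwarz_ineq2[of "G m z" h] by simp
      qed
    qed auto
    then show ?thesis by simp
  qed
  have lip2: "\<bar>G m x \<bullet> (y - x)\<bar> \<le> B m * norm (y - x)" for m y
    using mult_right_mono[OF bG[of m x], of "norm (y - x)"] Cauchy_Schwarz_ineq2[of "G m x" "y - x"] by simp
  \<comment> \<open>At \<open>y = x\<close> the quotient is 0 by the convention on division, and the
    bound on values only supplies \<open>0 \<le> B m\<close>.\<close>
  have qb: "\<bar>?D m y / norm (y - x)\<bar> \<le> 2 * B m" for m y
  proof (cases "y = x")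
    case True
    then show ?thesis using bf[of m x] by simp
  next
    case False
    have "\<bar>?D m y\<bar> \<le> 2 * B m * norm (y - x)"
      using lip[of m y] lip2[of m y] by (simp add: algebra_simps)
    then show ?thesis using False by (simp add: divide_le_eq)
  qed
  show "((\<lambda>x. \<integral>m. f m x \<partial>M) has_derivative (\<lambda>h. (\<integral>m. G m x \<partial>M) \<bullet> h)) (at x)"
    unfolding has_derivative_iff_norm
  proof
    show "bounded_linear (\<lambda>h. (\<integral>m. G m x \<partial>M) \<bullet> h)"
      by (rule bounded_linear_inner_right)
    show "((\<lambda>y. norm ((\<integral>m. f m y \<partial>M) - (\<integral>m. f m x \<partial>M) - (\<integral>m. G m x \<partial>M) \<bullet> (y - x)) / norm (y - x)) \<longlongrightarrow> 0) (at x)"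
      unfolding tendsto_at_iff_sequentially comp_def
    proof (intro allI impI)
      fix X :: "nat \<Rightarrow> 'a" assume neq: "\<forall>i. X i \<in> UNIV - {x}" and X: "X \<longlonglongrightarrow> x"
      have eq: "norm ((\<integral>m. f m (X n) \<partial>M) - (\<integral>m. f m x \<partial>M) - (\<integral>m. G m x \<partial>M) \<bullet> (X n - x)) / norm (X n - x)
         = \<bar>\<integral>m. ?D m (X n) / norm (X n - x) \<partial>M\<bar>" for n
        using If IG by (simp add: abs_divide)
      have "(\<lambda>n. \<integral>m. ?D m (X n) / norm (X n - x) \<partial>M) \<longlonglongrightarrow> (\<integral>m. 0 \<partial>M)"
      proof (rule integral_dominated_convergence[where w="\<lambda>m. 2 * B m"])
        show "AE m in M. (\<lambda>n. ?D m (X n) / norm (X n - x)) \<longlonglongrightarrow> 0"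
        proof (rule AE_I2)
          fix m
          have "((\<lambda>y. norm (?D m y) / norm (y - x)) \<longlongrightarrow> 0) (at x)"
            using C1b_deriv[OF D, of m x] unfolding has_derivative_iff_norm by blast
          then have "(\<lambda>n. norm (?D m (X n)) / norm (X n - x)) \<longlonglongrightarrow> 0"
            using neq X unfolding tendsto_at_iff_sequentially comp_def by blast
          then have "(\<lambda>n. \<bar>?D m (X n) / norm (X n - x)\<bar>) \<longlonglongrightarrow> 0"
            by (simp add: abs_divide)
          then show "(\<lambda>n. ?D m (X n) / norm (X n - x)) \<longlonglongrightarrow> 0"
            by (rule tendsto_rabs_zero_cancel)
        qed
      qed (use B qb in auto)
      then have "(\<lambda>n. \<bar>\<integral>m. ?D m (X n) / norm (X n - x) \<partial>M\<bar>) \<longlonglongrightarrow> 0"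
        by (intro tendsto_rabs_zero) simp
      then show "(\<lambda>n. norm ((\<integral>m. f m (X n) \<partial>M) - (\<integral>m. f m x \<partial>M) - (\<integral>m. G m x \<partial>M) \<bullet> (X n - x)) / norm (X n - x)) \<longlonglongrightarrow> 0"
        unfolding eq .
    qed
  qed
qed


section \<open>Fubini's theorem under product bounds\<close>

lemma integrable_pair_dominated:
  fixes f :: "'x \<times> 'y \<Rightarrow> 'e::euclidean_space"
  assumes "sigma_finite_measure M" "sigma_finite_measure N"
    and g: "integrable M g" and h: "integrable N h"
    and f: "f \<in> borel_measurable (M \<Otimes>\<^sub>M N)"
    and bound: "\<And>x y. norm (f (x, y)) \<le> g x * h y"
  shows "integrable (M \<Otimes>\<^sub>M N) f"
proof -
  interpret pair_sigma_finite M N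
    using assms(1,2) by (simp add: pair_sigma_finite_def)
  have [measurable]: "g \<in> borel_measurable M" "h \<in> borel_measurable N"
    using g h by auto
  have "integrable (M \<Otimes>\<^sub>M N) (\<lambda>z. g (fst z) * h (snd z))"
  proof (rule Fubini_integrable)
    show "integrable M (\<lambda>x. \<integral>y. norm (g (fst (x, y)) * h (snd (x, y))) \<partial>N)"
      using g h by (simp add: abs_mult)
    show "AE x in M. integrable N (\<lambda>y. g (fst (x, y)) * h (snd (x, y)))"
      using h by simp
  qed measurable
  then show ?thesis
    by (rule Bochner_Integration.integrable_bound[OF _ f])
      (use order_trans[OF bound abs_ge_self] in \<open>auto intro!: AE_I2\<close>)
qed

lemma integral_swap_dominated:
  fixes f :: "'x \<Rightarrow> 'y \<Rightarrow> 'e::euclidean_space"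
  assumes "sigma_finite_measure M" "sigma_finite_measure N"
    and "integrable M g" and "integrable N h"
    and "case_prod f \<in> borel_measurable (M \<Otimes>\<^sub>M N)"
    and "\<And>x y. norm (f x y) \<le> g x * h y"
  shows "(\<integral>x. \<integral>y. f x y \<partial>N \<partial>M) = (\<integral>y. \<integral>x. f x y \<partial>M \<partial>N)"
proof -
  interpret pair_sigma_finite M N
    using assms(1,2) by (simp add: pair_sigma_finite_def)
  show ?thesis
    using assms by (intro Fubini_integral[symmetric] integrable_pair_dominated[of M N g h]) auto
qed

text \<open>Stated with the inner product so that it covers both vector fields and scalar densities,
  for which the inner product is multiplication.\<close>

lemma integrable_inner_bounded:
  fixes W G :: "'m \<Rightarrow> 'e::euclidean_space"
  assumes W: "integrable M W" and [measurable]: "G \<in> borel_measurable M"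
    and B: "\<And>m. norm (G m) \<le> B"
  shows "integrable M (\<lambda>m. W m \<bullet> G m)"
    "\<bar>\<integral>m. W m \<bullet> G m \<partial>M\<bar> \<le> (\<integral>m. norm (W m) \<partial>M) * B"
proof -
  have [measurable]: "W \<in> borel_measurable M" using W by auto
  have b: "norm (W m \<bullet> G m) \<le> norm (W m) * B" for m
    using order_trans[OF Cauchy_Schwarz_ineq2 mult_left_mono[OF B norm_ge_zero]] by simp
  have i: "integrable M (\<lambda>m. norm (W m) * B)"
    using W by simp
  show 1: "integrable M (\<lambda>m. W m \<bullet> G m)"
    by (rule Bochner_Integration.integrable_bound[OF i])
      (use order_trans[OF b abs_ge_self] in \<open>auto intro!: AE_I2\<close>)
  show "\<bar>\<integral>m. W m \<bullet> G m \<partial>M\<bar> \<le> (\<integral>m. norm (W m) \<partial>M) * B"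
    using norm_integral_le_integral[OF 1 i b] by simp
qed

lemma integral_inner_swap:
  fixes k :: "'x::euclidean_space \<Rightarrow> 'y::euclidean_space \<Rightarrow> 'e::euclidean_space"
  assumes W: "integrable lborel W" and \<kappa>: "integrable lborel \<kappa>"
    and k[measurable]: "case_prod k \<in> borel_measurable (borel \<Otimes>\<^sub>M borel)"
    and bound: "\<And>\<xi> y. norm (k \<xi> y) \<le> \<kappa> \<xi>"
  shows "integrable lborel (\<lambda>\<xi>. LINT y|lborel. W y \<bullet> k \<xi> y)"
    "(LINT \<xi>|lborel. LINT y|lborel. W y \<bullet> k \<xi> y) = (LINT y|lborel. W y \<bullet> (LINT \<xi>|lborel. k \<xi> y))"
proof -
  have [measurable]: "W \<in> borel_measurable borel" using W by auto
  have b: "norm (W y \<bullet> k \<xi> y) \<le> \<kappa> \<xi> * norm (W y)" for \<xi> y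
    using order_trans[OF Cauchy_Schwarz_ineq2 mult_left_mono[OF bound norm_ge_zero], of "W y" \<xi> y]
    by (simp add: mult.commute)
  have m: "(\<lambda>(\<xi>, y). W y \<bullet> k \<xi> y) \<in> borel_measurable (lborel \<Otimes>\<^sub>M lborel)"
    unfolding case_prod_beta using k by (auto simp: case_prod_beta intro!: borel_measurable_inner)
  have "integrable (lborel \<Otimes>\<^sub>M lborel) (\<lambda>(\<xi>, y). W y \<bullet> k \<xi> y)"
    by (rule integrable_pair_dominated[OF lborel.sigma_finite_measure_axioms
          lborel.sigma_finite_measure_axioms \<kappa> integrable_norm[OF W] m]) (simp add: b del: norm_conv_dist real_norm_def)
  from lborel_pair.integrable_fst'[OF this]
  show "integrable lborel (\<lambda>\<xi>. LINT y|lborel. W y \<bullet> k \<xi> y)"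
    by simp
  have "integrable lborel (\<lambda>\<xi>. k \<xi> y)" for y
    by (rule Bochner_Integration.integrable_bound[OF \<kappa>])
      (use order_trans[OF bound abs_ge_self] in \<open>auto intro!: AE_I2\<close>)
  then show "(LINT \<xi>|lborel. LINT y|lborel. W y \<bullet> k \<xi> y) = (LINT y|lborel. W y \<bullet> (LINT \<xi>|lborel. k \<xi> y))"
    using integral_swap_dominated[OF lborel.sigma_finite_measure_axioms
          lborel.sigma_finite_measure_axioms \<kappa> integrable_norm[OF W] m b]
    by simp
qed

subsection \<open>The cosine transform\<close>

text \<open>The Fourier transform of an even function without its normalising power of
  \<open>2 * pi\<close>, which therefore reappears in full in the inversion formula.\<close>

definition cos_transform :: "('a::euclidean_space \<Rightarrow> real) \<Rightarrow> 'a \<Rightarrow> real" where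
  "cos_transform K z = (LINT \<xi>|lborel. cos (z \<bullet> \<xi>) * K \<xi>)"

lemma integrable_bounded_mult:
  fixes K f :: "'a::euclidean_space \<Rightarrow> real"
  assumes "integrable lborel K" "f \<in> borel_measurable borel" "\<And>x. \<bar>f x\<bar> \<le> B"
  shows "integrable lborel (\<lambda>x. f x * K x)" "integrable lborel (\<lambda>x. K x * f x)"
  using integrable_inner_bounded(1)[of lborel K f B] assms by (simp_all add: mult.commute)

text \<open>Plane waves are eigenfunctions of convolution with \<open>K\<close>, and the transform
  is the eigenvalue. Evenness removes the mixed term of the addition theorems.\<close>

lemma even_convolution_trig:
  fixes K :: "'a::euclidean_space \<Rightarrow> real"
  assumes K: "integrable lborel K" and even: "\<And>\<xi>. K (- \<xi>) = K \<xi>"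
  shows "(LINT \<xi>|lborel. K \<xi> * cos (z \<bullet> (x - \<xi>))) = cos_transform K z * cos (z \<bullet> x)"
    "(LINT \<xi>|lborel. K \<xi> * sin (z \<bullet> (x - \<xi>))) = cos_transform K z * sin (z \<bullet> x)"
proof -
  have [measurable]: "K \<in> borel_measurable borel" using K by auto
  \<comment> \<open>The reflected integrand is the negative of the original one, so the integral
    equals its own negative.\<close>
  have "(LINT \<xi>|lborel. sin (z \<bullet> (0 - \<xi>)) * K (0 - \<xi>)) = (LINT \<xi>|lborel. sin (z \<bullet> \<xi>) * K \<xi>)"
    by (rule integral_lborel_reflect) measurable
  then have s0: "(LINT \<xi>|lborel. sin (z \<bullet> \<xi>) * K \<xi>) = 0"
    by (simp add: even)
  have i: "integrable lborel (\<lambda>\<xi>. sin (z \<bullet> \<xi>) * K \<xi>)" "integrable lborel (\<lambda>\<xi>. cos (z \<bullet> \<xi>) * K \<xi>)"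
    using K by (auto intro!: integrable_bounded_mult(1)[where B=1])
  have "(LINT \<xi>|lborel. K \<xi> * cos (z \<bullet> (x - \<xi>))) =
      (LINT \<xi>|lborel. cos (z \<bullet> x) * (cos (z \<bullet> \<xi>) * K \<xi>) + sin (z \<bullet> x) * (sin (z \<bullet> \<xi>) * K \<xi>))"
    by (rule Bochner_Integration.integral_cong) (simp_all add: inner_diff_right cos_diff algebra_simps)
  then show "(LINT \<xi>|lborel. K \<xi> * cos (z \<bullet> (x - \<xi>))) = cos_transform K z * cos (z \<bullet> x)"
    using i by (simp add: s0 cos_transform_def)
  have "(LINT \<xi>|lborel. K \<xi> * sin (z \<bullet> (x - \<xi>))) =
      (LINT \<xi>|lborel. sin (z \<bullet> x) * (cos (z \<bullet> \<xi>) * K \<xi>) - cos (z \<bullet> x) * (sin (z \<bullet> \<xi>) * K \<xi>))"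
    by (rule Bochner_Integration.integral_cong) (simp_all add: inner_diff_right sin_diff algebra_simps)
  then show "(LINT \<xi>|lborel. K \<xi> * sin (z \<bullet> (x - \<xi>))) = cos_transform K z * sin (z \<bullet> x)"
    using i by (simp add: s0 cos_transform_def)
qed

lemma continuous_cos_transform:
  assumes K: "integrable lborel K"
  shows "continuous_on UNIV (cos_transform K)"
  unfolding continuous_on_sequentially
proof (safe, simp add: comp_def)
  fix Z :: "nat \<Rightarrow> 'a" and z assume Z: "Z \<longlonglongrightarrow> z"
  have [measurable]: "K \<in> borel_measurable borel" using K by auto
  show "(\<lambda>n. cos_transform K (Z n)) \<longlonglongrightarrow> cos_transform K z"
    unfolding cos_transform_def
  proof (rule integral_dominated_convergence[where w="\<lambda>\<xi>. norm (K \<xi>)"])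
    show "AE \<xi> in lborel. (\<lambda>n. cos (Z n \<bullet> \<xi>) * K \<xi>) \<longlonglongrightarrow> cos (z \<bullet> \<xi>) * K \<xi>"
      using Z by (intro AE_I2 tendsto_intros)
    show "AE \<xi> in lborel. norm (cos (Z n \<bullet> \<xi>) * K \<xi>) \<le> norm (K \<xi>)" for n
      by (intro AE_I2) (simp add: abs_mult mult_left_le_one_le)
  qed (use K in \<open>auto intro!: integrable_norm\<close>)
qed

section \<open>Gaussian mollification and Fourier inversion\<close>

text \<open>In the rescaled variable the Gaussian is fixed and the shrinking width sits in the
  argument of \<open>f\<close>, so one integrable majorant serves all \<open>n\<close>. The Gaussian
  is not normalised; the factor in the limit is its mass.\<close>

lemma tendsto_gauss_convolution:
  fixes f :: "'a::euclidean_space \<Rightarrow> 'e::euclidean_space"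
  assumes f: "continuous_on UNIV f" and B: "\<And>x. norm (f x) \<le> B"
  shows "(\<lambda>n. LINT \<zeta>|lborel. gauss (1/2) \<zeta> *\<^sub>R f (x - (1 / Suc n) *\<^sub>R \<zeta>)) \<longlonglongrightarrow>
     sqrt (2 * pi) ^ DIM('a) *\<^sub>R f x"
proof -
  have [measurable]: "f \<in> borel_measurable borel"
    using f by (rule borel_measurable_continuous_onI)
  have g0: "integrable lborel (gauss (1/2) :: 'a \<Rightarrow> real)"
    by (rule gaussian_fourier_std)
  then have g: "integrable lborel (\<lambda>\<zeta>::'a. gauss (1/2) \<zeta> * B)"
    by (rule integrable_mult_left)
  have "(\<lambda>n. LINT \<zeta>|lborel. gauss (1/2) \<zeta> *\<^sub>R f (x - (1 / Suc n) *\<^sub>R \<zeta>)) \<longlonglongrightarrow>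
     (LINT \<zeta>::'a|lborel. gauss (1/2) \<zeta> *\<^sub>R f x)"
  proof (rule integral_dominated_convergence[OF _ _ g])
    show "AE \<zeta> in lborel. (\<lambda>n. gauss (1/2) \<zeta> *\<^sub>R f (x - (1 / Suc n) *\<^sub>R \<zeta>)) \<longlonglongrightarrow> gauss (1/2) \<zeta> *\<^sub>R f x"
    proof (intro AE_I2 tendsto_intros)
      fix \<zeta> :: 'a
      have "(\<lambda>n. x - (1 / Suc n) *\<^sub>R \<zeta>) \<longlonglongrightarrow> x - 0 *\<^sub>R \<zeta>"
        using LIMSEQ_inverse_real_of_nat by (intro tendsto_intros) (simp add: inverse_eq_divide)
      moreover have "isCont f x"
        using f by (simp add: continuous_on_eq_continuous_at)
      ultimately show "(\<lambda>n. f (x - (1 / Suc n) *\<^sub>R \<zeta>)) \<longlonglongrightarrow> f x"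
        by (intro isCont_tendsto_compose[of x f]) simp_all
    qed
    show "AE \<zeta> in lborel. norm (gauss (1/2) \<zeta> *\<^sub>R f (x - (1 / Suc n) *\<^sub>R \<zeta>)) \<le> gauss (1/2) \<zeta> * B" for n
      using B by (intro AE_I2) simp
  qed measurable
  also have "(LINT \<zeta>::'a|lborel. gauss (1/2) \<zeta> *\<^sub>R f x) = sqrt (2 * pi) ^ DIM('a) *\<^sub>R f x"
    using gaussian_fourier_std(2)[of "0::'a"] integral_scaleR_left[of "f x" lborel "gauss (1/2)"] g0 by simp
  finally show ?thesis .
qed

text \<open>A Gaussian factor inserted in frequency makes the double integral absolutely convergent.
  One limit is taken by dominated convergence with majorant the transform; the other arises by
  integrating out the frequency first, which leaves a Gaussian mollification of
  \<open>K\<close>.\<close>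

lemma cos_inversion:
  fixes K :: "'a::euclidean_space \<Rightarrow> real"
  assumes cont: "continuous_on UNIV K" and B: "\<And>x. \<bar>K x\<bar> \<le> B" and K: "integrable lborel K"
    and even: "\<And>\<xi>. K (- \<xi>) = K \<xi>" and C: "integrable lborel (cos_transform K)"
  shows "(LINT z|lborel. cos_transform K z * cos (z \<bullet> x)) = (2 * pi) ^ DIM('a) * K x"
proof (rule LIMSEQ_unique)
  have [measurable]: "K \<in> borel_measurable borel" "cos_transform K \<in> borel_measurable borel"
    using K C by auto
  let ?C = "cos_transform K"
  let ?r = "\<lambda>n. 1 / real (Suc n)"
  let ?g = "\<lambda>n (z::'a). gauss ((?r n)\<^sup>2 / 2) z"
  show "(\<lambda>n. LINT z|lborel. ?C z * cos (z \<bullet> x) * ?g n z) \<longlonglongrightarrow> (LINT z|lborel. ?C z * cos (z \<bullet> x))"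
  proof (rule integral_dominated_convergence[where w="\<lambda>z. norm (?C z)"])
    show "AE z in lborel. (\<lambda>n. ?C z * cos (z \<bullet> x) * ?g n z) \<longlonglongrightarrow> ?C z * cos (z \<bullet> x)"
    proof (rule AE_I2)
      fix z
      have "(\<lambda>n. ?C z * cos (z \<bullet> x) * exp (- ((inverse (real (Suc n)))\<^sup>2 / 2 * (z \<bullet> z)))) \<longlonglongrightarrow>
          ?C z * cos (z \<bullet> x) * exp (- (0\<^sup>2 / 2 * (z \<bullet> z)))"
        by (intro tendsto_intros LIMSEQ_inverse_real_of_nat) simp
      then show "(\<lambda>n. ?C z * cos (z \<bullet> x) * ?g n z) \<longlonglongrightarrow> ?C z * cos (z \<bullet> x)"
        by (simp add: inverse_eq_divide del: of_nat_Suc)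
    qed
    show "AE z in lborel. norm (?C z * cos (z \<bullet> x) * ?g n z) \<le> norm (?C z)" for n
    proof (rule AE_I2)
      fix z
      have "\<bar>cos (z \<bullet> x)\<bar> * ?g n z \<le> 1 * 1"
        by (intro mult_mono) auto
      then show "norm (?C z * cos (z \<bullet> x) * ?g n z) \<le> norm (?C z)"
        by (simp add: abs_mult mult.assoc mult_left_le)
    qed
  qed (use C in auto)
  have eq: "(LINT z|lborel. ?C z * cos (z \<bullet> x) * ?g n z) =
      sqrt (2 * pi) ^ DIM('a) * (LINT \<zeta>|lborel. gauss (1/2) \<zeta> *\<^sub>R K (x - ?r n *\<^sub>R \<zeta>))" for n
  proof -
    have r: "?r n > 0" by simp
    have m: "(\<lambda>(z, \<xi>). K \<xi> * cos (z \<bullet> (x - \<xi>)) * ?g n z) \<in> borel_measurable (lborel \<Otimes>\<^sub>M lborel)"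
      by measurable
    have b: "norm (K \<xi> * cos (z \<bullet> (x - \<xi>)) * ?g n z) \<le> ?g n z * norm (K \<xi>)" for z \<xi>
      using mult_right_mono[OF abs_cos_le_one[of "z \<bullet> (x - \<xi>)"], of "\<bar>K \<xi>\<bar> * ?g n z"]
      by (simp add: abs_mult algebra_simps)
    \<comment> \<open>The eigenfunction identity is used from right to left: the factor
      \<open>cos (z \<bullet> x)\<close> is absorbed into the integral over \<xi>, which leaves one
      cosine for the Gaussian transform.\<close>
    have "(LINT z|lborel. ?C z * cos (z \<bullet> x) * ?g n z) =
        (LINT z|lborel. LINT \<xi>|lborel. K \<xi> * cos (z \<bullet> (x - \<xi>)) * ?g n z)"
      using even_convolution_trig(1)[OF K even] by simp
    also have "\<dots> = (LINT \<xi>|lborel. LINT z|lborel. K \<xi> * cos (z \<bullet> (x - \<xi>)) * ?g n z)"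
      by (rule integral_swap_dominated[OF lborel.sigma_finite_measure_axioms
          lborel.sigma_finite_measure_axioms gaussian_fourier(1)[OF r] integrable_norm[OF K] m b])
    also have "\<dots> = (LINT \<xi>|lborel. K \<xi> * ((sqrt (2 * pi) / ?r n) ^ DIM('a) * gauss (1/2) ((x - \<xi>) /\<^sub>R ?r n)))"
      by (simp only: mult.assoc integral_mult_right_zero gaussian_fourier(2)[OF r])
    \<comment> \<open>Substitution of \<open>x - r \<zeta>\<close> for \<xi>, with \<open>r\<close>
      the width; the Jacobian cancels the power of \<open>r\<close> from the Gaussian
      transform.\<close>
    also have "\<dots> = \<bar>- ?r n\<bar> ^ DIM('a) *\<^sub>R (LINT \<zeta>|lborel. K (x + (- ?r n) *\<^sub>R \<zeta>) *
        ((sqrt (2 * pi) / ?r n) ^ DIM('a) * gauss (1/2) ((x - (x + (- ?r n) *\<^sub>R \<zeta>)) /\<^sub>R ?r n)))"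
      by (rule integral_lborel_affine) auto
    also have "\<dots> = (?r n) ^ DIM('a) * (LINT \<zeta>|lborel. (sqrt (2 * pi) / ?r n) ^ DIM('a) * (gauss (1/2) \<zeta> *\<^sub>R K (x - ?r n *\<^sub>R \<zeta>)))"
      using r by (simp add: mult_ac)
    also have "\<dots> = sqrt (2 * pi) ^ DIM('a) * (LINT \<zeta>|lborel. gauss (1/2) \<zeta> *\<^sub>R K (x - ?r n *\<^sub>R \<zeta>))"
      using r by (simp only: integral_mult_right_zero power_divide) simp
    finally show ?thesis .
  qed
  have "(\<lambda>n. sqrt (2 * pi) ^ DIM('a) * (LINT \<zeta>|lborel. gauss (1/2) \<zeta> *\<^sub>R K (x - ?r n *\<^sub>R \<zeta>))) \<longlonglongrightarrow>
     sqrt (2 * pi) ^ DIM('a) * (sqrt (2 * pi) ^ DIM('a) *\<^sub>R K x)"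
    by (intro tendsto_intros tendsto_gauss_convolution[OF cont]) (use B in simp)
  also have "sqrt (2 * pi) ^ DIM('a) * (sqrt (2 * pi) ^ DIM('a) *\<^sub>R K x) = (2 * pi) ^ DIM('a) * K x"
    using power_mult_distrib[of "sqrt (2 * pi)" "sqrt (2 * pi)" "DIM('a)"] by simp
  finally show "(\<lambda>n. LINT z|lborel. ?C z * cos (z \<bullet> x) * ?g n z) \<longlonglongrightarrow> (2 * pi) ^ DIM('a) * K x"
    unfolding eq .
qed

lemma C1b_cos_integral:
  fixes h :: "'a::euclidean_space \<Rightarrow> real"
  assumes h: "integrable lborel h" and zh: "integrable lborel (\<lambda>z. norm z * h z)"
  shows "C1b (\<lambda>x. LINT z|lborel. h z * cos (z \<bullet> x)) (\<lambda>x. LINT z|lborel. h z *\<^sub>R - (sin (z \<bullet> x) *\<^sub>R z))"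
proof (rule C1b_integral[where B="\<lambda>z. norm (h z) + norm (norm z * h z)"])
  have [measurable]: "h \<in> borel_measurable borel" using h by auto
  show "C1b (\<lambda>x. h z * cos (z \<bullet> x)) (\<lambda>x. h z *\<^sub>R - (sin (z \<bullet> x) *\<^sub>R z))" for z
    using C1b_lincomb[OF C1b_cos C1b_cos, of "h z" z 0 z] by simp
  show "integrable lborel (\<lambda>z. norm (h z) + norm (norm z * h z))"
    using h zh by auto
  show "\<bar>h z * cos (z \<bullet> x)\<bar> \<le> norm (h z) + norm (norm z * h z)" for z x
    using mult_left_le[of "\<bar>cos (z \<bullet> x)\<bar>" "\<bar>h z\<bar>"] by (simp add: abs_mult add_increasing2)
  show "norm (h z *\<^sub>R - (sin (z \<bullet> x) *\<^sub>R z)) \<le> norm (h z) + norm (norm z * h z)" for z x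
    using mult_left_le[of "\<bar>sin (z \<bullet> x)\<bar>" "\<bar>h z\<bar> * norm z"] by (simp add: abs_mult mult_ac add_increasing)
  show "(\<lambda>z. h z * cos (z \<bullet> x)) \<in> borel_measurable lborel" for x
    by simp
  show "(\<lambda>z. h z *\<^sub>R - (sin (z \<bullet> x) *\<^sub>R z)) \<in> borel_measurable lborel" for x
    by simp
qed

lemma C1b_mult_left:
  assumes "C1b f F"
  shows "C1b (\<lambda>x. c * f x) (\<lambda>x. c *\<^sub>R F x)"
  using C1b_lincomb[OF assms assms, of c 0] by simp

lemma C1b_convolution:
  assumes g: "C1b g g'" and k: "integrable lborel k"
  shows "C1b (\<lambda>x. LINT \<xi>|lborel. k \<xi> * g (x - \<xi>)) (\<lambda>x. LINT \<xi>|lborel. k \<xi> *\<^sub>R g' (x - \<xi>))"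
proof -
  obtain B where B: "B \<ge> 0" "\<And>x. \<bar>g x\<bar> \<le> B" "\<And>x. norm (g' x) \<le> B"
    using C1b_bound[OF g] by metis
  have [measurable]: "k \<in> borel_measurable borel" "g \<in> borel_measurable borel" "g' \<in> borel_measurable borel"
    using k C1b_measurable[OF g] by auto
  show ?thesis
  proof (rule C1b_integral[where B="\<lambda>\<xi>. norm (k \<xi>) * B"])
    show "C1b (\<lambda>x. k \<xi> * g (x - \<xi>)) (\<lambda>x. k \<xi> *\<^sub>R g' (x - \<xi>))" for \<xi>
      by (rule C1b_mult_left[OF C1b_translate[OF g]])
    show "integrable lborel (\<lambda>\<xi>. norm (k \<xi>) * B)"
      using k by auto
  qed (use B in \<open>auto simp: abs_mult mult_left_mono\<close>)
qed

subsection \<open>First-order functionals\<close>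

text \<open>The value terms have their own parameter space because in the application they sit on
  the time slices 0 and \<open>s\<close>: \<open>b0\<close>, \<open>b1\<close> are densities on
  space and \<open>a0\<close>, \<open>a1\<close> embed space as these slices. Signs are part of the
  densities.\<close>

locale first_order_functional =
  fixes W :: "'a::euclidean_space \<Rightarrow> 'a"
    and b0 b1 :: "'c::euclidean_space \<Rightarrow> real"
    and a0 a1 :: "'c \<Rightarrow> 'a"
  assumes W: "integrable lborel W"
    and b0: "integrable lborel b0" and b1: "integrable lborel b1"
    and a0[measurable]: "a0 \<in> borel_measurable borel" and a1[measurable]: "a1 \<in> borel_measurable borel"
begin

text \<open>The second argument is not tied to the first, so the functional also makes sense for
  limits of pairs that are no longer a function with its gradient.\<close>

definition \<Lambda> :: "('a \<Rightarrow> real) \<Rightarrow> ('a \<Rightarrow> 'a) \<Rightarrow> real" where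
  "\<Lambda> \<phi> G = (LINT z|lborel. W z \<bullet> G z) + (LINT y|lborel. b0 y * \<phi> (a0 y)) + (LINT y|lborel. b1 y * \<phi> (a1 y))"

lemma densities_measurable[measurable]: "W \<in> borel_measurable borel" "b0 \<in> borel_measurable borel" "b1 \<in> borel_measurable borel"
  using W b0 b1 by auto

definition total_mass :: real where
  "total_mass = (LINT z|lborel. norm (W z)) + (LINT y|lborel. norm (b0 y)) + (LINT y|lborel. norm (b1 y))"

lemma \<Lambda>_integrable:
  assumes [measurable]: "\<phi> \<in> borel_measurable borel" "G \<in> borel_measurable borel"
    and B: "\<And>x. \<bar>\<phi> x\<bar> \<le> B" "\<And>x. norm (G x) \<le> B"
  shows "integrable lborel (\<lambda>z. W z \<bullet> G z)" "integrable lborel (\<lambda>y. b0 y * \<phi> (a0 y))"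
    "integrable lborel (\<lambda>y. b1 y * \<phi> (a1 y))"
  using integrable_inner_bounded(1)[OF W, of G B] integrable_inner_bounded(1)[OF b0, of "\<lambda>y. \<phi> (a0 y)" B]
    integrable_inner_bounded(1)[OF b1, of "\<lambda>y. \<phi> (a1 y)" B] B
  by simp_all

lemma \<Lambda>_bound:
  assumes [measurable]: "\<phi> \<in> borel_measurable borel" "G \<in> borel_measurable borel"
    and B: "\<And>x. \<bar>\<phi> x\<bar> \<le> B" "\<And>x. norm (G x) \<le> B"
  shows "\<bar>\<Lambda> \<phi> G\<bar> \<le> total_mass * B"
proof -
  have "\<bar>LINT z|lborel. W z \<bullet> G z\<bar> \<le> (LINT z|lborel. norm (W z)) * B"
    using B by (intro integrable_inner_bounded(2)[OF W]) auto
  moreover have "\<bar>LINT y|lborel. b0 y \<bullet> \<phi> (a0 y)\<bar> \<le> (LINT y|lborel. norm (b0 y)) * B"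
    using B by (intro integrable_inner_bounded(2)[OF b0]) auto
  moreover have "\<bar>LINT y|lborel. b1 y \<bullet> \<phi> (a1 y)\<bar> \<le> (LINT y|lborel. norm (b1 y)) * B"
    using B by (intro integrable_inner_bounded(2)[OF b1]) auto
  ultimately show ?thesis
    unfolding \<Lambda>_def total_mass_def by (simp add: distrib_right)
qed

lemma \<Lambda>_lincomb:
  assumes "C1b f F" "C1b g G"
  shows "\<Lambda> (\<lambda>x. a * f x + b * g x) (\<lambda>x. a *\<^sub>R F x + b *\<^sub>R G x) = a * \<Lambda> f F + b * \<Lambda> g G"
proof -
  obtain A B where A: "\<And>x. \<bar>f x\<bar> \<le> A" "\<And>x. norm (F x) \<le> A" and B: "\<And>x. \<bar>g x\<bar> \<le> B" "\<And>x. norm (G x) \<le> B"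
    using assms[THEN C1b_bound] by metis
  show ?thesis
    using \<Lambda>_integrable[OF C1b_measurable[OF assms(1)] A] \<Lambda>_integrable[OF C1b_measurable[OF assms(2)] B]
    unfolding \<Lambda>_def by (simp add: inner_add_right distrib_left mult.left_commute)
qed

lemma \<Lambda>_mult_left: "\<Lambda> (\<lambda>x. c * f x) (\<lambda>x. c *\<^sub>R F x) = c * \<Lambda> f F"
  unfolding \<Lambda>_def by (simp add: mult.left_commute distrib_left)

text \<open>Convergence of gradients is asked only almost everywhere and only where \<open>W\<close>
  does not vanish, which is all that the clamped approximations on the slab deliver. Values are
  needed at every point of the ranges of \<open>a0\<close> and \<open>a1\<close>, since these may be
  null sets.\<close>

lemma \<Lambda>_tendsto:
  assumes m: "\<And>n. \<phi> n \<in> borel_measurable borel" "\<And>n. G n \<in> borel_measurable borel"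
    "\<phi>' \<in> borel_measurable borel" "G' \<in> borel_measurable borel"
    and B: "\<And>n x. \<bar>\<phi> n x\<bar> \<le> B" "\<And>n x. norm (G n x) \<le> B"
    and lim0: "\<And>y. (\<lambda>n. \<phi> n (a0 y)) \<longlonglongrightarrow> \<phi>' (a0 y)"
    and lim1: "\<And>y. (\<lambda>n. \<phi> n (a1 y)) \<longlonglongrightarrow> \<phi>' (a1 y)"
    and limW: "AE z in lborel. W z \<noteq> 0 \<longrightarrow> (\<lambda>n. G n z) \<longlonglongrightarrow> G' z"
  shows "(\<lambda>n. \<Lambda> (\<phi> n) (G n)) \<longlonglongrightarrow> \<Lambda> \<phi>' G'"
  unfolding \<Lambda>_def
proof (intro tendsto_add)
  note m[measurable]
  show "(\<lambda>n. LINT z|lborel. W z \<bullet> G n z) \<longlonglongrightarrow> (LINT z|lborel. W z \<bullet> G' z)"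
  proof (rule integral_dominated_convergence[where w="\<lambda>z. norm (W z) * B"])
    show "AE z in lborel. (\<lambda>n. W z \<bullet> G n z) \<longlonglongrightarrow> W z \<bullet> G' z"
      using limW
    proof eventually_elim
      fix z assume "W z \<noteq> 0 \<longrightarrow> (\<lambda>n. G n z) \<longlonglongrightarrow> G' z"
      then show "(\<lambda>n. W z \<bullet> G n z) \<longlonglongrightarrow> W z \<bullet> G' z"
        by (cases "W z = 0") (auto intro!: tendsto_inner)
    qed
    show "AE z in lborel. norm (W z \<bullet> G n z) \<le> norm (W z) * B" for n
      using order_trans[OF Cauchy_Schwarz_ineq2 mult_left_mono[OF B(2) norm_ge_zero]] by (intro AE_I2) simp
  qed (use W in auto)
  show "(\<lambda>n. LINT y|lborel. b0 y * \<phi> n (a0 y)) \<longlonglongrightarrow> (LINT y|lborel. b0 y * \<phi>' (a0 y))"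
  proof (rule integral_dominated_convergence[where w="\<lambda>y. norm (b0 y) * B"])
    show "AE y in lborel. (\<lambda>n. b0 y * \<phi> n (a0 y)) \<longlonglongrightarrow> b0 y * \<phi>' (a0 y)"
      using lim0 by (intro AE_I2 tendsto_intros)
  qed (use b0 B in \<open>auto simp: abs_mult mult_left_mono\<close>)
  show "(\<lambda>n. LINT y|lborel. b1 y * \<phi> n (a1 y)) \<longlonglongrightarrow> (LINT y|lborel. b1 y * \<phi>' (a1 y))"
  proof (rule integral_dominated_convergence[where w="\<lambda>y. norm (b1 y) * B"])
    show "AE y in lborel. (\<lambda>n. b1 y * \<phi> n (a1 y)) \<longlonglongrightarrow> b1 y * \<phi>' (a1 y)"
      using lim1 by (intro AE_I2 tendsto_intros)
  qed (use b1 B in \<open>auto simp: abs_mult mult_left_mono\<close>)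
qed

text \<open>Fubini in each of the three terms. The majorant depends on the parameter alone, because
  the densities are merely integrable and leave no room for growth in \<open>x\<close>.\<close>

lemma \<Lambda>_integral:
  fixes k :: "'x::euclidean_space \<Rightarrow> 'a \<Rightarrow> real"
  assumes m: "case_prod k \<in> borel_measurable (borel \<Otimes>\<^sub>M borel)"
    "case_prod k' \<in> borel_measurable (borel \<Otimes>\<^sub>M borel)"
    and \<kappa>: "integrable lborel \<kappa>"
    and B: "\<And>\<xi> x. \<bar>k \<xi> x\<bar> \<le> \<kappa> \<xi>" "\<And>\<xi> x. norm (k' \<xi> x) \<le> \<kappa> \<xi>"
  shows "\<Lambda> (\<lambda>x. LINT \<xi>|lborel. k \<xi> x) (\<lambda>x. LINT \<xi>|lborel. k' \<xi> x) = (LINT \<xi>|lborel. \<Lambda> (k \<xi>) (k' \<xi>))"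
proof -
  note m[measurable]
  have m0: "(\<lambda>(\<xi>, y). k \<xi> (a0 y)) \<in> borel_measurable (borel \<Otimes>\<^sub>M borel)"
    by measurable
  have m1: "(\<lambda>(\<xi>, y). k \<xi> (a1 y)) \<in> borel_measurable (borel \<Otimes>\<^sub>M borel)"
    by measurable
  have B': "norm (k \<xi> x) \<le> \<kappa> \<xi>" for \<xi> x
    using B by simp
  show ?thesis
    using integral_inner_swap[OF W \<kappa> m(2) B(2)] integral_inner_swap[OF b0 \<kappa> m0 B'] integral_inner_swap[OF b1 \<kappa> m1 B']
    unfolding \<Lambda>_def by simp
qed

text \<open>The derivative may be put on either factor of a convolution. With the derivative on \<open>k\<close> the
  pair is a superposition of translates of \<open>(k, k')\<close>.\<close>

lemma \<Lambda>_convolution: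
  assumes k: "C1b k k'" "integrable lborel k" and g: "C1b g g'" "integrable lborel g"
    and zero: "\<And>\<xi>. \<Lambda> (\<lambda>x. k (x - \<xi>)) (\<lambda>x. k' (x - \<xi>)) = 0"
  shows "\<Lambda> (\<lambda>x. LINT \<xi>|lborel. k \<xi> * g (x - \<xi>)) (\<lambda>x. LINT \<xi>|lborel. k \<xi> *\<^sub>R g' (x - \<xi>)) = 0"
proof -
  have [measurable]: "k \<in> borel_measurable borel" "k' \<in> borel_measurable borel" "g \<in> borel_measurable borel"
    using C1b_measurable[OF k(1)] C1b_measurable[OF g(1)] by auto
  obtain B where B: "B \<ge> 0" "\<And>x. \<bar>k x\<bar> \<le> B" "\<And>x. norm (k' x) \<le> B"
    using C1b_bound[OF k(1)] by metis
  have eq: "(LINT \<xi>|lborel. k \<xi> * g (x - \<xi>)) = (LINT \<xi>|lborel. g \<xi> * k (x - \<xi>))" for x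
    using integral_lborel_reflect[of "\<lambda>\<xi>. k \<xi> * g (x - \<xi>)" x] by (simp add: mult.commute)
  have "C1b (\<lambda>x. LINT \<xi>|lborel. k \<xi> * g (x - \<xi>)) (\<lambda>x. LINT \<xi>|lborel. g \<xi> *\<^sub>R k' (x - \<xi>))"
    unfolding eq by (rule C1b_convolution[OF k(1) g(2)])
  \<comment> \<open>Both expressions are gradients of the same convolution, so they coincide; this
    replaces an integration by parts.\<close>
  from C1b_unique[OF C1b_convolution[OF g(1) k(2)] this]
  have "\<Lambda> (\<lambda>x. LINT \<xi>|lborel. k \<xi> * g (x - \<xi>)) (\<lambda>x. LINT \<xi>|lborel. k \<xi> *\<^sub>R g' (x - \<xi>)) =
      \<Lambda> (\<lambda>x. LINT \<xi>|lborel. g \<xi> * k (x - \<xi>)) (\<lambda>x. LINT \<xi>|lborel. g \<xi> *\<^sub>R k' (x - \<xi>))"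
    by (simp add: eq)
  also have "\<dots> = (LINT \<xi>|lborel. \<Lambda> (\<lambda>x. g \<xi> * k (x - \<xi>)) (\<lambda>x. g \<xi> *\<^sub>R k' (x - \<xi>)))"
  proof (rule \<Lambda>_integral[where \<kappa>="\<lambda>\<xi>. norm (g \<xi>) * B"])
    show "integrable lborel (\<lambda>\<xi>. norm (g \<xi>) * B)"
      using g(2) by auto
  qed (use B in \<open>auto simp: abs_mult mult_left_mono\<close>)
  also have "\<dots> = 0"
    by (simp add: \<Lambda>_mult_left zero)
  finally show ?thesis .
qed

text \<open>The convolution of \<open>K\<close> with a damped cosine is annihilated for every
  damping; without damping it is the cosine times the transform at \<open>z\<close>, which may be
  divided out. The shift \<open>w\<close> supplies all phases, hence sines too, and later the
  translates of Gaussians.\<close>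

lemma \<Lambda>_cos_zero_of_transform:
  assumes K: "C1b K K'" "integrable lborel K" and even: "\<And>\<xi>. K (- \<xi>) = K \<xi>"
    and zero: "\<And>\<xi>. \<Lambda> (\<lambda>x. K (x - \<xi>)) (\<lambda>x. K' (x - \<xi>)) = 0"
    and nz: "cos_transform K z \<noteq> 0"
  shows "\<Lambda> (\<lambda>x. cos (z \<bullet> (x - w))) (\<lambda>x. - (sin (z \<bullet> (x - w)) *\<^sub>R z)) = 0"
proof -
  define c where "c x = cos (z \<bullet> (x - w))" for x
  define c' where "c' x = - (sin (z \<bullet> (x - w)) *\<^sub>R z)" for x
  have c: "C1b c c'"
    unfolding c_def c'_def by (rule C1b_translate[OF C1b_cos])
  have cb: "\<bar>c x\<bar> \<le> 1" "norm (c' x) \<le> norm z" for x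
    using mult_right_mono[OF abs_sin_le_one[of "z \<bullet> (x - w)"], of "norm z"] by (simp_all add: c_def c'_def)
  \<comment> \<open>Damping parameters at most 1, so that \<open>2 * (1 + a n)\<close> bounds the
    gradients of the dampers by 4 for all \<open>n\<close>.\<close>
  define a where "a n = inverse (real (Suc n))" for n
  have a: "0 < a n" "a n \<le> 1" for n
    by (simp_all add: a_def field_simps)
  have alim: "a \<longlonglongrightarrow> 0"
    unfolding a_def by (rule LIMSEQ_inverse_real_of_nat)
  define gr :: "nat \<Rightarrow> 'a \<Rightarrow> 'a" where "gr n x = - ((2 * a n * gauss (a n) x) *\<^sub>R x)" for n x
  have grb: "norm (gr n x) \<le> 4" for n x
  proof -
    have "norm (gr n x) \<le> 2 * (1 + a n)"
      unfolding gr_def using a(1)[of n] by (intro gauss_grad_bound) simp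
    also have "\<dots> \<le> 4"
      using a(2)[of n] by simp
    finally show ?thesis .
  qed
  define g where "g n x = c x * gauss (a n) x" for n x
  define g' where "g' n x = c x *\<^sub>R gr n x + gauss (a n) x *\<^sub>R c' x" for n x
  have g: "C1b (g n) (g' n)" for n
    unfolding g_def g'_def gr_def using a[of n] by (intro C1b_mult[OF c C1b_gauss]) auto
  have gi: "integrable lborel (g n)" for n
    unfolding g_def using integrable_gauss[OF a(1)] C1b_measurable[OF c] cb
    by (intro integrable_bounded_mult(1)) auto
  have gb: "\<bar>g n x\<bar> \<le> 4 + norm z" "norm (g' n x) \<le> 4 + norm z" for n x
  proof -
    have "\<bar>g n x\<bar> \<le> 1 * 1"
      unfolding g_def abs_mult using cb a[of n] by (intro mult_mono) (auto simp: less_imp_le)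
    then show "\<bar>g n x\<bar> \<le> 4 + norm z" using norm_ge_zero[of z] by linarith
    have "norm (g' n x) \<le> \<bar>c x\<bar> * norm (gr n x) + gauss (a n) x * norm (c' x)"
      unfolding g'_def by (rule order_trans[OF norm_triangle_ineq]) simp
    also have "\<dots> \<le> 1 * 4 + 1 * norm z"
      using cb grb a[of n] by (intro add_mono mult_mono) (auto simp: less_imp_le)
    finally show "norm (g' n x) \<le> 4 + norm z" by simp
  qed
  have glim: "(\<lambda>n. g n x) \<longlonglongrightarrow> c x" "(\<lambda>n. g' n x) \<longlonglongrightarrow> c' x" for x
  proof -
    have e: "(\<lambda>n. gauss (a n) x) \<longlonglongrightarrow> gauss 0 x"
      using alim by (intro tendsto_intros)
    then have "(\<lambda>n. c x * gauss (a n) x) \<longlonglongrightarrow> c x * gauss 0 x"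
      by (rule tendsto_mult_left)
    then show "(\<lambda>n. g n x) \<longlonglongrightarrow> c x"
      by (simp add: g_def)
    have "(\<lambda>n. c x *\<^sub>R - ((2 * a n * gauss (a n) x) *\<^sub>R x) + gauss (a n) x *\<^sub>R c' x) \<longlonglongrightarrow>
        c x *\<^sub>R - ((2 * 0 * gauss 0 x) *\<^sub>R x) + gauss 0 x *\<^sub>R c' x"
      using alim by (intro tendsto_intros)
    then show "(\<lambda>n. g' n x) \<longlonglongrightarrow> c' x"
      by (simp add: g'_def gr_def)
  qed
  let ?f = "\<lambda>n x. LINT \<xi>|lborel. K \<xi> * g n (x - \<xi>)"
  let ?F = "\<lambda>n x. LINT \<xi>|lborel. K \<xi> *\<^sub>R g' n (x - \<xi>)"
  have conv: "C1b (?f n) (?F n)" for n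
    by (rule C1b_convolution[OF g K(2)])
  have [measurable]: "K \<in> borel_measurable borel" "g n \<in> borel_measurable borel" "g' n \<in> borel_measurable borel"
    "c \<in> borel_measurable borel" "c' \<in> borel_measurable borel" for n
    using C1b_measurable[OF K(1)] C1b_measurable[OF g] C1b_measurable[OF c] by auto
  \<comment> \<open>Convolution with \<open>K\<close> costs a factor of its L1 norm;
    \<open>4 + norm z\<close> bounds the damped cosine and its gradient by the product rule.\<close>
  let ?B = "(LINT \<xi>|lborel. norm (K \<xi>)) * (4 + norm z)"
  have Ki: "integrable lborel (\<lambda>\<xi>. norm (K \<xi>) * (4 + norm z))"
    using K(2) by auto
  have "(\<lambda>n. \<Lambda> (?f n) (?F n)) \<longlonglongrightarrow>
      \<Lambda> (\<lambda>x. LINT \<xi>|lborel. K \<xi> * c (x - \<xi>)) (\<lambda>x. LINT \<xi>|lborel. K \<xi> *\<^sub>R c' (x - \<xi>))"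
  proof (rule \<Lambda>_tendsto[where B="?B"])
    show "?f n \<in> borel_measurable borel" "?F n \<in> borel_measurable borel" for n
      using C1b_measurable[OF conv] by auto
    show "(\<lambda>x. LINT \<xi>|lborel. K \<xi> * c (x - \<xi>)) \<in> borel_measurable borel"
      "(\<lambda>x. LINT \<xi>|lborel. K \<xi> *\<^sub>R c' (x - \<xi>)) \<in> borel_measurable borel"
      using C1b_measurable[OF C1b_convolution[OF c K(2)]] by auto
    show "\<bar>?f n x\<bar> \<le> ?B" for n x
      using integrable_inner_bounded(2)[OF K(2), of "\<lambda>\<xi>. g n (x - \<xi>)" "4 + norm z"] gb by simp
    show "norm (?F n x) \<le> ?B" for n x
    proof -
      have b: "norm (K \<xi> *\<^sub>R g' n (x - \<xi>)) \<le> norm (K \<xi>) * (4 + norm z)" for \<xi>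
        using gb by (simp add: mult_left_mono)
      have "integrable lborel (\<lambda>\<xi>. K \<xi> *\<^sub>R g' n (x - \<xi>))"
        by (rule Bochner_Integration.integrable_bound[OF Ki]) (use order_trans[OF b abs_ge_self] in auto)
      from norm_integral_le_integral[OF this Ki b]
      show ?thesis by simp
    qed
    have l0: "(\<lambda>n. ?f n x) \<longlonglongrightarrow> (LINT \<xi>|lborel. K \<xi> * c (x - \<xi>))" for x
      by (rule integral_dominated_convergence[OF _ _ Ki])
        (use gb glim in \<open>auto simp: abs_mult intro!: tendsto_intros mult_left_mono\<close>)
    show "(\<lambda>n. ?f n (a0 y)) \<longlonglongrightarrow> (LINT \<xi>|lborel. K \<xi> * c (a0 y - \<xi>))"
      "(\<lambda>n. ?f n (a1 y)) \<longlonglongrightarrow> (LINT \<xi>|lborel. K \<xi> * c (a1 y - \<xi>))" for y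
      by (rule l0)+
    have "(\<lambda>n. ?F n x) \<longlonglongrightarrow> (LINT \<xi>|lborel. K \<xi> *\<^sub>R c' (x - \<xi>))" for x
      by (rule integral_dominated_convergence[OF _ _ Ki])
        (use gb glim in \<open>auto simp: abs_mult intro!: tendsto_intros mult_left_mono\<close>)
    then show "AE x in lborel. W x \<noteq> 0 \<longrightarrow> (\<lambda>n. ?F n x) \<longlonglongrightarrow> (LINT \<xi>|lborel. K \<xi> *\<^sub>R c' (x - \<xi>))"
      by auto
  qed
  moreover have "\<Lambda> (?f n) (?F n) = 0" for n
    by (rule \<Lambda>_convolution[OF K g gi zero])
  ultimately have "\<Lambda> (\<lambda>x. LINT \<xi>|lborel. K \<xi> * c (x - \<xi>)) (\<lambda>x. LINT \<xi>|lborel. K \<xi> *\<^sub>R c' (x - \<xi>)) = 0"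
    by (simp add: LIMSEQ_const_iff)
  moreover have "(LINT \<xi>|lborel. K \<xi> * c (x - \<xi>)) = cos_transform K z * c x" for x
    using even_convolution_trig(1)[OF K(2) even, of z "x - w"] by (simp add: c_def algebra_simps)
  moreover have "(LINT \<xi>|lborel. K \<xi> *\<^sub>R c' (x - \<xi>)) = cos_transform K z *\<^sub>R c' x" for x
  proof -
    have "integrable lborel (\<lambda>\<xi>. K \<xi> * sin (z \<bullet> (x - w - \<xi>)))"
      using K(2) by (intro integrable_bounded_mult(2)[where B=1]) auto
    then have "(LINT \<xi>|lborel. (K \<xi> * sin (z \<bullet> (x - w - \<xi>))) *\<^sub>R (- z)) =
        (cos_transform K z * sin (z \<bullet> (x - w))) *\<^sub>R (- z)"
      using even_convolution_trig(2)[OF K(2) even, of z "x - w"] by (subst integral_scaleR_left) auto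
    then show ?thesis by (simp add: c'_def algebra_simps)
  qed
  ultimately have "cos_transform K z * \<Lambda> c c' = 0"
    unfolding \<Lambda>_mult_left[symmetric] by simp
  then show ?thesis
    using nz by (simp add: c_def[abs_def] c'_def[abs_def])
qed

text \<open>For fixed \<open>w\<close> the left-hand side is continuous in the frequency: a
  convergent sequence of frequencies is bounded, and with it the gradients of the waves.\<close>

lemma \<Lambda>_cos_zero:
  assumes K: "C1b K K'" "integrable lborel K" and even: "\<And>\<xi>. K (- \<xi>) = K \<xi>"
    and zero: "\<And>\<xi>. \<Lambda> (\<lambda>x. K (x - \<xi>)) (\<lambda>x. K' (x - \<xi>)) = 0"
    and dense: "closure {z. cos_transform K z \<noteq> 0} = UNIV"
  shows "\<Lambda> (\<lambda>x. cos (z \<bullet> (x - w))) (\<lambda>x. - (sin (z \<bullet> (x - w)) *\<^sub>R z)) = 0"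
proof -
  obtain Z where Z: "\<And>n. cos_transform K (Z n) \<noteq> 0" "Z \<longlonglongrightarrow> z"
    using dense closure_sequential[of z "{z. cos_transform K z \<noteq> 0}"] by auto
  obtain B where B: "\<And>n. norm (Z n) \<le> B"
    using convergent_imp_Bseq[OF convergentI[OF Z(2)]] by (auto simp: Bseq_def)
  have "(\<lambda>n. \<Lambda> (\<lambda>x. cos (Z n \<bullet> (x - w))) (\<lambda>x. - (sin (Z n \<bullet> (x - w)) *\<^sub>R Z n))) \<longlonglongrightarrow>
     \<Lambda> (\<lambda>x. cos (z \<bullet> (x - w))) (\<lambda>x. - (sin (z \<bullet> (x - w)) *\<^sub>R z))"
  proof (rule \<Lambda>_tendsto[where B="max 1 B"])
    show "norm (- (sin (Z n \<bullet> (x - w)) *\<^sub>R Z n)) \<le> max 1 B" for n x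
      using mult_mono[OF abs_sin_le_one[of "Z n \<bullet> (x - w)"] B[of n]] by simp
    show "AE x in lborel. W x \<noteq> 0 \<longrightarrow> (\<lambda>n. - (sin (Z n \<bullet> (x - w)) *\<^sub>R Z n)) \<longlonglongrightarrow> - (sin (z \<bullet> (x - w)) *\<^sub>R z)"
      using Z(2) by (intro AE_I2 impI tendsto_intros)
  qed (use Z(2) in \<open>auto intro!: tendsto_intros simp: le_max_iff_disj\<close>)
  then show ?thesis
    using \<Lambda>_cos_zero_of_transform[OF K even zero Z(1)] by (simp add: LIMSEQ_const_iff)
qed

end

section \<open>From plane waves to Gaussians and to integrable test functions\<close>

lemma gauss_eq_cos_integral:
  fixes x :: "'a::euclidean_space"
  assumes "r > 0"
  shows "gauss (r\<^sup>2 / 2) x = (1 / (r * sqrt (2 * pi))) ^ DIM('a) *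
     (LINT z|lborel. gauss (1 / (2 * r\<^sup>2)) z * cos (z \<bullet> x))"
proof -
  have "(LINT z|lborel. cos (z \<bullet> x) * gauss ((1 / r)\<^sup>2 / 2) z) =
     (sqrt (2 * pi) / (1 / r)) ^ DIM('a) * gauss (1/2) (x /\<^sub>R (1 / r))"
    using assms by (intro gaussian_fourier(2)) simp
  also have "gauss (1/2) (x /\<^sub>R (1 / r)) = gauss (r\<^sup>2 / 2) x"
    by (simp add: power2_eq_square)
  finally show ?thesis
    using assms by (simp add: power_divide power_mult_distrib mult.commute)
qed

text \<open>Half of the exponent absorbs the factor \<open>norm z\<close>, the other half remains as
  an integrable majorant.\<close>

lemma integrable_norm_mult_gauss:
  assumes "a > 0"
  shows "integrable lborel (\<lambda>z::'a::euclidean_space. norm z * gauss a z)"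
proof (rule Bochner_Integration.integrable_bound)
  show "integrable lborel (\<lambda>z::'a. (1 + a / 2) / (a / 2) * gauss (a / 2) z)"
    using assms by (intro integrable_mult_right integrable_gauss) simp
  have "norm z * gauss a z \<le> (1 + a / 2) / (a / 2) * gauss (a / 2) z" for z :: 'a
  proof -
    have "norm z * gauss (a / 2) z \<le> (1 + a / 2) / (a / 2)"
      using norm_mult_gauss_le[of "a / 2" z] assms by (simp add: field_simps)
    then have "norm z * gauss (a / 2) z * gauss (a / 2) z \<le> (1 + a / 2) / (a / 2) * gauss (a / 2) z"
      by (rule mult_right_mono) simp
    also have "norm z * gauss (a / 2) z * gauss (a / 2) z = norm z * gauss a z"
      by (simp add: mult.assoc flip: exp_add)
    finally show ?thesis .
  qed
  then show "AE z in lborel. norm (norm z * gauss a z) \<le> norm ((1 + a / 2) / (a / 2) * gauss (a / 2) (z::'a))"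
    using assms by (intro AE_I2) simp
qed auto

text \<open>It links the form of mollification suited to limits, with a fixed Gaussian, to the form
  suited to \<open>\<Lambda>_convolution\<close>, a genuine convolution.\<close>

lemma gauss_rescale:
  fixes f :: "'a::euclidean_space \<Rightarrow> 'e::euclidean_space"
  assumes r: "r > 0" and [measurable]: "f \<in> borel_measurable borel"
  shows "(LINT \<zeta>|lborel. gauss (1/2) \<zeta> *\<^sub>R f (x - (1 / r) *\<^sub>R \<zeta>)) =
    r ^ DIM('a) *\<^sub>R (LINT \<xi>|lborel. gauss (r\<^sup>2 / 2) \<xi> *\<^sub>R f (x - \<xi>))"
proof -
  have "gauss (r\<^sup>2 / 2) ((1 / r) *\<^sub>R \<zeta>) = gauss (1/2) \<zeta>" for \<zeta> :: 'a
    using r by (simp add: power2_eq_square)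
  moreover have "(LINT \<xi>|lborel. gauss (r\<^sup>2 / 2) \<xi> *\<^sub>R f (x - \<xi>)) = \<bar>1 / r\<bar> ^ DIM('a) *\<^sub>R
     (LINT \<zeta>|lborel. gauss (r\<^sup>2 / 2) (0 + (1 / r) *\<^sub>R \<zeta>) *\<^sub>R f (x - (0 + (1 / r) *\<^sub>R \<zeta>)))"
    using r by (intro integral_lborel_affine) auto
  ultimately have "(LINT \<xi>|lborel. gauss (r\<^sup>2 / 2) \<xi> *\<^sub>R f (x - \<xi>)) = \<bar>1 / r\<bar> ^ DIM('a) *\<^sub>R
     (LINT \<zeta>|lborel. gauss (1/2) \<zeta> *\<^sub>R f (x - (1 / r) *\<^sub>R \<zeta>))"
    by (simp only: add_0)
  then show ?thesis
    using r by (simp add: power_divide)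
qed

context first_order_functional
begin

text \<open>A Gaussian is a superposition of plane waves with Gaussian weight, whose first moment
  controls the gradients. Whatever formula \<open>g'\<close> is given by, uniqueness identifies it
  with the superposition of sines.\<close>

lemma \<Lambda>_gauss_zero:
  assumes cos: "\<And>z w. \<Lambda> (\<lambda>x. cos (z \<bullet> (x - w))) (\<lambda>x. - (sin (z \<bullet> (x - w)) *\<^sub>R z)) = 0"
    and r: "r > 0" and g: "C1b (gauss (r\<^sup>2 / 2)) g'"
  shows "\<Lambda> (\<lambda>x. gauss (r\<^sup>2 / 2) (x - w)) (\<lambda>x. g' (x - w)) = 0"
proof -
  let ?h = "gauss (1 / (2 * r\<^sup>2)) :: 'a \<Rightarrow> real"
  let ?c = "(1 / (r * sqrt (2 * pi))) ^ DIM('a)"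
  have h: "integrable lborel ?h" and zh: "integrable lborel (\<lambda>z. norm z * ?h z)"
    using r by (intro integrable_gauss integrable_norm_mult_gauss; simp)+
  have "C1b (gauss (r\<^sup>2 / 2)) (\<lambda>x. ?c *\<^sub>R (LINT z|lborel. ?h z *\<^sub>R - (sin (z \<bullet> x) *\<^sub>R z)))"
    unfolding gauss_eq_cos_integral[OF r] by (rule C1b_mult_left[OF C1b_cos_integral[OF h zh]])
  from C1b_unique[OF g this]
  have "\<Lambda> (\<lambda>x. gauss (r\<^sup>2 / 2) (x - w)) (\<lambda>x. g' (x - w)) =
     ?c * \<Lambda> (\<lambda>x. LINT z|lborel. ?h z * cos (z \<bullet> (x - w))) (\<lambda>x. LINT z|lborel. ?h z *\<^sub>R - (sin (z \<bullet> (x - w)) *\<^sub>R z))"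
    unfolding gauss_eq_cos_integral[OF r] \<Lambda>_mult_left[symmetric] by simp
  also have "\<Lambda> (\<lambda>x. LINT z|lborel. ?h z * cos (z \<bullet> (x - w))) (\<lambda>x. LINT z|lborel. ?h z *\<^sub>R - (sin (z \<bullet> (x - w)) *\<^sub>R z))
     = (LINT z|lborel. \<Lambda> (\<lambda>x. ?h z * cos (z \<bullet> (x - w))) (\<lambda>x. ?h z *\<^sub>R - (sin (z \<bullet> (x - w)) *\<^sub>R z)))"
  proof (rule \<Lambda>_integral[where \<kappa>="\<lambda>z. ?h z + norm z * ?h z"])
    show "integrable lborel (\<lambda>z. ?h z + norm z * ?h z)"
      using h zh by auto
    show "\<bar>?h z * cos (z \<bullet> (x - w))\<bar> \<le> ?h z + norm z * ?h z" for z x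
      using mult_left_le[of "\<bar>cos (z \<bullet> (x - w))\<bar>" "?h z"] by (simp add: abs_mult add_increasing2)
    show "norm (?h z *\<^sub>R - (sin (z \<bullet> (x - w)) *\<^sub>R z)) \<le> ?h z + norm z * ?h z" for z x
      using mult_left_le[of "\<bar>sin (z \<bullet> (x - w))\<bar>" "?h z * norm z"] by (simp add: abs_mult mult_ac add_increasing)
  qed measurable
  also have "\<dots> = 0"
    by (simp only: \<Lambda>_mult_left cos) simp
  finally show ?thesis by simp
qed

text \<open>In \<open>\<Lambda>_convolution\<close> the Gaussian now plays the part of
  \<open>k\<close>, its translates being annihilated already, and \<phi> that of \<open>g\<close>.
  The mollified functions converge to \<phi> together with their gradients, boundedly.\<close>

theorem \<Lambda>_zero:
  assumes K: "C1b K K'" "integrable lborel K" and even: "\<And>\<xi>. K (- \<xi>) = K \<xi>"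
    and zero: "\<And>\<xi>. \<Lambda> (\<lambda>x. K (x - \<xi>)) (\<lambda>x. K' (x - \<xi>)) = 0"
    and dense: "closure {z. cos_transform K z \<noteq> 0} = UNIV"
    and \<phi>: "C1b \<phi> G" "integrable lborel \<phi>"
  shows "\<Lambda> \<phi> G = 0"
proof -
  let ?g = "gauss (1/2) :: 'a \<Rightarrow> real"
  let ?f = "\<lambda>n x. LINT \<zeta>|lborel. ?g \<zeta> * \<phi> (x - (1 / Suc n) *\<^sub>R \<zeta>)"
  let ?F = "\<lambda>n x. LINT \<zeta>|lborel. ?g \<zeta> *\<^sub>R G (x - (1 / Suc n) *\<^sub>R \<zeta>)"
  obtain B where B: "B \<ge> 0" "\<And>x. \<bar>\<phi> x\<bar> \<le> B" "\<And>x. norm (G x) \<le> B"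
    using C1b_bound[OF \<phi>(1)] by metis
  have gi: "integrable lborel ?g"
    by (rule gaussian_fourier_std)
  have [measurable]: "\<phi> \<in> borel_measurable borel" "G \<in> borel_measurable borel"
    using C1b_measurable[OF \<phi>(1)] by auto
  have "C1b (?f n) (?F n) \<and> \<Lambda> (?f n) (?F n) = 0" for n
  proof -
    let ?r = "real (Suc n)"
    have r: "?r > 0" by simp
    let ?k = "gauss (?r\<^sup>2 / 2) :: 'a \<Rightarrow> real"
    obtain k' where k': "C1b ?k k'"
      using C1b_gauss[of "?r\<^sup>2 / 2"] by auto
    have ki: "integrable lborel ?k"
      by (rule gaussian_fourier(1)[OF r])
    have "\<Lambda> (\<lambda>x. ?k (x - \<xi>)) (\<lambda>x. k' (x - \<xi>)) = 0" for \<xi>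
      by (rule \<Lambda>_gauss_zero[OF \<Lambda>_cos_zero[OF K even zero dense] r k'])
    from \<Lambda>_convolution[OF k' ki \<phi> this]
    have L: "\<Lambda> (\<lambda>x. LINT \<xi>|lborel. ?k \<xi> * \<phi> (x - \<xi>)) (\<lambda>x. LINT \<xi>|lborel. ?k \<xi> *\<^sub>R G (x - \<xi>)) = 0" .
    have eq1: "?f n x = ?r ^ DIM('a) * (LINT \<xi>|lborel. ?k \<xi> * \<phi> (x - \<xi>))" for x
      using gauss_rescale[OF r, of \<phi> x] by simp
    have eq2: "?F n x = ?r ^ DIM('a) *\<^sub>R (LINT \<xi>|lborel. ?k \<xi> *\<^sub>R G (x - \<xi>))" for x
      by (rule gauss_rescale[OF r]) measurable
    show ?thesis
      unfolding eq1 eq2 \<Lambda>_mult_left L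
      using C1b_mult_left[OF C1b_convolution[OF \<phi>(1) ki], of "?r ^ DIM('a)"] by (simp del: of_nat_Suc)
  qed
  then have conv: "C1b (?f n) (?F n)" and L: "\<Lambda> (?f n) (?F n) = 0" for n
    by auto
  let ?c = "sqrt (2 * pi) ^ DIM('a)"
  have gBi: "integrable lborel (\<lambda>\<zeta>. ?g \<zeta> * B)"
    using gi by (rule integrable_mult_left)
  have "(\<lambda>n. \<Lambda> (?f n) (?F n)) \<longlonglongrightarrow> \<Lambda> (\<lambda>x. ?c * \<phi> x) (\<lambda>x. ?c *\<^sub>R G x)"
  proof (rule \<Lambda>_tendsto[where B="LINT \<zeta>|lborel. ?g \<zeta> * B"])
    show "?f n \<in> borel_measurable borel" "?F n \<in> borel_measurable borel" for n
      using C1b_measurable[OF conv] by auto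
    have b: "norm (?g \<zeta> *\<^sub>R G (x - (1 / Suc n) *\<^sub>R \<zeta>)) \<le> ?g \<zeta> * B" for n x \<zeta>
      using B by (simp add: mult_left_mono)
    have b': "norm (?g \<zeta> * \<phi> (x - (1 / Suc n) *\<^sub>R \<zeta>)) \<le> ?g \<zeta> * B" for n x \<zeta>
      using B by (simp add: abs_mult mult_left_mono)
    show "norm (?F n x) \<le> (LINT \<zeta>|lborel. ?g \<zeta> * B)" for n x
      by (rule norm_integral_le_integral[OF _ gBi b], rule Bochner_Integration.integrable_bound[OF gBi])
        (use order_trans[OF b abs_ge_self] in auto)
    have "norm (?f n x) \<le> (LINT \<zeta>|lborel. ?g \<zeta> * B)" for n x
      by (rule norm_integral_le_integral[OF _ gBi b'], rule Bochner_Integration.integrable_bound[OF gBi])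
        (use order_trans[OF b' abs_ge_self] in auto)
    then show "\<bar>?f n x\<bar> \<le> (LINT \<zeta>|lborel. ?g \<zeta> * B)" for n x
      by simp
    have l: "(\<lambda>n. ?f n x) \<longlonglongrightarrow> ?c * \<phi> x" for x
      using tendsto_gauss_convolution[OF C1b_continuous[OF \<phi>(1)], of B x] B by simp
    show "(\<lambda>n. ?f n (a0 y)) \<longlonglongrightarrow> ?c * \<phi> (a0 y)" "(\<lambda>n. ?f n (a1 y)) \<longlonglongrightarrow> ?c * \<phi> (a1 y)" for y
      by (rule l)+
    have "(\<lambda>n. ?F n x) \<longlonglongrightarrow> ?c *\<^sub>R G x" for x
      by (rule tendsto_gauss_convolution[OF C1b_grad_continuous[OF \<phi>(1)] B(3)])
    then show "AE x in lborel. W x \<noteq> 0 \<longrightarrow> (\<lambda>n. ?F n x) \<longlonglongrightarrow> ?c *\<^sub>R G x"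
      by auto
  qed measurable
  then have "?c * \<Lambda> \<phi> G = 0"
    unfolding L \<Lambda>_mult_left by (simp add: LIMSEQ_const_iff)
  then show ?thesis
    by simp
qed

end

subsection \<open>Bounded functionals on a reproducing kernel Hilbert space\<close>

context rkhs
begin

lemma lincomb_mem: "f \<in> H \<Longrightarrow> g \<in> H \<Longrightarrow> (\<lambda>x. a * f x + b * g x) \<in> H"
  by (intro add_mem scale_mem)

lemma diff_mem: "f \<in> H \<Longrightarrow> g \<in> H \<Longrightarrow> (\<lambda>x. f x - g x) \<in> H"
  using lincomb_mem[of f g 1 "-1"] by simp

lemma ip_lincomb_left:
  assumes "f \<in> H" "g \<in> H" "h \<in> H"
  shows "ip (\<lambda>x. a * f x + b * g x) h = a * ip f h + b * ip g h"
  using assms by (simp add: ip_add ip_scale scale_mem)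

lemma ip_lincomb_right:
  assumes "f \<in> H" "g \<in> H" "h \<in> H"
  shows "ip h (\<lambda>x. a * f x + b * g x) = a * ip h f + b * ip h g"
  using assms by (simp add: ip_commute[of h] lincomb_mem ip_lincomb_left)

lemma ip_diff_left: "f \<in> H \<Longrightarrow> g \<in> H \<Longrightarrow> h \<in> H \<Longrightarrow> ip (\<lambda>x. f x - g x) h = ip f h - ip g h"
  using ip_lincomb_left[of f g h 1 "-1"] by simp

lemma ip_diff_right: "f \<in> H \<Longrightarrow> g \<in> H \<Longrightarrow> h \<in> H \<Longrightarrow> ip h (\<lambda>x. f x - g x) = ip h f - ip h g"
  using ip_lincomb_right[of f g h 1 "-1"] by simp

lemma ip_lincomb_self:
  assumes "f \<in> H" "g \<in> H"
  shows "ip (\<lambda>x. a * f x + b * g x) (\<lambda>x. a * f x + b * g x) =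
    a\<^sup>2 * ip f f + 2 * a * b * ip f g + b\<^sup>2 * ip g g"
  using assms ip_commute[of g f]
  by (simp add: ip_lincomb_left ip_lincomb_right lincomb_mem power2_eq_square algebra_simps)

definition nrm :: "('x \<Rightarrow> real) \<Rightarrow> real" where
  "nrm f = sqrt (ip f f)"

lemma nrm_nonneg: "f \<in> H \<Longrightarrow> 0 \<le> nrm f"
  by (simp add: nrm_def ip_nonneg)

lemma nrm_square: "f \<in> H \<Longrightarrow> (nrm f)\<^sup>2 = ip f f"
  by (simp add: nrm_def ip_nonneg)

lemma Cauchy_Schwarz:
  assumes "f \<in> H" "g \<in> H"
  shows "\<bar>ip f g\<bar> \<le> nrm f * nrm g"
proof -
  have "(ip f g)\<^sup>2 \<le> ip f f * ip g g"
  proof (cases "ip g g = 0")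
    case True
    then have "g = (\<lambda>_. 0)"
      using assms by (intro ip_definite)
    then have "ip f g = 0"
      using ip_lincomb_right[of f f f 0 0] assms by simp
    then show ?thesis
      using True by simp
  next
    case False
    then have pos: "ip g g > 0"
      using ip_nonneg[OF assms(2)] by simp
    \<comment> \<open>This vector is a multiple of the component of \<open>f\<close> orthogonal to
      \<open>g\<close>.\<close>
    have "0 \<le> ip (\<lambda>x. ip g g * f x + (- ip f g) * g x) (\<lambda>x. ip g g * f x + (- ip f g) * g x)"
      using assms by (intro ip_nonneg lincomb_mem)
    also have "\<dots> = ip g g * (ip f f * ip g g - (ip f g)\<^sup>2)"
      using assms by (subst ip_lincomb_self) (simp_all add: power2_eq_square algebra_simps)
    finally show ?thesis
      using pos by (simp add: zero_le_mult_iff)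
  qed
  then have "sqrt ((ip f g)\<^sup>2) \<le> sqrt (ip f f * ip g g)"
    by (rule real_sqrt_le_mono)
  then show ?thesis
    by (simp add: nrm_def real_sqrt_mult)
qed

text \<open>\<open>V\<close> need not be closed: a minimizing sequence in \<open>V\<close> of \<open>ip f f - 2 * L f\<close> is Cauchy, and its
  limit in \<open>H\<close> represents \<open>L\<close>.\<close>

theorem riesz_on_subspace:
  assumes V: "V \<subseteq> H" "V \<noteq> {}"
    and lin: "\<And>f g a b. f \<in> V \<Longrightarrow> g \<in> V \<Longrightarrow> (\<lambda>x. a * f x + b * g x) \<in> V"
    and L: "\<And>f g a b. f \<in> V \<Longrightarrow> g \<in> V \<Longrightarrow> L (\<lambda>x. a * f x + b * g x) = a * L f + b * L g"
    and bound: "\<And>f. f \<in> V \<Longrightarrow> \<bar>L f\<bar> \<le> C * nrm f"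
  shows "\<exists>g\<in>H. \<forall>h\<in>V. ip g h = L h"
proof -
  \<comment> \<open>If \<open>g\<close> represents \<open>L\<close>, then \<open>J f\<close> is the
    squared distance from \<open>f\<close> to \<open>g\<close> minus the squared norm of
    \<open>g\<close>.\<close>
  define J where "J f = ip f f - 2 * L f" for f
  have VH: "f \<in> V \<Longrightarrow> f \<in> H" for f
    using V by auto
  have lower: "- C\<^sup>2 \<le> J f" if "f \<in> V" for f
  proof -
    have "0 \<le> (nrm f - C)\<^sup>2" by simp
    then show ?thesis
      using bound[OF that] nrm_square[OF VH[OF that]] by (simp add: J_def power2_diff mult.commute)
  qed
  define m where "m = Inf (J ` V)"
  have bdd: "bdd_below (J ` V)"
    using lower by (auto intro!: bdd_belowI[of _ "- C\<^sup>2"])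
  have m_le: "m \<le> J f" if "f \<in> V" for f
    unfolding m_def using that bdd by (auto intro: cInf_lower)
  have "\<exists>f\<in>V. J f < m + 1 / real (Suc n)" for n
    using cInf_lessD[of "J ` V" "m + 1 / real (Suc n)"] V(2) unfolding m_def by auto
  then obtain F where F: "\<And>n. F n \<in> V" "\<And>n. J (F n) < m + 1 / real (Suc n)"
    by metis
  have expand: "J (\<lambda>x. a * f x + b * g x) =
      a\<^sup>2 * ip f f + 2 * a * b * ip f g + b\<^sup>2 * ip g g - 2 * (a * L f + b * L g)"
    if "f \<in> V" "g \<in> V" for f g a b
    using that by (simp add: J_def ip_lincomb_self L VH)
  \<comment> \<open>Parallelogram law: in this combination the terms in \<open>L\<close> cancel. The
    midpoint lies in \<open>V\<close>, so its value of \<open>J\<close> is at least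
    \<open>m\<close>, which makes the sequence Cauchy.\<close>
  have diff: "ip (\<lambda>x. f x - g x) (\<lambda>x. f x - g x) = 2 * J f + 2 * J g - 4 * J (\<lambda>x. (1/2) * f x + (1/2) * g x)"
    if "f \<in> V" "g \<in> V" for f g
    using ip_lincomb_self[OF VH VH, OF that, of 1 "-1"] expand[OF that, of "1/2" "1/2"]
    by (simp add: J_def field_simps power2_eq_square)
  have cauchy: "ip (\<lambda>x. F i x - F j x) (\<lambda>x. F i x - F j x) \<le> 2 / real (Suc i) + 2 / real (Suc j)" for i j
    using diff[OF F(1)[of i] F(1)[of j]] m_le[OF lin[OF F(1)[of i] F(1)[of j], of "1/2" "1/2"]] F(2)[of i] F(2)[of j]
    by (simp del: of_nat_Suc)
  have "\<exists>N. \<forall>i\<ge>N. \<forall>j\<ge>N. sqrt (ip (\<lambda>x. F i x - F j x) (\<lambda>x. F i x - F j x)) < e" if "e > 0" for e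
  proof -
    have "0 < e\<^sup>2 / 4"
      using that by simp
    then obtain N where N: "1 / real (Suc N) < e\<^sup>2 / 4"
      by (rule nat_approx_posE)
    have "sqrt (ip (\<lambda>x. F i x - F j x) (\<lambda>x. F i x - F j x)) < e" if "i \<ge> N" "j \<ge> N" for i j
    proof -
      have "1 / real (Suc i) \<le> 1 / real (Suc N)" "1 / real (Suc j) \<le> 1 / real (Suc N)"
        using that by (auto simp: frac_le)
      then have "ip (\<lambda>x. F i x - F j x) (\<lambda>x. F i x - F j x) < e\<^sup>2"
        using cauchy[of i j] N by (simp add: add_divide_distrib del: of_nat_Suc)
      then show ?thesis
        using \<open>e > 0\<close> by (intro real_less_lsqrt) (auto simp: ip_nonneg diff_mem VH F)
    qed
    then show ?thesis by blast
  qed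
  then obtain g where g: "g \<in> H" and lim: "(\<lambda>n. nrm (\<lambda>x. F n x - g x)) \<longlonglongrightarrow> 0"
    using complete[of F] F(1) VH unfolding nrm_def by blast
  have "ip g h = L h" if h: "h \<in> V" for h
  proof -
    have "(\<lambda>n. ip (\<lambda>x. F n x - g x) h) \<longlonglongrightarrow> 0"
    proof (rule Lim_null_comparison)
      show "\<forall>\<^sub>F n in sequentially. norm (ip (\<lambda>x. F n x - g x) h) \<le> nrm (\<lambda>x. F n x - g x) * nrm h"
        using Cauchy_Schwarz[OF diff_mem[OF VH[OF F(1)] g] VH[OF h]] by (intro always_eventually) simp
      show "(\<lambda>n. nrm (\<lambda>x. F n x - g x) * nrm h) \<longlonglongrightarrow> 0"
        using tendsto_mult_right[OF lim, of "nrm h"] by simp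
    qed
    then have "(\<lambda>n. ip (F n) h - ip g h) \<longlonglongrightarrow> 0"
      using F(1) VH g h by (simp add: ip_diff_left)
    then have ipl: "(\<lambda>n. ip (F n) h) \<longlonglongrightarrow> ip g h"
      by (simp add: LIM_zero_iff)
    \<comment> \<open>Moving from \<open>F n\<close> by \<open>t\<close> times \<open>h\<close>
      cannot push \<open>J\<close> below \<open>m\<close>, and \<open>J (F n)\<close> exceeds
      \<open>m\<close> by less than \<open>1 / real (Suc n)\<close>, a slack that disappears in the
      limit.\<close>
    have q: "0 \<le> 2 * t * (ip g h - L h) + t\<^sup>2 * ip h h" for t
    proof (rule LIMSEQ_le_const)
      have "(\<lambda>n. 1 / real (Suc n) + 2 * t * (ip (F n) h - L h) + t\<^sup>2 * ip h h) \<longlonglongrightarrow>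
        0 + 2 * t * (ip g h - L h) + t\<^sup>2 * ip h h"
        using LIMSEQ_inverse_real_of_nat by (intro tendsto_intros ipl) (simp add: inverse_eq_divide)
      then show "(\<lambda>n. 1 / real (Suc n) + 2 * t * (ip (F n) h - L h) + t\<^sup>2 * ip h h) \<longlonglongrightarrow>
        2 * t * (ip g h - L h) + t\<^sup>2 * ip h h"
        by simp
      have "0 \<le> 1 / real (Suc n) + 2 * t * (ip (F n) h - L h) + t\<^sup>2 * ip h h" for n
      proof -
        have "J (\<lambda>x. 1 * F n x + t * h x) = J (F n) + 2 * t * (ip (F n) h - L h) + t\<^sup>2 * ip h h"
          unfolding expand[OF F(1) h] by (simp add: J_def algebra_simps)
        then show ?thesis
          using m_le[OF lin[OF F(1)[of n] h, of 1 t]] F(2)[of n] by linarith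
      qed
      then show "\<exists>N. \<forall>n\<ge>N. 0 \<le> 1 / real (Suc n) + 2 * t * (ip (F n) h - L h) + t\<^sup>2 * ip h h"
        by blast
    qed
    define d where "d = ip g h - L h"
    have hh: "0 \<le> ip h h"
      using ip_nonneg VH h by auto
    \<comment> \<open>This \<open>t\<close> makes the quadratic negative unless
      \<open>d = 0\<close>. The 1 in the denominator spares a case distinction on
      \<open>ip h h = 0\<close>.\<close>
    have "0 \<le> 2 * (- d / (1 + ip h h)) * d + (- d / (1 + ip h h))\<^sup>2 * ip h h"
      using q[of "- d / (1 + ip h h)"] by (simp add: d_def)
    also have "\<dots> = - (d\<^sup>2 * (2 + ip h h)) / (1 + ip h h)\<^sup>2"
      using hh by (simp add: field_simps power2_eq_square add_nonneg_eq_0_iff)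
    finally have "0 \<le> - (d\<^sup>2 * (2 + ip h h))"
      using hh by (subst (asm) zero_le_divide_iff) (auto simp: add_nonneg_eq_0_iff)
    then have "d\<^sup>2 * (2 + ip h h) \<le> 0"
      by simp
    then have "d = 0"
      using hh by (auto simp: mult_le_0_iff)
    then show ?thesis by (simp add: d_def)
  qed
  with g show ?thesis by auto
qed

text \<open>The square root is the norm of the difference of the two kernel sections. For a
  translation-invariant even kernel the radicand is twice \<open>K 0 - K (x - y)\<close>, so a
  quadratic bound on that makes every element of \<open>H\<close> Lipschitz.\<close>

lemma eval_diff_le:
  assumes "f \<in> H"
  shows "\<bar>f x - f y\<bar> \<le> nrm f * sqrt (k x x - 2 * k x y + k y y)"
proof -
  have "ip (\<lambda>z. k x z - k y z) (\<lambda>z. k x z - k y z) = k x x - 2 * k x y + k y y"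
    using reproducing[of "k x" x] reproducing[of "k x" y] reproducing[of "k y" y] ip_commute[of "k x" "k y"]
    by (simp add: ip_diff_left ip_diff_right diff_mem kernel_mem)
  moreover have "f x - f y = ip f (\<lambda>z. k x z - k y z)"
    using assms reproducing[OF assms] by (simp add: ip_diff_right kernel_mem)
  ultimately show ?thesis
    using Cauchy_Schwarz[OF assms diff_mem[OF kernel_mem[of x] kernel_mem[of y]]] by (simp add: nrm_def)
qed

lemma eval_le:
  assumes "f \<in> H"
  shows "\<bar>f x\<bar> \<le> nrm f * sqrt (k x x)"
  using Cauchy_Schwarz[OF assms kernel_mem[of x]] reproducing[OF assms, of x] reproducing[OF kernel_mem, of x x]
  by (simp add: nrm_def)

end

section \<open>Membership of the residual in the RKHS\<close>

lemma lipschitz_grad_bound: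
  fixes f :: "'a::euclidean_space \<Rightarrow> real"
  assumes f: "(f has_derivative (\<lambda>h. G \<bullet> h)) (at x)" and L: "\<And>y. \<bar>f y - f x\<bar> \<le> L * norm (y - x)"
  shows "norm G \<le> L"
proof (cases "G = 0")
  case True
  \<comment> \<open>Some point different from \<open>x\<close> is needed to see that
    \<open>L\<close> is nonnegative.\<close>
  obtain b :: 'a where "b \<in> Basis" using nonempty_Basis by blast
  then have "0 \<le> L" using L[of "x + b"] abs_ge_zero[of "f (x + b) - f x"] by simp
  with True show ?thesis by simp
next
  case False
  have "((\<lambda>t. x + t *\<^sub>R G) has_derivative (\<lambda>t. t *\<^sub>R G)) (at 0)"
    by (auto intro!: derivative_eq_intros)
  moreover have "(f has_derivative (\<lambda>h. G \<bullet> h)) (at (x + 0 *\<^sub>R G))"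
    using f by simp
  ultimately have "((\<lambda>t. f (x + t *\<^sub>R G)) has_derivative (\<lambda>t. G \<bullet> (t *\<^sub>R G))) (at 0)"
    by (rule has_derivative_compose)
  then have "((\<lambda>t. f (x + t *\<^sub>R G)) has_real_derivative (G \<bullet> G)) (at 0)"
    by (simp add: has_field_derivative_def mult_commute_abs)
  then have "((\<lambda>t. (f (x + t *\<^sub>R G) - f x) / t) \<longlongrightarrow> G \<bullet> G) (at 0)"
    by (simp add: has_field_derivative_iff)
  moreover have "\<forall>\<^sub>F t in at 0. (f (x + t *\<^sub>R G) - f x) / t \<le> L * norm G"
    unfolding eventually_at_filter
  proof (intro always_eventually allI impI)
    fix t :: real assume "t \<noteq> 0"
    have "\<bar>(f (x + t *\<^sub>R G) - f x) / t\<bar> \<le> L * norm G"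
      using L[of "x + t *\<^sub>R G"] \<open>t \<noteq> 0\<close> by (simp add: abs_divide field_simps)
    then show "(f (x + t *\<^sub>R G) - f x) / t \<le> L * norm G"
      by (rule order_trans[OF abs_ge_self])
  qed
  ultimately have "G \<bullet> G \<le> L * norm G"
    by (rule tendsto_upperbound) simp
  then show ?thesis
    using False by (simp add: dot_square_norm power2_eq_square)
qed

text \<open>\<open>\<Lambda>\<close> needs gradients, so it is considered on the differentiable
  elements only; by evenness the kernel sections are the translates of \<open>K\<close> and belong
  to them. Evaluating the representative at \<xi> means pairing it with such a section.\<close>

theorem (in first_order_functional) \<Lambda>_translates_in_rkhs:
  assumes H: "rkhs H ip (\<lambda>\<xi> \<eta>. K (\<xi> - \<eta>))"
    and K: "C1b K K'" and even: "\<And>\<xi>. K (- \<xi>) = K \<xi>"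
    and quad: "\<And>\<xi>. K 0 - K \<xi> \<le> B * (norm \<xi>)\<^sup>2" and B: "B \<ge> 0"
  shows "(\<lambda>\<xi>. \<Lambda> (\<lambda>x. K (x - \<xi>)) (\<lambda>x. K' (x - \<xi>))) \<in> H"
proof -
  interpret rkhs H ip "\<lambda>\<xi> \<eta>. K (\<xi> - \<eta>)" by fact
  define V where "V = {f \<in> H. \<exists>G. C1b f G}"
  \<comment> \<open>The choice is forced by \<open>C1b_unique\<close>, which is why \<open>L\<close>
    is linear.\<close>
  define L where "L f = \<Lambda> f (SOME G. C1b f G)" for f
  have L: "L f = \<Lambda> f G" if "C1b f G" for f G
    unfolding L_def using C1b_unique[OF that someI[of "C1b f", OF that]] by simp
  \<comment> \<open>The first entry comes from evaluating at a point, the second from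
    \<open>K 0 - 2 * K h + K 0 \<le> 2 * B * (norm h)\<^sup>2\<close>;
    \<open>\<Lambda>_bound\<close> wants one constant for values and gradients.\<close>
  define c where "c = max (sqrt (K 0)) (sqrt (2 * B))"
  have ker: "(\<lambda>\<eta>. K (\<xi> - \<eta>)) = (\<lambda>x. K (x - \<xi>))" for \<xi>
    using even[of "\<xi> - x" for x] by (simp add: fun_eq_iff)
  have kerV: "(\<lambda>x. K (x - \<xi>)) \<in> V" for \<xi>
    using kernel_mem[of \<xi>] C1b_translate[OF K, of \<xi>] unfolding V_def ker by auto
  have bound: "\<bar>L f\<bar> \<le> total_mass * c * nrm f" if f: "f \<in> V" for f
  proof -
    from f obtain G where fH: "f \<in> H" and G: "C1b f G" by (auto simp: V_def)
    have "\<bar>f x\<bar> \<le> c * nrm f" for x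
    proof -
      have "\<bar>f x\<bar> \<le> nrm f * sqrt (K 0)"
        using eval_le[OF fH, of x] by simp
      also have "\<dots> \<le> nrm f * c"
        using nrm_nonneg[OF fH] by (intro mult_left_mono) (auto simp: c_def)
      finally show ?thesis by (simp add: mult.commute)
    qed
    moreover have "norm (G x) \<le> c * nrm f" for x
    proof (rule lipschitz_grad_bound[OF C1b_deriv[OF G]])
      fix y
      have "sqrt (K 0 - 2 * K (y - x) + K 0) \<le> sqrt (2 * B * (norm (y - x))\<^sup>2)"
        using quad[of "y - x"] by (intro real_sqrt_le_mono) simp
      also have "\<dots> = sqrt (2 * B) * norm (y - x)"
        using B by (simp add: real_sqrt_mult)
      also have "\<dots> \<le> c * norm (y - x)"
        by (intro mult_right_mono) (auto simp: c_def)
      finally have "nrm f * sqrt (K 0 - 2 * K (y - x) + K 0) \<le> nrm f * (c * norm (y - x))"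
        using nrm_nonneg[OF fH] by (rule mult_left_mono)
      then show "\<bar>f y - f x\<bar> \<le> c * nrm f * norm (y - x)"
        using eval_diff_le[OF fH, of y x] by (auto simp: mult_ac intro: order_trans)
    qed
    ultimately show ?thesis
      using \<Lambda>_bound[OF C1b_measurable[OF G], of "c * nrm f"] L[OF G] by (simp add: mult.assoc)
  qed
  have "\<exists>g\<in>H. \<forall>h\<in>V. ip g h = L h"
  proof (rule riesz_on_subspace[of V L "total_mass * c"])
    show "V \<subseteq> H"
      by (auto simp: V_def)
    show "V \<noteq> {}"
      using kerV by blast
    show "(\<lambda>x. a * f x + b * g x) \<in> V" if "f \<in> V" "g \<in> V" for f g a b
      using that lincomb_mem C1b_lincomb unfolding V_def by blast
    show "L (\<lambda>x. a * f x + b * g x) = a * L f + b * L g" if fg: "f \<in> V" "g \<in> V" for f g a b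
    proof -
      obtain F G where "C1b f F" "C1b g G"
        using fg unfolding V_def by blast
      then show ?thesis
        by (simp add: L[OF C1b_lincomb, of f F g G] L[of f F] L[of g G] \<Lambda>_lincomb)
    qed
  qed (rule bound)
  then obtain g where g: "g \<in> H" "\<And>h. h \<in> V \<Longrightarrow> ip g h = L h" by auto
  have "g \<xi> = \<Lambda> (\<lambda>x. K (x - \<xi>)) (\<lambda>x. K' (x - \<xi>))" for \<xi>
    using reproducing[OF g(1), of \<xi>] g(2)[OF kerV[of \<xi>]] L[OF C1b_translate[OF K], of \<xi>] unfolding ker by simp
  then have "g = (\<lambda>\<xi>. \<Lambda> (\<lambda>x. K (x - \<xi>)) (\<lambda>x. K' (x - \<xi>)))"
    by (rule ext)
  then show ?thesis
    using g(1) by blast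
qed

subsection \<open>Regularity of the kernel\<close>

lemma one_minus_cos_le: "1 - cos (t::real) \<le> t\<^sup>2 / 2"
proof -
  have "1 - cos t = 2 * (sin (t / 2))\<^sup>2"
    using cos_double_sin[of "t / 2"] by simp
  also have "(sin (t / 2))\<^sup>2 \<le> (t / 2)\<^sup>2"
    using abs_sin_x_le_abs_x[of "t / 2"] by (simp only: abs_le_square_iff)
  finally show ?thesis by (simp add: power2_eq_square)
qed

text \<open>Inversion writes \<open>K\<close> as a superposition of cosines: the first moment of the
  transform permits differentiation, the second gives the quadratic bound at the origin through
  \<open>one_minus_cos_le\<close>.\<close>

lemma cos_inversion_regularity:
  fixes K :: "'a::euclidean_space \<Rightarrow> real"
  assumes cont: "continuous_on UNIV K" and bounded: "\<And>x. \<bar>K x\<bar> \<le> B" and K: "integrable lborel K"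
    and even: "\<And>\<xi>. K (- \<xi>) = K \<xi>"
    and C: "integrable lborel (\<lambda>z. (1 + (norm z)\<^sup>2) * cos_transform K z)"
  shows "\<exists>K'. C1b K K'" "\<exists>B\<ge>0. \<forall>\<xi>. K 0 - K \<xi> \<le> B * (norm \<xi>)\<^sup>2"
proof -
  let ?C = "cos_transform K" let ?c = "1 / (2 * pi) ^ DIM('a)"
  have [measurable]: "?C \<in> borel_measurable borel"
    using continuous_cos_transform[OF K] by (rule borel_measurable_continuous_onI)
  have dom: "integrable lborel f" if "f \<in> borel_measurable borel"
    "\<And>z. \<bar>f z\<bar> \<le> (1 + (norm z)\<^sup>2) * \<bar>?C z\<bar>" for f :: "'a \<Rightarrow> real"
    by (rule Bochner_Integration.integrable_bound[OF C]) (use that in \<open>auto simp: abs_mult\<close>)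
  have 1: "integrable lborel ?C"
    by (rule dom) (auto simp: algebra_simps)
  have "norm z \<le> 1 + (norm z)\<^sup>2" for z :: 'a
    using sum_squares_bound[of 1 "norm z"] norm_ge_zero[of z] by (simp only: one_power2)
  then have 2: "integrable lborel (\<lambda>z. norm z * ?C z)"
    by (intro dom) (auto simp: abs_mult intro!: mult_right_mono)
  have 3: "integrable lborel (\<lambda>z. (norm z)\<^sup>2 * \<bar>?C z\<bar>)"
    by (rule dom) (auto simp: abs_mult intro!: mult_right_mono)
  have inv: "K x = ?c * (LINT z|lborel. ?C z * cos (z \<bullet> x))" for x
    using cos_inversion[OF cont bounded K even 1, of x] by simp
  show "\<exists>K'. C1b K K'"
    using C1b_mult_left[OF C1b_cos_integral[OF 1 2], of ?c] unfolding inv[symmetric] by blast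
  \<comment> \<open>Half the second absolute moment of the transform, times the inversion
    constant.\<close>
  let ?B = "?c * (LINT z|lborel. (norm z)\<^sup>2 * \<bar>?C z\<bar>) / 2"
  have "K 0 - K \<xi> \<le> ?B * (norm \<xi>)\<^sup>2" for \<xi>
  proof -
    have i: "integrable lborel (\<lambda>z. ?C z * cos (z \<bullet> x))" for x
      using 1 by (intro integrable_bounded_mult(2)[where B=1]) auto
    have "K 0 - K \<xi> = ?c * (LINT z|lborel. ?C z * (1 - cos (z \<bullet> \<xi>)))"
      using inv[of 0] inv[of \<xi>] i[of \<xi>] 1 by (simp add: right_diff_distrib diff_divide_distrib)
    also have "(LINT z|lborel. ?C z * (1 - cos (z \<bullet> \<xi>))) \<le> (LINT z|lborel. (norm z)\<^sup>2 * \<bar>?C z\<bar> * ((norm \<xi>)\<^sup>2 / 2))"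
    proof (rule integral_mono)
      show "integrable lborel (\<lambda>z. ?C z * (1 - cos (z \<bullet> \<xi>)))"
        using i 1 by (simp add: right_diff_distrib)
      show "integrable lborel (\<lambda>z. (norm z)\<^sup>2 * \<bar>?C z\<bar> * ((norm \<xi>)\<^sup>2 / 2))"
        using 3 by (rule integrable_mult_left)
      fix z
      have "(z \<bullet> \<xi>)\<^sup>2 \<le> (norm z * norm \<xi>)\<^sup>2"
        using Cauchy_Schwarz_ineq2[of z \<xi>] by (metis abs_ge_zero power2_abs power_mono)
      then have "\<bar>?C z\<bar> * (1 - cos (z \<bullet> \<xi>)) \<le> \<bar>?C z\<bar> * ((norm z * norm \<xi>)\<^sup>2 / 2)"
        using one_minus_cos_le[of "z \<bullet> \<xi>"] by (intro mult_left_mono) auto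
      also have "\<dots> = (norm z)\<^sup>2 * \<bar>?C z\<bar> * ((norm \<xi>)\<^sup>2 / 2)"
        by (simp add: power_mult_distrib mult_ac)
      finally have "\<bar>?C z\<bar> * (1 - cos (z \<bullet> \<xi>)) \<le> (norm z)\<^sup>2 * \<bar>?C z\<bar> * ((norm \<xi>)\<^sup>2 / 2)" .
      moreover have "?C z * (1 - cos (z \<bullet> \<xi>)) \<le> \<bar>?C z\<bar> * (1 - cos (z \<bullet> \<xi>))"
        by (intro mult_right_mono) auto
      ultimately show "?C z * (1 - cos (z \<bullet> \<xi>)) \<le> (norm z)\<^sup>2 * \<bar>?C z\<bar> * ((norm \<xi>)\<^sup>2 / 2)"
        by linarith
    qed
    also have "(LINT z|lborel. (norm z)\<^sup>2 * \<bar>?C z\<bar> * ((norm \<xi>)\<^sup>2 / 2)) =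
        (LINT z|lborel. (norm z)\<^sup>2 * \<bar>?C z\<bar>) * ((norm \<xi>)\<^sup>2 / 2)"
      by (rule integral_mult_left_zero)
    finally show ?thesis by (simp add: mult_left_mono mult_ac divide_right_mono)
  qed
  moreover have "?B \<ge> 0" by simp
  ultimately show "\<exists>B\<ge>0. \<forall>\<xi>. K 0 - K \<xi> \<le> B * (norm \<xi>)\<^sup>2" by blast
qed

lemma fourier_eq_cos_transform:
  fixes K :: "'a::euclidean_space \<Rightarrow> real"
  assumes K: "integrable lborel K" and even: "\<And>\<xi>. K (- \<xi>) = K \<xi>"
  shows "fourier K z = complex_of_real ((2 * pi) powr (- real DIM('a) / 2) * cos_transform K z)"
proof -
  have i: "integrable lborel (\<lambda>\<xi>. cos (z \<bullet> \<xi>) * K \<xi>)" "integrable lborel (\<lambda>\<xi>. sin (z \<bullet> \<xi>) * K \<xi>)"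
    using K by (auto intro!: integrable_bounded_mult(1)[where B=1])
  have s: "(LINT \<xi>|lborel. sin (z \<bullet> \<xi>) * K \<xi>) = 0"
    using even_convolution_trig(2)[OF K even, of z 0] by (simp add: mult.commute)
  have e: "exp (- (\<i> * complex_of_real (z \<bullet> \<xi>))) * complex_of_real (K \<xi>) =
      complex_of_real (cos (z \<bullet> \<xi>) * K \<xi>) - \<i> * complex_of_real (sin (z \<bullet> \<xi>) * K \<xi>)" for \<xi>
    by (simp add: complex_eq_iff Re_exp Im_exp)
  have "(LINT \<xi>|lborel. exp (- (\<i> * complex_of_real (z \<bullet> \<xi>))) * complex_of_real (K \<xi>)) =
     complex_of_real (LINT \<xi>|lborel. cos (z \<bullet> \<xi>) * K \<xi>) - \<i> * complex_of_real (LINT \<xi>|lborel. sin (z \<bullet> \<xi>) * K \<xi>)"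
    unfolding e using i by (subst Bochner_Integration.integral_diff) (auto simp del: of_real_mult)
  then show ?thesis
    by (simp add: fourier_def s cos_transform_def)
qed

subsection \<open>The continuity equation on the slab\<close>

lemma trivial_limit_time:
  fixes T :: real
  assumes "T > 0" "t \<in> {0..T}" "I = UNIV \<or> I = {0..T}"
  shows "at t within I \<noteq> bot"
  using assms by (auto simp: trivial_limit_within)

text \<open>\<open>I\<close> covers both readings of the time derivative: two-sided for
  \<open>K\<close> on the whole space, one-sided at 0 and \<open>T\<close> for functions on the
  slab. The total derivative is restricted to a time line and a time slice; a nontrivial filter
  makes the derivative along the line unique.\<close>

lemma transport_op_eq:
  assumes \<phi>: "(\<phi> has_derivative (\<lambda>h. G \<bullet> h)) (at (t, x) within I \<times> UNIV)"
    and t: "t \<in> I" "at t within I \<noteq> bot"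
  shows "partial_t I \<phi> (t, x) = fst G" "grad_x \<phi> (t, x) = snd G"
    "transport_op I u \<phi> (t, x) = (1, u (t, x)) \<bullet> G"
proof -
  have "((\<lambda>s. (s, x)) has_derivative (\<lambda>h. (h, 0))) (at t within I)"
    by (auto intro!: derivative_eq_intros)
  moreover have "(\<phi> has_derivative (\<lambda>h. G \<bullet> h)) (at (t, x) within (\<lambda>s. (s, x)) ` I)"
    by (rule has_derivative_subset[OF \<phi>]) auto
  ultimately have "((\<lambda>s. \<phi> (s, x)) has_derivative (\<lambda>h. G \<bullet> (h, 0))) (at t within I)"
    by (rule has_derivative_in_compose)
  then have "((\<lambda>s. \<phi> (s, x)) has_vector_derivative fst G) (at t within I)"
    by (simp add: has_vector_derivative_def inner_prod_def mult.commute)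
  then show 1: "partial_t I \<phi> (t, x) = fst G"
    unfolding partial_t_def using vector_derivative_within[OF t(2)] by simp
  have "((\<lambda>y. (t, y)) has_derivative (\<lambda>h. (0, h))) (at x)"
    by (auto intro!: derivative_eq_intros)
  moreover have "(\<phi> has_derivative (\<lambda>h. G \<bullet> h)) (at (t, x) within (\<lambda>y. (t, y)) ` UNIV)"
    by (rule has_derivative_subset[OF \<phi>]) (use t in auto)
  ultimately have "((\<lambda>y. \<phi> (t, y)) has_derivative (\<lambda>h. G \<bullet> (0, h))) (at x)"
    by (rule has_derivative_in_compose)
  from frechet_derivative_at[OF this]
  have "frechet_derivative (\<lambda>y. \<phi> (t, y)) (at x) = (\<lambda>h. snd G \<bullet> h)"
    by (simp add: inner_prod_def)
  then show 2: "grad_x \<phi> (t, x) = snd G"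
    by (simp add: grad_x_def inner_axis vec_eq_iff)
  show "transport_op I u \<phi> (t, x) = (1, u (t, x)) \<bullet> G"
    unfolding transport_op_def 1 2 by (simp add: inner_prod_def)
qed

lemma C1b_has_derivative_within: "C1b f G \<Longrightarrow> (f has_derivative (\<lambda>h. G x \<bullet> h)) (at x within S)"
  using C1b_deriv has_derivative_at_withinI by blast

lemma C1_bounded_of_C1b:
  assumes "C1b \<phi> G"
  shows "C1_bounded T \<phi>"
  unfolding C1_bounded_def
proof (intro conjI exI[where x="\<lambda>z. blinfun_inner_right (G z)"] ballI)
  obtain B where B: "\<And>x. \<bar>\<phi> x\<bar> \<le> B" "\<And>x. norm (G x) \<le> B"
    using C1b_bound[OF assms] by metis
  show "bounded (\<phi> ` slab T)"
    using B by (auto intro!: boundedI)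
  show "(\<phi> has_derivative blinfun_apply (blinfun_inner_right (G z))) (at z within slab T)" for z
    using C1b_has_derivative_within[OF assms, of z "slab T"] by simp
  show "continuous_on (slab T) (\<lambda>z. blinfun_inner_right (G z))"
    using continuous_on_subset[OF C1b_grad_continuous[OF assms], of "slab T"]
    by (intro bounded_linear.continuous_on[OF bounded_linear_blinfun_inner_right]) auto
  have "bounded (G ` slab T)"
    using B by (auto intro!: boundedI)
  from bounded_linear_image[OF this bounded_linear_blinfun_inner_right]
  show "bounded ((\<lambda>z. blinfun_inner_right (G z)) ` slab T)"
    by (simp add: image_image)
qed

lemma C1_bounded_gradient:
  assumes "C1_bounded T \<phi>"
  obtains G B where "\<And>z. z \<in> slab T \<Longrightarrow> (\<phi> has_derivative (\<lambda>h. G z \<bullet> h)) (at z within slab T)"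
    "continuous_on (slab T) G" "B \<ge> 0" "\<And>z. z \<in> slab T \<Longrightarrow> \<bar>\<phi> z\<bar> \<le> B" "\<And>z. z \<in> slab T \<Longrightarrow> norm (G z) \<le> B"
proof -
  obtain D where bd: "bounded (\<phi> ` slab T)"
    and D: "\<And>z. z \<in> slab T \<Longrightarrow> (\<phi> has_derivative blinfun_apply (D z)) (at z within slab T)"
    and cD: "continuous_on (slab T) D" and bD: "bounded (D ` slab T)"
    using assms unfolding C1_bounded_def by blast
  define G where "G z = (\<Sum>b\<in>Basis. blinfun_apply (D z) b *\<^sub>R b)" for z
  have G: "blinfun_apply (D z) h = G z \<bullet> h" for z h
  proof -
    have "blinfun_apply (D z) h = blinfun_apply (D z) (\<Sum>b\<in>Basis. (h \<bullet> b) *\<^sub>R b)"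
      by (simp only: euclidean_representation)
    also have "\<dots> = G z \<bullet> h"
      by (simp add: G_def blinfun.sum_right blinfun.scaleR_right inner_sum_left inner_commute[of h] mult.commute)
    finally show ?thesis .
  qed
  obtain B1 where B1: "\<And>z. z \<in> slab T \<Longrightarrow> \<bar>\<phi> z\<bar> \<le> B1"
    using bd by (auto simp: bounded_iff)
  obtain B2 where B2: "\<And>z. z \<in> slab T \<Longrightarrow> norm (D z) \<le> B2"
    using bD by (auto simp: bounded_iff)
  have nG: "norm (G z) \<le> norm (D z)" for z
  proof (cases "G z = 0")
    case False
    have "norm (G z) * norm (G z) = norm (blinfun_apply (D z) (G z))"
      by (simp add: G dot_square_norm power2_eq_square)
    also have "\<dots> \<le> norm (D z) * norm (G z)"
      by (rule norm_blinfun)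
    finally show ?thesis using False by simp
  qed simp
  show ?thesis
  proof (rule that[of G "max (max B1 B2) 0"])
    show "(\<phi> has_derivative (\<lambda>h. G z \<bullet> h)) (at z within slab T)" if "z \<in> slab T" for z
      using D[OF that] unfolding G[symmetric] .
    show "continuous_on (slab T) G"
      unfolding G_def[abs_def] using cD by (intro continuous_intros)
    show "\<bar>\<phi> z\<bar> \<le> max (max B1 B2) 0" if "z \<in> slab T" for z
      using B1[OF that] by simp
    show "norm (G z) \<le> max (max B1 B2) 0" if "z \<in> slab T" for z
      using B2[OF that] nG[of z] by simp
  qed simp
qed

text \<open>Bounds come from compactness of the support. On its open complement \<phi> is locally
  zero, so the gradient vanishes there as well.\<close>

lemma test_function_C1b:
  assumes "test_function \<Omega> \<phi>"
  obtains G where "C1b \<phi> G" "\<And>z. z \<notin> \<Omega> \<Longrightarrow> \<phi> z = 0" "\<And>z. z \<notin> \<Omega> \<Longrightarrow> G z = 0"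
proof -
  let ?S = "closure {z. \<phi> z \<noteq> 0}"
  have S: "compact ?S" "?S \<subseteq> \<Omega>" and "C_k (Suc 0) \<phi>"
    using assms unfolding test_function_def by blast+
  then have diff: "\<phi> differentiable (at x)" and cont: "continuous_on UNIV (\<lambda>x. frechet_derivative \<phi> (at x) v)" for x v
    by (auto simp: differentiable_on_def)
  define G where "G z = (\<Sum>b\<in>Basis. frechet_derivative \<phi> (at z) b *\<^sub>R b)" for z
  have G: "frechet_derivative \<phi> (at z) h = G z \<bullet> h" for z h
  proof -
    interpret linear "frechet_derivative \<phi> (at z)"
      using diff by (rule linear_frechet_derivative)
    have "frechet_derivative \<phi> (at z) h = frechet_derivative \<phi> (at z) (\<Sum>b\<in>Basis. (h \<bullet> b) *\<^sub>R b)"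
      by (simp only: euclidean_representation)
    also have "\<dots> = G z \<bullet> h"
      by (simp add: G_def sum scale inner_sum_left inner_commute[of h] mult.commute)
    finally show ?thesis .
  qed
  have d: "(\<phi> has_derivative (\<lambda>h. G z \<bullet> h)) (at z)" for z
    using diff[of z] unfolding frechet_derivative_works ext[of "frechet_derivative \<phi> (at z)", OF G] .
  have zero: "\<phi> z = 0" if "z \<notin> ?S" for z
    using that closure_subset[of "{z. \<phi> z \<noteq> 0}"] by auto
  have G0: "G z = 0" if "z \<notin> ?S" for z
  proof -
    have "((\<lambda>_. 0) has_derivative (\<lambda>h. G z \<bullet> h)) (at z)"
    proof (rule has_derivative_transform_within_open[OF d[of z]])
      show "open (- ?S)" by (intro open_Compl closed_closure)
      show "z \<in> - ?S" using that by simp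
      show "\<phi> x = 0" if "x \<in> - ?S" for x
        by (rule zero) (use that in simp)
    qed
    from has_derivative_unique[OF this has_derivative_const]
    have "G z \<bullet> G z = 0" by (rule fun_cong)
    then show ?thesis by simp
  qed
  have cG: "continuous_on UNIV G"
    unfolding G_def[abs_def] by (intro continuous_intros cont)
  have c\<phi>: "continuous_on UNIV \<phi>"
    using has_derivative_continuous[OF d] by (intro continuous_at_imp_continuous_on) blast
  have "bounded (\<phi> ` ?S)" "bounded (G ` ?S)"
    using S(1) c\<phi> cG by (auto intro!: compact_imp_bounded compact_continuous_image intro: continuous_on_subset)
  then obtain B1 B2 where B1: "\<And>z. z \<in> ?S \<Longrightarrow> \<bar>\<phi> z\<bar> \<le> B1" and B2: "\<And>z. z \<in> ?S \<Longrightarrow> norm (G z) \<le> B2"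
    unfolding bounded_iff by auto
  show ?thesis
  proof (rule that[of G])
    show "C1b \<phi> G"
    proof (rule C1bI[OF d cG])
      show "\<bar>\<phi> x\<bar> \<le> \<bar>B1\<bar>" for x
        using B1[of x] zero[of x] by (cases "x \<in> ?S") auto
      show "norm (G x) \<le> \<bar>B2\<bar>" for x
        using B2[of x] G0[of x] by (cases "x \<in> ?S") auto
    qed
  qed (use S(2) zero G0 in blast)+
qed

section \<open>The density curve as a first-order functional\<close>

text \<open>Mass and momentum as one space-time vector, cut off at time \<open>s\<close>: its inner
  product with the full gradient of \<phi> is \<open>p\<close> times the transport operator applied
  to \<phi>.\<close>

definition transport_field :: "(real \<times> (real^'d) \<Rightarrow> real) \<Rightarrow> (real \<times> (real^'d) \<Rightarrow> real^'d) \<Rightarrow>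
    real \<Rightarrow> real \<times> (real^'d) \<Rightarrow> real \<times> (real^'d)" where
  "transport_field p u s z = indicator ({0..s} \<times> UNIV) z *\<^sub>R (p z *\<^sub>R (1, u z))"

locale density_curve =
  fixes T :: real and p :: "real \<times> (real^'d) \<Rightarrow> real"
  assumes T_pos: "T > 0"
    and p_continuous: "continuous_L1 T p"
    and p_bounded: "L_infinity T p"
    and p_nonneg: "\<And>t x. t \<in> {0..T} \<Longrightarrow> 0 \<le> p (t, x)"
    and p_mass: "\<And>t. t \<in> {0..T} \<Longrightarrow> (LINT x|lborel. p (t, x)) = 1"
begin

lemma slab_sets[measurable]: "slab T \<in> sets borel"
  by (intro borel_closed closed_Times) auto

lemma p_slice_integrable: "t \<in> {0..T} \<Longrightarrow> integrable lborel (\<lambda>x. p (t, x))"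
  using p_continuous by (auto simp: continuous_L1_def)

text \<open>Each slice has mass 1, so the integral over space of the absolute value is the indicator
  of \<open>{0..T}\<close>.\<close>

lemma p_slab_integrable: "integrable lborel (\<lambda>z. indicator (slab T) z * p z)"
proof -
  have "(\<lambda>z. indicator (slab T) z * p z) \<in> borel_measurable borel"
    using p_bounded unfolding L_infinity_def by (auto simp: borel_measurable_restrict_space_iff)
  then have m: "(\<lambda>z. indicator (slab T) z * p z) \<in> borel_measurable (lborel \<Otimes>\<^sub>M lborel)"
    by (simp add: lborel_prod)
  have eq: "indicator (slab T) (t, x) * p (t, x) = indicator {0..T} t * p (t, x)" for t x
    by (simp add: indicator_def)
  have "integrable (lborel \<Otimes>\<^sub>M lborel) (\<lambda>z. indicator (slab T) z * p z)"
  proof (rule lborel_pair.Fubini_integrable[OF m])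
    have "(LINT x|lborel. norm (indicator (slab T) (t, x) * p (t, x))) = indicator {0..T} t" for t
      using p_mass[of t] p_nonneg[of t] by (cases "t \<in> {0..T}") (auto simp: indicator_def)
    then show "integrable lborel (\<lambda>t. LINT x|lborel. norm (indicator (slab T) (t, x) * p (t, x)))"
      by (simp only:) (rule integrable_real_indicator, simp_all add: emeasure_lborel_Icc_eq)
    show "AE t in lborel. integrable lborel (\<lambda>x. indicator (slab T) (t, x) * p (t, x))"
      using p_slice_integrable unfolding eq by (intro AE_I2) (auto simp: indicator_def)
  qed
  then show ?thesis by (simp add: lborel_prod)
qed

lemma momentum_integrable:
  assumes "u \<in> L1_vec T p"
  shows "integrable lborel (\<lambda>z. indicator (slab T) z *\<^sub>R (p z *\<^sub>R u z))"
proof -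
  have int: "integrable (density (restrict_space lborel (slab T)) (\<lambda>z. ennreal (p z))) u"
    using assms by (simp add: L1_vec_def)
  have sets: "sets (restrict_space lborel (slab T)) = sets (restrict_space borel (slab T))"
    by (rule sets_restrict_space_cong) simp
  have "u \<in> borel_measurable (restrict_space lborel (slab T))"
    using borel_measurable_integrable[OF int] by simp
  moreover have "p \<in> borel_measurable (restrict_space lborel (slab T))"
    using p_bounded by (simp add: L_infinity_def cong: measurable_cong_sets[OF sets refl])
  moreover have "AE z in restrict_space lborel (slab T). 0 \<le> p z"
    using p_nonneg by (intro AE_I2) (auto simp: space_restrict_space)
  ultimately have "integrable (restrict_space lborel (slab T)) (\<lambda>z. p z *\<^sub>R u z)"
    using int by (subst (asm) integrable_density) auto
  then show ?thesis
    by (subst (asm) integrable_restrict_space) auto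
qed

lemma transport_field_integrable:
  assumes u: "u \<in> L1_vec T p" and s: "s \<in> {0..T}"
  shows "integrable lborel (transport_field p u s)"
proof -
  have 1: "integrable lborel (\<lambda>z. (indicator (slab T) z * p z) *\<^sub>R ((1, 0) :: real \<times> (real^'d)))"
    using p_slab_integrable by (intro integrable_scaleR_left)
  have "bounded_linear (\<lambda>v. (0, v) :: real \<times> (real^'d))"
    by (intro bounded_linear_Pair bounded_linear_zero bounded_linear_ident)
  from integrable_bounded_linear[OF this momentum_integrable[OF u]]
  have "integrable lborel (\<lambda>z. (indicator (slab T) z * p z) *\<^sub>R ((1, 0) :: real \<times> (real^'d)) +
      (0, indicator (slab T) z *\<^sub>R (p z *\<^sub>R u z)))"
    by (intro Bochner_Integration.integrable_add 1)
  then have "integrable lborel (\<lambda>z. indicator ({0..s} \<times> UNIV) z *\<^sub>R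
      ((indicator (slab T) z * p z) *\<^sub>R ((1, 0) :: real \<times> (real^'d)) + (0, indicator (slab T) z *\<^sub>R (p z *\<^sub>R u z))))"
    by (intro integrable_mult_indicator) (auto intro!: borel_closed closed_Times)
  moreover have "indicator ({0..s} \<times> UNIV) z *\<^sub>R
      ((indicator (slab T) z * p z) *\<^sub>R ((1, 0) :: real \<times> (real^'d)) + (0, indicator (slab T) z *\<^sub>R (p z *\<^sub>R u z)))
    = transport_field p u s z" for z
    using s by (cases z) (auto simp: transport_field_def indicator_def)
  ultimately show ?thesis by simp
qed

lemma is_first_order_functional:
  assumes u: "u \<in> L1_vec T p" and s: "s \<in> {0..T}"
  shows "first_order_functional (transport_field p u s) (\<lambda>y. p (0, y)) (\<lambda>y. - p (s, y)) (\<lambda>y. (0, y)) (\<lambda>y. (s, y))"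
  using transport_field_integrable[OF u s] p_slice_integrable[of 0] p_slice_integrable[OF s] T_pos
  by unfold_locales auto

definition weak_form :: "(real \<times> (real^'d) \<Rightarrow> real^'d) \<Rightarrow> real \<Rightarrow> (real \<times> (real^'d) \<Rightarrow> real) \<Rightarrow>
    (real \<times> (real^'d) \<Rightarrow> real \<times> (real^'d)) \<Rightarrow> real" where
  "weak_form u s = first_order_functional.\<Lambda> (transport_field p u s) (\<lambda>y. p (0, y)) (\<lambda>y. - p (s, y)) (\<lambda>y. (0, y)) (\<lambda>y. (s, y))"

lemma weak_form_eq:
  assumes u: "u \<in> L1_vec T p" and s: "s \<in> {0..T}"
  shows "weak_form u s \<phi> G = (LINT z|lborel. transport_field p u s z \<bullet> G z) +
    (LINT y|lborel. p (0, y) * \<phi> (0, y)) - (LINT y|lborel. p (s, y) * \<phi> (s, y))"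
  unfolding weak_form_def first_order_functional.\<Lambda>_def[OF is_first_order_functional[OF u s]] by simp

text \<open>The residual and \<open>class_U0\<close> use iterated integrals, the functional a
  space-time integral; Fubini joins them. The field vanishes off the slab, so \<phi> need be
  differentiable only there.\<close>

lemma iterated_transport:
  assumes u: "u \<in> L1_vec T p" and s: "s \<in> {0..T}"
    and I: "I = UNIV \<or> I = {0..T}"
    and d: "\<And>z. z \<in> slab T \<Longrightarrow> (\<phi> has_derivative (\<lambda>h. G z \<bullet> h)) (at z within I \<times> UNIV)"
    and G: "G \<in> borel_measurable borel" and B: "\<And>z. norm (G z) \<le> B"
  shows "(LINT r:{0..s}|lborel. LINT y|lborel. p (r, y) * transport_op I u \<phi> (r, y)) =
    (LINT z|lborel. transport_field p u s z \<bullet> G z)"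
proof -
  have "integrable lborel (\<lambda>z. transport_field p u s z \<bullet> G z)"
    using integrable_inner_bounded(1)[OF transport_field_integrable[OF u s] _ B] G by simp
  then have "integrable (lborel \<Otimes>\<^sub>M lborel) (\<lambda>z. transport_field p u s z \<bullet> G z)"
    by (simp add: lborel_prod)
  from lborel_pair.integral_fst'[OF this]
  have "(LINT z|lborel. transport_field p u s z \<bullet> G z) =
      (LINT r|lborel. LINT y|lborel. transport_field p u s (r, y) \<bullet> G (r, y))"
    by (simp add: lborel_prod)
  also have "\<dots> = (LINT r:{0..s}|lborel. LINT y|lborel. p (r, y) * transport_op I u \<phi> (r, y))"
    unfolding set_lebesgue_integral_def
  proof (rule Bochner_Integration.integral_cong)
    fix r :: real
    show "(LINT y|lborel. transport_field p u s (r, y) \<bullet> G (r, y)) =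
      indicator {0..s} r *\<^sub>R (LINT y|lborel. p (r, y) * transport_op I u \<phi> (r, y))"
    proof (cases "r \<in> {0..s}")
      case True
      then have r: "r \<in> {0..T}" using s by auto
      then have "transport_op I u \<phi> (r, y) = (1, u (r, y)) \<bullet> G (r, y)" for y
        using I d[of "(r, y)"] by (intro transport_op_eq(3) trivial_limit_time[OF T_pos r I]) auto
      moreover have "transport_field p u s (r, y) = p (r, y) *\<^sub>R (1, u (r, y))" for y
        using True by (simp add: transport_field_def)
      ultimately show ?thesis
        using True by (simp del: scaleR_Pair)
    next
      case False
      then have "transport_field p u s (r, y) = 0" for y
        by (simp add: transport_field_def zero_prod_def)
      then show ?thesis
        using False by simp
    qed
  qed simp
  finally show ?thesis by simp
qed

lemma residual_eq_weak_form:
  assumes u: "u \<in> L1_vec T p" and s: "s \<in> {0..T}"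
    and K: "C1b K K'" and even: "\<And>\<xi>. K (- \<xi>) = K \<xi>"
  shows "residual K p u s \<xi> = weak_form u s (\<lambda>x. K (x - \<xi>)) (\<lambda>x. K' (x - \<xi>))"
proof -
  have eq: "(\<lambda>\<eta>. K (\<xi> - \<eta>)) = (\<lambda>x. K (x - \<xi>))"
    using even[of "\<xi> - x" for x] by (simp add: fun_eq_iff)
  obtain B where B: "\<And>x. norm (K' x) \<le> B"
    using C1b_bound[OF K] by metis
  note C = C1b_translate[OF K, of \<xi>]
  have "(LINT r:{0..s}|lborel. LINT y|lborel. p (r, y) * transport_op UNIV u (\<lambda>x. K (x - \<xi>)) (r, y)) =
      (LINT z|lborel. transport_field p u s z \<bullet> K' (z - \<xi>))"
    by (rule iterated_transport[OF u s, where B=B])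
      (use C1b_deriv[OF C] C1b_measurable(2)[OF C] B in auto)
  then show ?thesis
    unfolding residual_def weak_form_eq[OF u s] eq by (simp add: fun_cong[OF eq])
qed

text \<open>\<open>G\<close> must be measurable and bounded everywhere but a gradient only on the
  slab, so the zero extension of a gradient qualifies.\<close>

lemma continuity_equation_iff:
  assumes u: "u \<in> L1_vec T p" and s: "s \<in> {0..T}"
    and d: "\<And>z. z \<in> slab T \<Longrightarrow> (\<phi> has_derivative (\<lambda>h. G z \<bullet> h)) (at z within slab T)"
    and G: "G \<in> borel_measurable borel" and B: "\<And>z. norm (G z) \<le> B"
  shows "(LINT x|lborel. \<phi> (s, x) * p (s, x)) - (LINT x|lborel. \<phi> (0, x) * p (0, x)) =
     (LINT r:{0..s}|lborel. LINT x|lborel. transport_op {0..T} u \<phi> (r, x) * p (r, x)) \<longleftrightarrow>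
     weak_form u s \<phi> G = 0"
  using iterated_transport[OF u s _ d G B] unfolding weak_form_eq[OF u s]
  by (auto simp: mult.commute)

end

subsection \<open>Extension of test functions beyond the slab\<close>

text \<open>A smooth map of the real line into \<open>[0,T]\<close> which tends to the identity of \<open>[0,T]\<close> as
  \<open>l\<close> increases to \<open>1\<close>. Composing with it extends a function from the slab to the whole space
  without losing differentiability.\<close>

definition angle :: "real \<Rightarrow> real \<Rightarrow> real" where
  "angle T t = pi * (t / T) - pi / 2"

text \<open>For \<open>l = 1\<close> this is the triangle wave reflecting between 0 and
  \<open>T\<close>. A factor \<open>l < 1\<close> rounds its corners, as the argument of
  \<open>arcsin\<close> then stays away from 1 and -1.\<close>

definition smooth_clamp :: "real \<Rightarrow> real \<Rightarrow> real \<Rightarrow> real" where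
  "smooth_clamp T l t = T / 2 + (T / pi) * arcsin (l * sin (angle T t))"

definition smooth_clamp_deriv :: "real \<Rightarrow> real \<Rightarrow> real \<Rightarrow> real" where
  "smooth_clamp_deriv T l t = l * cos (angle T t) / sqrt (1 - (l * sin (angle T t))\<^sup>2)"

lemma angle_bounds:
  assumes "T > 0"
  shows "0 \<le> t \<Longrightarrow> - (pi / 2) \<le> angle T t" "t \<le> T \<Longrightarrow> angle T t \<le> pi / 2"
    "0 < t \<Longrightarrow> - (pi / 2) < angle T t" "t < T \<Longrightarrow> angle T t < pi / 2"
proof -
  have "0 \<le> t \<Longrightarrow> 0 \<le> pi * (t / T)" "0 < t \<Longrightarrow> 0 < pi * (t / T)"
    "t \<le> T \<Longrightarrow> pi * (t / T) \<le> pi * 1" "t < T \<Longrightarrow> pi * (t / T) < pi * 1"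
    using assms mult_left_mono[of "t / T" 1 pi] mult_strict_left_mono[of "t / T" 1 pi] by simp_all
  then show "0 \<le> t \<Longrightarrow> - (pi / 2) \<le> angle T t" "t \<le> T \<Longrightarrow> angle T t \<le> pi / 2"
    "0 < t \<Longrightarrow> - (pi / 2) < angle T t" "t < T \<Longrightarrow> angle T t < pi / 2"
    unfolding angle_def by linarith+
qed

lemma abs_mult_sin_less: "0 \<le> l \<Longrightarrow> l < 1 \<Longrightarrow> \<bar>l * sin (x::real)\<bar> < 1"
  using mult_left_le[of "\<bar>sin x\<bar>" l] by (simp add: abs_mult)

lemma smooth_clamp_has_derivative:
  assumes "T > 0" "0 \<le> l" "l < 1"
  shows "(smooth_clamp T l has_real_derivative smooth_clamp_deriv T l t) (at t)"
proof -
  let ?y = "l * sin (angle T t)"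
  have y: "-1 < ?y" "?y < 1"
    using abs_mult_sin_less[OF assms(2,3), of "angle T t"] by linarith+
  have a: "(angle T has_real_derivative pi / T) (at t)"
    unfolding angle_def[abs_def] using assms by (auto intro!: derivative_eq_intros)
  have "((\<lambda>t. l * sin (angle T t)) has_real_derivative l * (cos (angle T t) * (pi / T))) (at t)"
    by (intro DERIV_cmult DERIV_chain2[OF DERIV_sin a])
  from DERIV_chain2[OF DERIV_arcsin[OF y] this]
  have "((\<lambda>t. arcsin (l * sin (angle T t))) has_real_derivative
      inverse (sqrt (1 - ?y\<^sup>2)) * (l * (cos (angle T t) * (pi / T)))) (at t)" .
  from DERIV_add[OF DERIV_const[of "T / 2"] DERIV_cmult[OF this, of "T / pi"]]
  have "(smooth_clamp T l has_real_derivative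
      0 + (T / pi) * (inverse (sqrt (1 - ?y\<^sup>2)) * (l * (cos (angle T t) * (pi / T))))) (at t)"
    unfolding smooth_clamp_def[abs_def] .
  moreover have "0 + (T / pi) * (inverse (sqrt (1 - ?y\<^sup>2)) * (l * (cos (angle T t) * (pi / T)))) = smooth_clamp_deriv T l t"
  proof -
    have "0 + (T / pi) * (inverse (sqrt (1 - ?y\<^sup>2)) * (l * (cos (angle T t) * (pi / T)))) =
        ((T / pi) * (pi / T)) * (l * cos (angle T t) * inverse (sqrt (1 - ?y\<^sup>2)))"
      by (simp only: mult_ac add_0)
    also have "(T / pi) * (pi / T) = 1"
      using assms by simp
    finally show ?thesis
      by (simp add: smooth_clamp_deriv_def divide_inverse)
  qed
  ultimately show ?thesis by simp
qed

lemma continuous_smooth_clamp_deriv: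
  assumes "T > 0" "0 \<le> l" "l < 1"
  shows "continuous_on UNIV (smooth_clamp_deriv T l)"
proof -
  have "(l * sin x)\<^sup>2 \<noteq> 1" for x :: real
    using abs_mult_sin_less[OF assms(2,3), of x] by (auto simp: power2_eq_1_iff)
  then show ?thesis
    unfolding smooth_clamp_deriv_def[abs_def] angle_def using assms(1) by (intro continuous_intros) auto
qed

lemma smooth_clamp_range:
  assumes "T > 0" "0 \<le> l" "l < 1"
  shows "smooth_clamp T l t \<in> {0..T}"
proof -
  let ?y = "l * sin (angle T t)"
  have y: "-1 \<le> ?y" "?y \<le> 1"
    using abs_mult_sin_less[OF assms(2,3), of "angle T t"] by linarith+
  have "(T / pi) * - (pi / 2) \<le> (T / pi) * arcsin ?y" "(T / pi) * arcsin ?y \<le> (T / pi) * (pi / 2)"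
    using assms arcsin_lbound[OF y] arcsin_ubound[OF y] by (intro mult_left_mono; simp)+
  then have "- (T / 2) \<le> (T / pi) * arcsin ?y" "(T / pi) * arcsin ?y \<le> T / 2"
    by simp_all
  then show ?thesis
    unfolding smooth_clamp_def atLeastAtMost_iff by linarith
qed

text \<open>Since \<open>l\<^sup>2 \<le> 1\<close>, the squared numerator is at most the expression
  under the root. The bound is uniform in \<open>l\<close>, so clamping does not enlarge
  gradients.\<close>

lemma smooth_clamp_deriv_bound:
  assumes "0 \<le> l" "l < 1"
  shows "\<bar>smooth_clamp_deriv T l t\<bar> \<le> 1"
proof -
  let ?x = "angle T t"
  have l: "l\<^sup>2 \<le> 1"
    using assms by (simp add: power_le_one)
  have "(l * cos ?x)\<^sup>2 = l\<^sup>2 * (1 - (sin ?x)\<^sup>2)"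
    by (simp add: power_mult_distrib cos_squared_eq)
  also have "\<dots> \<le> 1 - (l * sin ?x)\<^sup>2"
    using l by (simp add: power_mult_distrib algebra_simps)
  finally have "\<bar>l * cos ?x\<bar> \<le> sqrt (1 - (l * sin ?x)\<^sup>2)"
    by (rule real_le_rsqrt[of "\<bar>l * cos ?x\<bar>", unfolded power2_abs])
  then show ?thesis
    using abs_ge_zero[of "l * cos ?x"] by (auto simp: smooth_clamp_deriv_def abs_divide divide_le_eq_1)
qed

lemma smooth_clamp_tendsto:
  assumes T: "T > 0" and l: "l \<longlonglongrightarrow> 1" "\<And>n. 0 \<le> l n" "\<And>n. l n < 1" and t: "t \<in> {0..T}"
  shows "(\<lambda>n. smooth_clamp T (l n) t) \<longlonglongrightarrow> t"
proof -
  let ?x = "angle T t"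
  have "(\<lambda>n. arcsin (l n * sin ?x)) \<longlonglongrightarrow> arcsin (1 * sin ?x)"
  proof (rule continuous_on_tendsto_compose[OF continuous_on_arcsin'])
    show "(\<lambda>n. l n * sin ?x) \<longlonglongrightarrow> 1 * sin ?x"
      using l(1) by (intro tendsto_intros)
    have "l n * sin ?x \<in> {-1..1}" for n
      using abs_mult_sin_less[OF l(2,3), of n ?x] by auto
    then show "\<forall>\<^sub>F n in sequentially. l n * sin ?x \<in> {-1..1}"
      by (intro always_eventually) blast
  qed auto
  also have "arcsin (1 * sin ?x) = ?x"
    using angle_bounds[OF T, of t] t by (simp add: arcsin_sin)
  finally have "(\<lambda>n. T / 2 + (T / pi) * arcsin (l n * sin ?x)) \<longlonglongrightarrow> T / 2 + (T / pi) * ?x"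
    by (intro tendsto_intros)
  also have "T / 2 + (T / pi) * ?x = t"
    using T by (simp add: angle_def field_simps)
  finally show ?thesis
    by (simp add: smooth_clamp_def)
qed

text \<open>The endpoints are excluded because the cosine vanishes there and the slope is 0 for
  every \<open>l\<close>.\<close>

lemma smooth_clamp_deriv_tendsto:
  assumes T: "T > 0" and l: "l \<longlonglongrightarrow> 1" and t: "0 < t" "t < T"
  shows "(\<lambda>n. smooth_clamp_deriv T (l n) t) \<longlonglongrightarrow> 1"
proof -
  let ?x = "angle T t"
  have c: "cos ?x > 0"
    using angle_bounds[OF T, of t] t by (intro cos_gt_zero_pi) auto
  have s: "sqrt (1 - (1 * sin ?x)\<^sup>2) = cos ?x"
    using c by (simp flip: cos_squared_eq)
  have "(\<lambda>n. l n * cos ?x / sqrt (1 - (l n * sin ?x)\<^sup>2)) \<longlonglongrightarrow> 1 * cos ?x / sqrt (1 - (1 * sin ?x)\<^sup>2)"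
    using l c s by (intro tendsto_intros) auto
  then show ?thesis
    unfolding smooth_clamp_deriv_def s using c by simp
qed

text \<open>The clamp maps into the slab, so a derivative relative to the slab is enough for the
  chain rule, and the composition is differentiable on both sides of times 0 and
  \<open>T\<close>.\<close>

lemma C1b_clamp_compose:
  fixes \<phi> :: "real \<times> (real^'d) \<Rightarrow> real"
  assumes T: "T > 0" and l: "0 \<le> l" "l < 1"
    and d: "\<And>z. z \<in> slab T \<Longrightarrow> (\<phi> has_derivative (\<lambda>h. G z \<bullet> h)) (at z within slab T)"
    and cG: "continuous_on (slab T) G"
    and B: "\<And>z. z \<in> slab T \<Longrightarrow> \<bar>\<phi> z\<bar> \<le> B" "\<And>z. z \<in> slab T \<Longrightarrow> norm (G z) \<le> B"
  shows "C1b (\<lambda>z. \<phi> (smooth_clamp T l (fst z), snd z))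
    (\<lambda>z. (smooth_clamp_deriv T l (fst z) * fst (G (smooth_clamp T l (fst z), snd z)), snd (G (smooth_clamp T l (fst z), snd z))))"
    and "norm (smooth_clamp_deriv T l (fst z) * fst (G (smooth_clamp T l (fst z), snd z)), snd (G (smooth_clamp T l (fst z), snd z))) \<le> B"
proof -
  let ?m = "\<lambda>z :: real \<times> (real^'d). (smooth_clamp T l (fst z), snd z)"
  have m: "?m z \<in> slab T" for z
    using smooth_clamp_range[OF T l] by simp
  show bound: "norm (smooth_clamp_deriv T l (fst z) * fst (G (?m z)), snd (G (?m z))) \<le> B" for z
  proof -
    have "\<bar>smooth_clamp_deriv T l (fst z) * fst (G (?m z))\<bar> \<le> 1 * \<bar>fst (G (?m z))\<bar>"
      unfolding abs_mult by (intro mult_right_mono smooth_clamp_deriv_bound l) simp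
    then have "norm (smooth_clamp_deriv T l (fst z) * fst (G (?m z)), snd (G (?m z))) \<le> norm (fst (G (?m z)), snd (G (?m z)))"
      unfolding norm_Pair by (intro real_sqrt_le_mono add_mono power_mono) auto
    then show ?thesis
      using B(2)[OF m[of z]] by simp
  qed
  have dm: "(?m has_derivative (\<lambda>h. (smooth_clamp_deriv T l (fst z) * fst h, snd h))) (at z)" for z
  proof -
    have "((\<lambda>z :: real \<times> (real^'d). smooth_clamp T l (fst z)) has_derivative (\<lambda>h. smooth_clamp_deriv T l (fst z) * fst h)) (at z)"
      using has_derivative_compose[OF bounded_linear_imp_has_derivative[OF bounded_linear_fst]
          smooth_clamp_has_derivative[OF T l, THEN has_field_derivative_imp_has_derivative]] .
    then show ?thesis
      by (intro has_derivative_Pair has_derivative_snd has_derivative_ident)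
  qed
  have cm: "continuous_on UNIV ?m"
    using has_derivative_continuous[OF dm] by (intro continuous_at_imp_continuous_on) blast
  have cGm: "continuous_on UNIV (\<lambda>z. G (?m z))"
    by (rule continuous_on_compose2[OF cG cm]) (use m in auto)
  show "C1b (\<lambda>z. \<phi> (?m z)) (\<lambda>z. (smooth_clamp_deriv T l (fst z) * fst (G (?m z)), snd (G (?m z))))"
  proof (rule C1bI)
    fix z
    have "(\<phi> has_derivative (\<lambda>h. G (?m z) \<bullet> h)) (at (?m z) within range ?m)"
      by (rule has_derivative_subset[OF d[OF m]]) (use m in auto)
    from has_derivative_in_compose[OF dm this]
    show "((\<lambda>z. \<phi> (?m z)) has_derivative (\<lambda>h. (smooth_clamp_deriv T l (fst z) * fst (G (?m z)), snd (G (?m z))) \<bullet> h)) (at z)"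
      by (simp add: inner_prod_def mult_ac)
    show "\<bar>\<phi> (?m z)\<bar> \<le> B"
      by (rule B(1)[OF m])
    show "norm (smooth_clamp_deriv T l (fst z) * fst (G (?m z)), snd (G (?m z))) \<le> B"
      by (rule bound)
  next
    show "continuous_on UNIV (\<lambda>z. (smooth_clamp_deriv T l (fst z) * fst (G (?m z)), snd (G (?m z))))"
      using continuous_on_compose2[OF continuous_smooth_clamp_deriv[OF T l] continuous_on_fst[OF continuous_on_id], of UNIV]
      by (intro continuous_intros cGm) auto
  qed
qed

section \<open>From test functions on the whole space to those on the slab\<close>

lemma AE_time_neq: "AE z in (lborel :: (real \<times> (real^'d)) measure). fst z \<noteq> c"
proof -
  have "negligible {z :: real \<times> (real^'d). z \<bullet> (1, 0) = c}"
    by (rule negligible_standard_hyperplane) (simp add: Basis_prod_def)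
  then have "AE z in lebesgue. (z :: real \<times> (real^'d)) \<notin> {z. z \<bullet> (1, 0) = c}"
    unfolding negligible_iff_null_sets by (rule AE_not_in)
  then have "AE z in lebesgue. fst (z :: real \<times> (real^'d)) \<noteq> c"
    by (simp add: inner_prod_def)
  then show ?thesis
    by (simp add: AE_completion_iff)
qed

context density_curve
begin

lemma weak_form_zero_extension:
  assumes u: "u \<in> L1_vec T p" and s: "s \<in> {0..T}"
    and zero: "\<And>\<phi> G. C1b \<phi> G \<Longrightarrow> integrable lborel \<phi> \<Longrightarrow> weak_form u s \<phi> G = 0"
    and d: "\<And>z. z \<in> slab T \<Longrightarrow> (\<phi> has_derivative (\<lambda>h. G z \<bullet> h)) (at z within slab T)"
    and cG: "continuous_on (slab T) G"
    and B: "B \<ge> 0" "\<And>z. z \<in> slab T \<Longrightarrow> \<bar>\<phi> z\<bar> \<le> B" "\<And>z. z \<in> slab T \<Longrightarrow> norm (G z) \<le> B"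
  shows "weak_form u s (\<lambda>z. indicator (slab T) z *\<^sub>R \<phi> z) (\<lambda>z. indicator (slab T) z *\<^sub>R G z) = 0"
proof -
  interpret F: first_order_functional "transport_field p u s" "\<lambda>y. p (0, y)" "\<lambda>y. - p (s, y)" "\<lambda>y. (0, y)" "\<lambda>y. (s, y)"
    by (rule is_first_order_functional[OF u s])
  have wf: "weak_form u s = F.\<Lambda>"
    by (simp add: weak_form_def)
  \<comment> \<open>One null sequence drives both limits: the Gaussian cutoff, which makes the
    approximants integrable, and the clamp with parameter \<open>1 - a n\<close>.\<close>
  define a where "a n = inverse (real (Suc n))" for n
  have a: "0 < a n" "a n \<le> 1" for n
    by (simp_all add: a_def field_simps)
  have alim: "a \<longlonglongrightarrow> 0"
    unfolding a_def by (rule LIMSEQ_inverse_real_of_nat)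
  have l: "(\<lambda>n. 1 - a n) \<longlonglongrightarrow> 1" "0 \<le> 1 - a n" "1 - a n < 1" for n
    using tendsto_diff[OF tendsto_const alim, of 1] a[of n] by auto
  define m :: "nat \<Rightarrow> real \<times> (real^'d) \<Rightarrow> real \<times> (real^'d)" where "m n z = (smooth_clamp T (1 - a n) (fst z), snd z)" for n z
  define f where "f n z = \<phi> (m n z)" for n z
  define F where "F n z = (smooth_clamp_deriv T (1 - a n) (fst z) * fst (G (m n z)), snd (G (m n z)))" for n z
  have f: "C1b (f n) (F n)" and Fb: "norm (F n z) \<le> B" for n z
    unfolding f_def F_def m_def using C1b_clamp_compose[OF T_pos l(2,3) d cG B(2,3)] by auto
  have m: "m n z \<in> slab T" for n z
    unfolding m_def using smooth_clamp_range[OF T_pos l(2,3)] by simp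
  have fb: "\<bar>f n z\<bar> \<le> B" for n z
    unfolding f_def by (rule B(2)[OF m])
  define g :: "nat \<Rightarrow> real \<times> (real^'d) \<Rightarrow> real \<times> (real^'d)" where "g n x = - ((2 * a n * gauss (a n) x) *\<^sub>R x)" for n x
  have g: "C1b (gauss (a n)) (g n)" and gb: "norm (g n x) \<le> 4" for n x
  proof -
    show "C1b (gauss (a n)) (g n)"
      unfolding g_def using a(1)[of n] by (intro C1b_gauss) simp
    have "norm (g n x) \<le> 2 * (1 + a n)"
      unfolding g_def using a(1)[of n] by (intro gauss_grad_bound) simp
    also have "\<dots> \<le> 4"
      using a(2)[of n] by simp
    finally show "norm (g n x) \<le> 4" .
  qed
  let ?h = "\<lambda>n z. f n z * gauss (a n) z"
  let ?H = "\<lambda>n z. f n z *\<^sub>R g n z + gauss (a n) z *\<^sub>R F n z"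
  have h: "C1b (?h n) (?H n)" for n
    by (rule C1b_mult[OF f g])
  have hi: "integrable lborel (?h n)" for n
    using C1b_measurable[OF f] by (intro integrable_bounded_mult(1)[OF integrable_gauss[OF a(1)] _ fb])
  have mlim: "(\<lambda>n. m n z) \<longlonglongrightarrow> z" if "z \<in> slab T" for z
    using that tendsto_Pair[OF smooth_clamp_tendsto[OF T_pos l] tendsto_const, of "fst z" "snd z"] by (auto simp: m_def)
  have elim: "(\<lambda>n. gauss (a n) z) \<longlonglongrightarrow> 1" and glim: "(\<lambda>n. g n z) \<longlonglongrightarrow> 0" for z
  proof -
    have "(\<lambda>n. gauss (a n) z) \<longlonglongrightarrow> gauss 0 z" "(\<lambda>n. - ((2 * a n * gauss (a n) z) *\<^sub>R z)) \<longlonglongrightarrow> - ((2 * 0 * gauss 0 z) *\<^sub>R z)"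
      using alim by (intro tendsto_intros; simp)+
    then show "(\<lambda>n. gauss (a n) z) \<longlonglongrightarrow> 1" "(\<lambda>n. g n z) \<longlonglongrightarrow> 0"
      by (simp_all add: g_def)
  qed
  have c\<phi>: "continuous_on (slab T) \<phi>"
    using has_derivative_continuous[OF d] by (simp add: continuous_on_eq_continuous_within)
  have flim: "(\<lambda>n. f n z) \<longlonglongrightarrow> \<phi> z" if "z \<in> slab T" for z
    unfolding f_def using m by (intro continuous_on_tendsto_compose[OF c\<phi> mlim[OF that] that]) auto
  have Glim: "(\<lambda>n. G (m n z)) \<longlonglongrightarrow> G z" if "z \<in> slab T" for z
    using m by (intro continuous_on_tendsto_compose[OF cG mlim[OF that] that]) auto
  have hlim: "(\<lambda>n. ?h n z) \<longlonglongrightarrow> indicator (slab T) z *\<^sub>R \<phi> z" if "z \<in> slab T" for z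
    using tendsto_mult[OF flim[OF that] elim[of z]] that by simp
  have "(\<lambda>n. F.\<Lambda> (?h n) (?H n)) \<longlonglongrightarrow> F.\<Lambda> (\<lambda>z. indicator (slab T) z *\<^sub>R \<phi> z) (\<lambda>z. indicator (slab T) z *\<^sub>R G z)"
  proof (rule F.\<Lambda>_tendsto[where B="B * 4 + B"])
    show "(\<lambda>z. indicator (slab T) z *\<^sub>R \<phi> z) \<in> borel_measurable borel" "(\<lambda>z. indicator (slab T) z *\<^sub>R G z) \<in> borel_measurable borel"
      using slab_sets c\<phi> cG by (intro borel_measurable_continuous_on_indicator; simp)+
    show "?h n \<in> borel_measurable borel" "?H n \<in> borel_measurable borel" for n
      by (rule C1b_measurable[OF h])+
    have e: "0 \<le> gauss (a n) z" "gauss (a n) z \<le> 1" for n and z :: "real \<times> (real^'d)"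
      using a(1)[of n] by (simp_all add: less_imp_le)
    show "\<bar>?h n z\<bar> \<le> B * 4 + B" for n z
    proof -
      have "\<bar>f n z\<bar> * gauss (a n) z \<le> B * 1"
        using fb e B(1) by (intro mult_mono) auto
      then show ?thesis using B(1) by (simp add: abs_mult)
    qed
    show "norm (?H n z) \<le> B * 4 + B" for n z
    proof -
      have "norm (?H n z) \<le> \<bar>f n z\<bar> * norm (g n z) + gauss (a n) z * norm (F n z)"
        by (rule order_trans[OF norm_triangle_ineq]) simp
      also have "\<dots> \<le> B * 4 + 1 * B"
        using fb gb Fb e B(1) by (intro add_mono mult_mono) auto
      finally show ?thesis by simp
    qed
    show "(\<lambda>n. ?h n (0, y)) \<longlonglongrightarrow> indicator (slab T) (0, y) *\<^sub>R \<phi> (0, y)" for y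
      using T_pos by (intro hlim) simp
    show "(\<lambda>n. ?h n (s, y)) \<longlonglongrightarrow> indicator (slab T) (s, y) *\<^sub>R \<phi> (s, y)" for y
      using s by (intro hlim) simp
    \<comment> \<open>At times 0 and \<open>T\<close> the clamp has slope 0 and the gradients need
      not converge to \<open>G\<close>; these times form a null set.\<close>
    show "AE z in lborel. transport_field p u s z \<noteq> 0 \<longrightarrow> (\<lambda>n. ?H n z) \<longlonglongrightarrow> indicator (slab T) z *\<^sub>R G z"
      using AE_time_neq[of 0] AE_time_neq[of T]
    proof (eventually_elim, intro impI)
      fix z :: "real \<times> (real^'d)"
      assume t: "fst z \<noteq> 0" "fst z \<noteq> T" and "transport_field p u s z \<noteq> 0"
      moreover have "z \<in> {0..s} \<times> UNIV"
        by (rule ccontr) (use \<open>transport_field p u s z \<noteq> 0\<close> in \<open>simp add: transport_field_def zero_prod_def[symmetric]\<close>)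
      ultimately have z: "z \<in> slab T" "0 < fst z" "fst z < T"
        using t s by (auto simp: mem_Times_iff)
      have Flim: "(\<lambda>n. F n z) \<longlonglongrightarrow> (1 * fst (G z), snd (G z))"
        unfolding F_def by (intro tendsto_intros smooth_clamp_deriv_tendsto[OF T_pos l(1) z(2,3)] Glim[OF z(1)])
      have "(\<lambda>n. ?H n z) \<longlonglongrightarrow> \<phi> z *\<^sub>R 0 + 1 *\<^sub>R (1 * fst (G z), snd (G z))"
        by (intro tendsto_intros flim[OF z(1)] glim elim Flim)
      then show "(\<lambda>n. ?H n z) \<longlonglongrightarrow> indicator (slab T) z *\<^sub>R G z"
        using z(1) by simp
    qed
  qed
  moreover have "F.\<Lambda> (?h n) (?H n) = 0" for n
    using zero[OF h hi] by (simp add: wf)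
  ultimately show ?thesis
    by (simp add: wf LIMSEQ_const_iff)
qed

theorem class_U0_iff_residual_zero:
  assumes u: "u \<in> L1_vec T p"
    and K: "C1b K K'" "integrable lborel K" and even: "\<And>\<xi>. K (- \<xi>) = K \<xi>"
    and dense: "closure {z. cos_transform K z \<noteq> 0} = UNIV"
    and pt: "weak_partial_t_in_L1 (open_slab T) p"
  shows "u \<in> class_U0 T p \<longleftrightarrow> (\<forall>s\<in>{0..T}. residual K p u s = (\<lambda>_. 0))"
proof
  assume U0: "u \<in> class_U0 T p"
  show "\<forall>s\<in>{0..T}. residual K p u s = (\<lambda>_. 0)"
  proof (intro ballI ext)
    fix s \<xi> assume s: "s \<in> {0..T}"
    note C = C1b_translate[OF K(1), of \<xi>]
    obtain B where "\<And>x. norm (K' (x - \<xi>)) \<le> B"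
      using C1b_bound[OF C] by metis
    then have "weak_form u s (\<lambda>x. K (x - \<xi>)) (\<lambda>x. K' (x - \<xi>)) = 0"
      using U0 C1_bounded_of_C1b[OF C, of T] s
      by (subst continuity_equation_iff[OF u s C1b_has_derivative_within[OF C] C1b_measurable(2)[OF C], symmetric])
        (auto simp: class_U0_def)
    then show "residual K p u s \<xi> = 0"
      by (simp add: residual_eq_weak_form[OF u s K(1) even])
  qed
next
  assume res: "\<forall>s\<in>{0..T}. residual K p u s = (\<lambda>_. 0)"
  have zero: "weak_form u s \<phi> G = 0" if s: "s \<in> {0..T}" and "C1b \<phi> G" "integrable lborel \<phi>" for s \<phi> G
  proof -
    have "weak_form u s (\<lambda>x. K (x - \<xi>)) (\<lambda>x. K' (x - \<xi>)) = 0" for \<xi>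
      using res s by (simp flip: residual_eq_weak_form[OF u s K(1) even])
    then show ?thesis
      using first_order_functional.\<Lambda>_zero[OF is_first_order_functional[OF u s] K even _ dense that(2,3)]
      unfolding weak_form_def by blast
  qed
  have eqn: "(LINT x|lborel. \<phi> (s, x) * p (s, x)) - (LINT x|lborel. \<phi> (0, x) * p (0, x)) =
     (LINT r:{0..s}|lborel. LINT x|lborel. transport_op {0..T} u \<phi> (r, x) * p (r, x))"
    if \<phi>: "C1_bounded T \<phi>" and s: "s \<in> {0..T}" for \<phi> s
  proof -
    obtain G B where G: "\<And>z. z \<in> slab T \<Longrightarrow> (\<phi> has_derivative (\<lambda>h. G z \<bullet> h)) (at z within slab T)"
      "continuous_on (slab T) G" "B \<ge> 0" "\<And>z. z \<in> slab T \<Longrightarrow> \<bar>\<phi> z\<bar> \<le> B" "\<And>z. z \<in> slab T \<Longrightarrow> norm (G z) \<le> B"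
      using C1_bounded_gradient[OF \<phi>] by metis
    \<comment> \<open>\<phi> is prescribed only on the slab, so its gradient is set to 0 elsewhere
      to be globally measurable and bounded.\<close>
    let ?G = "\<lambda>z. indicator (slab T) z *\<^sub>R G z"
    have "weak_form u s (\<lambda>z. indicator (slab T) z *\<^sub>R \<phi> z) ?G = 0"
      by (rule weak_form_zero_extension[OF u s zero[OF s] G])
    then have "weak_form u s \<phi> ?G = 0"
      unfolding weak_form_eq[OF u s] using s T_pos by simp
    moreover have "?G \<in> borel_measurable borel"
      using slab_sets G(2) by (rule borel_measurable_continuous_on_indicator)
    moreover have "norm (?G z) \<le> B" for z
      using G(3) G(5)[of z] by (cases "z \<in> slab T") auto
    ultimately show ?thesis
      using G(1) by (subst continuity_equation_iff[OF u s]) auto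
  qed
  have "weak_div_x_in_L1 (open_slab T) (\<lambda>z. p z *\<^sub>R u z)"
  proof -
    obtain g where g: "set_integrable lborel (open_slab T) g"
      and gp: "\<And>\<phi>. test_function (open_slab T) \<phi> \<Longrightarrow>
        (LINT z:open_slab T|lborel. p z * partial_t UNIV \<phi> z) = - (LINT z:open_slab T|lborel. g z * \<phi> z)"
      using pt unfolding weak_partial_t_in_L1_def by blast
    \<comment> \<open>The candidate for the weak divergence is \<open>- g\<close>, with
      \<open>g\<close> the weak time derivative of \<open>p\<close>.\<close>
    have "(LINT z:open_slab T|lborel. (p z *\<^sub>R u z) \<bullet> grad_x \<phi> z) = - (LINT z:open_slab T|lborel. (- g z) * \<phi> z)"
      if \<phi>: "test_function (open_slab T) \<phi>" for \<phi>
    proof -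
      obtain G where G: "C1b \<phi> G" and out: "\<And>z. z \<notin> open_slab T \<Longrightarrow> \<phi> z = 0" "\<And>z. z \<notin> open_slab T \<Longrightarrow> G z = 0"
        using test_function_C1b[OF \<phi>] by metis
      obtain B where B: "\<And>x. norm (G x) \<le> B"
        using C1b_bound[OF G] by metis
      have T: "T \<in> {0..T}" using T_pos by simp
      have Gm[measurable]: "G \<in> borel_measurable borel"
        by (rule C1b_measurable[OF G])
      \<comment> \<open>With horizon \<open>T\<close> the field fills the slab, and both slice terms
        drop out because the support of \<phi> avoids times 0 and \<open>T\<close>.\<close>
      have "weak_form u T \<phi> G = 0"
        using eqn[OF C1_bounded_of_C1b[OF G] T]
        by (subst (asm) continuity_equation_iff[OF u T C1b_has_derivative_within[OF G] Gm B])
      then have W0: "(LINT z|lborel. transport_field p u T z \<bullet> G z) = 0"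
        unfolding weak_form_eq[OF u T] by (simp add: out)
      have d: "partial_t UNIV \<phi> z = fst (G z)" "grad_x \<phi> z = snd (G z)" for z
        using transport_op_eq(1,2)[of \<phi> "G z" "fst z" "snd z" UNIV] C1b_deriv[OF G, of z] by auto
      have i1: "integrable lborel (\<lambda>z. (indicator (slab T) z * p z) \<bullet> fst (G z))"
      proof (rule integrable_inner_bounded(1)[OF p_slab_integrable])
        show "norm (fst (G z)) \<le> B" for z
          using norm_fst_le[of "fst (G z)" "snd (G z)"] B[of z] by simp
        show "(\<lambda>z. fst (G z)) \<in> borel_measurable lborel"
          using borel_measurable_continuous_onI[OF continuous_on_fst[OF C1b_grad_continuous[OF G]]] by simp
      qed
      have i2: "integrable lborel (\<lambda>z. (indicator (slab T) z *\<^sub>R (p z *\<^sub>R u z)) \<bullet> snd (G z))"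
      proof (rule integrable_inner_bounded(1)[OF momentum_integrable[OF u]])
        show "norm (snd (G z)) \<le> B" for z
          using norm_snd_le[of "snd (G z)" "fst (G z)"] B[of z] by simp
        show "(\<lambda>z. snd (G z)) \<in> borel_measurable lborel"
          using borel_measurable_continuous_onI[OF continuous_on_snd[OF C1b_grad_continuous[OF G]]] by simp
      qed
      have split: "transport_field p u T z \<bullet> G z =
          (indicator (slab T) z * p z) \<bullet> fst (G z) + (indicator (slab T) z *\<^sub>R (p z *\<^sub>R u z)) \<bullet> snd (G z)" for z
        by (simp add: transport_field_def inner_prod_def algebra_simps)
      have "(LINT z|lborel. (indicator (slab T) z *\<^sub>R (p z *\<^sub>R u z)) \<bullet> snd (G z)) =
          - (LINT z|lborel. (indicator (slab T) z * p z) \<bullet> fst (G z))"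
        using W0 i1 i2 unfolding split by simp
      \<comment> \<open>The gradient vanishes outside the open slab, so closed and open slab may be
        exchanged.\<close>
      moreover have "(indicator (slab T) z *\<^sub>R (p z *\<^sub>R u z)) \<bullet> snd (G z) =
          indicator (open_slab T) z *\<^sub>R ((p z *\<^sub>R u z) \<bullet> grad_x \<phi> z)" for z
        using out(2)[of z] by (cases z) (auto simp: d indicator_def)
      moreover have "(indicator (slab T) z * p z) \<bullet> fst (G z) =
          indicator (open_slab T) z *\<^sub>R (p z * partial_t UNIV \<phi> z)" for z
        using out(2)[of z] by (cases z) (auto simp: d indicator_def)
      ultimately have "(LINT z:open_slab T|lborel. (p z *\<^sub>R u z) \<bullet> grad_x \<phi> z) =
          - (LINT z:open_slab T|lborel. p z * partial_t UNIV \<phi> z)"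
        unfolding set_lebesgue_integral_def by (simp only:)
      then show ?thesis
        using gp[OF \<phi>] by (simp add: set_lebesgue_integral_def)
    qed
    moreover have "set_integrable lborel (open_slab T) (\<lambda>z. - g z)"
      using g by (simp add: set_integrable_def)
    ultimately show ?thesis
      unfolding weak_div_x_in_L1_def by blast
  qed
  then show "u \<in> class_U0 T p"
    using u eqn by (auto simp: class_U0_def class_U_def)
qed

end

theorem theorem1:
  fixes T :: real
    and \<mu> :: "real \<Rightarrow> (real^'d) measure"
    and p :: "real \<times> (real^'d) \<Rightarrow> real"
    and K :: "real \<times> (real^'d) \<Rightarrow> real"
    and H :: "(real \<times> (real^'d) \<Rightarrow> real) set"
    and ip :: "(real \<times> (real^'d) \<Rightarrow> real) \<Rightarrow> (real \<times> (real^'d) \<Rightarrow> real) \<Rightarrow> real"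
  assumes T_pos: "T > 0"
    and mu_prob: "\<And>t. t \<in> {0..T} \<Longrightarrow> prob_space (\<mu> t)"
    and mu_density: "\<And>t. t \<in> {0..T} \<Longrightarrow> \<mu> t = density lborel (\<lambda>x. ennreal (p (t, x)))"
    and mu_continuous: "narrowly_continuous T \<mu>"
    and H_rkhs: "rkhs H ip (\<lambda>\<xi> \<eta>. K (\<xi> - \<eta>))"
    and A1_continuous: "continuous_on UNIV K"
    and A1_integrable: "integrable lborel K"
    and A1_positive_definite: "positive_definite K"
    and A1_universal: "closure {z. fourier K z \<noteq> 0} = UNIV"
    and A2: "integrable lborel (\<lambda>z. complex_of_real (1 + (norm z)\<^sup>2) * fourier K z)"
    and A3_continuous: "continuous_L1 T p"
    and A3_bounded: "L_infinity T p"
    and A3_nonneg: "\<And>t x. t \<in> {0..T} \<Longrightarrow> 0 \<le> p (t, x)"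
    and A3_mass: "\<And>t. t \<in> {0..T} \<Longrightarrow> (LINT x|lborel. p (t, x)) = 1"
    and A3_weak_derivative: "weak_partial_t_in_L1 (open_slab T) p"
  shows "(\<forall>u\<in>L1_vec T p. \<forall>s\<in>{0..T}. residual K p u s \<in> H) \<and>
         (\<forall>u\<in>L1_vec T p. u \<in> class_U0 T p \<longleftrightarrow> (\<forall>s\<in>{0..T}. residual K p u s = (\<lambda>_. 0)))"
proof -
  interpret density_curve T p
    using assms by unfold_locales
  interpret rkhs H ip "\<lambda>\<xi> \<eta>. K (\<xi> - \<eta>)" by fact
  have even: "K (- \<xi>) = K \<xi>" for \<xi>
    using A1_positive_definite unfolding positive_definite_def by blast
  \<comment> \<open>By evenness \<open>K\<close> is the kernel section at 0, hence an element of
    \<open>H\<close>, and the reproducing property bounds it.\<close>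
  have Kb: "\<bar>K \<xi>\<bar> \<le> nrm K * sqrt (K 0)" for \<xi>
    using eval_le[OF kernel_mem[of 0], of \<xi>] by (simp add: even)
  have F: "fourier K z = complex_of_real ((2 * pi) powr (- real DIM(real \<times> (real^'d)) / 2) * cos_transform K z)" for z
    by (rule fourier_eq_cos_transform[OF A1_integrable even])
  have dense: "closure {z. cos_transform K z \<noteq> 0} = UNIV"
    using A1_universal by (simp add: F)
  \<comment> \<open>Division by the normalising constant turns (A2) into a moment condition on the
    cosine transform.\<close>
  have "integrable lborel (\<lambda>z. (1 / (2 * pi) powr (- real DIM(real \<times> (real^'d)) / 2)) *
      Re (complex_of_real (1 + (norm z)\<^sup>2) * fourier K z))"
    using A2 by (intro integrable_mult_right integrable_Re)
  then have C: "integrable lborel (\<lambda>z. (1 + (norm z)\<^sup>2) * cos_transform K z)"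
    by (simp add: F)
  obtain K' where K': "C1b K K'"
    using cos_inversion_regularity(1)[OF A1_continuous Kb A1_integrable even C] by blast
  obtain B where B: "B \<ge> 0" "\<And>\<xi>. K 0 - K \<xi> \<le> B * (norm \<xi>)\<^sup>2"
    using cos_inversion_regularity(2)[OF A1_continuous Kb A1_integrable even C] by blast
  have "residual K p u s \<in> H" if u: "u \<in> L1_vec T p" and s: "s \<in> {0..T}" for u s
    using first_order_functional.\<Lambda>_translates_in_rkhs[OF is_first_order_functional[OF u s] H_rkhs K' even B(2,1)]
    by (simp flip: weak_form_def residual_eq_weak_form[OF u s K' even])
  moreover have "u \<in> class_U0 T p \<longleftrightarrow> (\<forall>s\<in>{0..T}. residual K p u s = (\<lambda>_. 0))" if "u \<in> L1_vec T p" for u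
    by (rule class_U0_iff_residual_zero[OF that K' A1_integrable even dense A3_weak_derivative])
  ultimately show ?thesis
    by blast
qed

end
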